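(* Let $\theta,\rho\in\mathbb{R}$ with $|\theta|<1$, $|\rho|<1$, let $(V_n)_{n\ge1}$ be a sequence of independent and identically distributed real random variables with zero mean, variance $\sigma^2>0$ and finite moment of order $4$, let the initial values $X_0,\varepsilon_0$ be arbitrary, and for all $n\ge1$ let $X_n=\theta X_{n-1}+\varepsilon_n$ and $\varepsilon_n=\rho\varepsilon_{n-1}+V_n$. Let $$\widehat{\theta}_n=\frac{\sum_{k=1}^n X_kX_{k-1}}{\sum_{k=1}^n X_{k-1}^2},\qquad \theta^*=\frac{\theta+\rho}{1+\theta\rho},\qquad \sigma_\theta^2=\frac{(1-\theta^2)(1-\theta\rho)(1-\rho^2)}{(1+\theta\rho)^3},$$ with $\sigma_\theta=\sqrt{\sigma_\theta^2}$. Then the quadratic strong law holds: $$\lim_{n\to\infty}\frac{1}{\log n}\sum_{k=1}^n\big(\widehat{\theta}_k-\theta^*\big)^2=\sigma_\theta^2\quad\text{almost surely}.$$ In addition, the law of iterated logarithm holds: $$\limsup_{n\to\infty}\Big(\frac{n}{2\log\log n}\Big)^{1/2}\big(\widehat{\theta}_n-\theta^*\big)=-\liminf_{n\to\infty}\Big(\frac{n}{2\log\log n}\Big)^{1/2}\big(\widehat{\theta}_n-\theta^*\big)=\sigma_\theta\quad\text{almost surely}.$$ Consequently, $$\limsup_{n\to\infty}\Big(\frac{n}{2\log\log n}\Big)\big(\widehat{\theta}_n-\theta^*\big)^2=\sigma_\theta^2\quad\text{almost surely}.$$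
   Context: $\widehat\theta_n$ is the least squares estimator of $\theta$. Convention: a quotient defining an estimator is read as $0$ if its denominator vanishes. *)

theory Defs
  imports "HOL-Probability.Probability"
begin

text \<open>Least squares estimator. Division by zero yields zero in HOL, which is the convention
  adopted for a vanishing denominator.\<close>

definition theta_hat :: "(nat \<Rightarrow> 'a \<Rightarrow> real) \<Rightarrow> nat \<Rightarrow> 'a \<Rightarrow> real" where
  "theta_hat X n \<omega> = (\<Sum>k=1..n. X k \<omega> * X (k - 1) \<omega>) / (\<Sum>k=1..n. (X (k - 1) \<omega>)\<^sup>2)"

definition theta_star :: "real \<Rightarrow> real \<Rightarrow> real" where
  "theta_star \<theta> \<rho> = (\<theta> + \<rho>) / (1 + \<theta> * \<rho>)"

definition sigma_theta_sq :: "real \<Rightarrow> real \<Rightarrow> real" where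
  "sigma_theta_sq \<theta> \<rho> = ((1 - \<theta>\<^sup>2) * (1 - \<theta> * \<rho>) * (1 - \<rho>\<^sup>2)) / (1 + \<theta> * \<rho>) ^ 3"

definition sigma_theta :: "real \<Rightarrow> real \<Rightarrow> real" where
  "sigma_theta \<theta> \<rho> = sqrt (sigma_theta_sq \<theta> \<rho>)"

end

theory Submission
  imports Defs "HOL-Real_Asymp.Real_Asymp"
begin

text \<open>
  Write \<open>S n\<close> for the sum of the squares \<open>(X (k - 1))^2\<close> over \<open>1 \<le> k \<le> n\<close>.  Multiplying the second order recursion for \<open>X\<close> by the
  previous value and summing gives
  \<open>(1 + \<theta> * \<rho>) * (theta_hat n - theta_star) * S n = M n + r n\<close>, where \<open>M n\<close> is the sum of \<open>V k * Y (k - 1)\<close>, the process \<open>Y\<close> solves the same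
  recursions as \<open>X\<close> but starts from zero, and \<open>r n\<close> is \<open>o(sqrt n)\<close> (\<open>normal_equation\<close>, \<open>err_eq\<close>, \<open>remainder_small\<close>).  The initial values contribute
  only a bounded term, path by path, because the recursions are stable.  The denominators satisfy \<open>S n / n \<longlonglongrightarrow> A * \<sigma>^2\<close>, where
  \<open>A = var_ratio \<theta> \<rho>\<close> (\<open>X_square_law\<close>).  All three claims thus become limit theorems for the martingale \<open>M\<close>, whose increments have bounded fourth
  moments and a conditional variance with mean value \<open>s^2 = \<sigma>^4 * A\<close>.

  The conditional variance is \<open>\<sigma>^2 * Y^2\<close>.  A quadratic form in the state solves the Poisson equation for \<open>Y^2\<close> (\<open>poisson_equation\<close>): up to
  martingale increments and telescoping terms, \<open>Y^2\<close> equals a multiple of the squared noise.  This yields the law of large numbers, and with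
  summation by parts it also yields \<open>heat_comparison\<close>: expectations of smooth functions of \<open>M N / sqrt N\<close> are compared with the heat flow of variance
  \<open>s^2\<close>, with an error of order \<open>1 / sqrt N\<close>.  Such an error is negligible on the scale of the iterated logarithm, where
  probabilities are powers of \<open>ln N\<close>.

  For the upper half the test function is \<open>ln (1 + exp z)\<close>.  It behaves like an exponential in the tail, has bounded derivatives and is convex,
  so that Doob's maximal inequality applies (\<open>maximal_tail\<close>); the Borel-Cantelli lemma along a geometric sequence of times finishes the
  argument (\<open>upper_LIL\<close>).  For the lower half the test function is a Gaussian bump, whose heat flow is explicit (\<open>lower_tail\<close>).  Restarting the process
  from zero at the times \<open>Q^j\<close> gives independent block sums, to which the second Borel-Cantelli lemma applies (\<open>block_sums_large\<close>), and
  the restart changes \<open>M\<close> by \<open>O(sqrt n)\<close> only, since the noise grows more slowly than \<open>n powr (1/4)\<close> (\<open>block_restart\<close>, \<open>lower_LIL\<close>).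

  The quadratic strong law follows from the telescoping sum of \<open>M n ^ 2 / n\<close>: the sum of \<open>M k ^ 2 / (k * (k + 1))\<close> equals the logarithmic average of
  the squared increments, up to a boundary term that the law of the iterated logarithm controls and a martingale that is \<open>o(ln n)\<close>
  (\<open>martingale_quadratic_law\<close>).
\<close>

section \<open>Fourth moments\<close>

text \<open>Products of at most four such variables are integrable; the noise, the process and the martingale are all of
  this kind.\<close>
definition (in prob_space) L4 :: "('a \<Rightarrow> real) \<Rightarrow> bool" where
  "L4 X \<longleftrightarrow> X \<in> borel_measurable M \<and> integrable M (\<lambda>\<omega>. X \<omega> ^ 4)"

lemma quartic_ineqs:
  fixes x y :: real
  shows "\<bar>x\<bar> \<le> 1 + x^4" "x^2 \<le> 1 + x^4" "\<bar>x\<bar>^3 \<le> 1 + x^4" "(x+y)^4 \<le> 8*(x^4+y^4)" "x^2*y^2 \<le> x^4+y^4"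
proof -
  have sq: "x^4 = (x^2)^2" for x :: real by (simp flip: power_mult)
  show 2: "x^2 \<le> 1 + x^4" for x :: real
  proof -
    have "2 * x^2 \<le> x^4 + 1" using zero_le_power2[of "x^2 - 1"] unfolding sq power2_diff by simp
    moreover have "0 \<le> x^2" by simp
    ultimately show ?thesis by linarith
  qed
  show "\<bar>x\<bar> \<le> 1 + x^4" for x :: real
  proof (cases "\<bar>x\<bar> \<le> 1")
    case False
    hence "\<bar>x\<bar>^1 \<le> \<bar>x\<bar>^4" by (intro power_increasing) auto
    thus ?thesis by simp
  qed (auto intro: order_trans)
  show "\<bar>x\<bar>^3 \<le> 1 + x^4"
  proof (cases "\<bar>x\<bar> \<le> 1")
    case True
    hence "\<bar>x\<bar>^3 \<le> 1" by (intro power_le_one) auto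
    thus ?thesis by (auto intro: order_trans)
  next
    case False
    hence "\<bar>x\<bar>^3 \<le> \<bar>x\<bar>^4" by (intro power_increasing) auto
    thus ?thesis by simp
  qed
  show 5: "x^2*y^2 \<le> x^4+y^4" for x y :: real
  proof -
    have "2 * (x^2 * y^2) \<le> x^4 + y^4"
      using zero_le_power2[of "x^2 - y^2"] unfolding sq power2_diff by simp
    moreover have "0 \<le> x^2 * y^2" by simp
    ultimately show ?thesis by linarith
  qed
  have "(x+y)^2 \<le> 2*(x^2+y^2)" using zero_le_power2[of "x-y"] by (simp add: power2_eq_square algebra_simps)
  hence "((x+y)^2)^2 \<le> (2*(x^2+y^2))^2" by (intro power_mono) auto
  also have "\<dots> \<le> 8*((x^2)^2+(y^2)^2)"
    using zero_le_power2[of "x^2-y^2"] by (simp add: power2_eq_square algebra_simps)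
  finally show "(x+y)^4 \<le> 8*(x^4+y^4)" by (simp flip: power_mult)
qed

context prob_space
begin

lemma L4_bound:
  assumes "L4 X" "L4 Y" "f \<in> borel_measurable M"
    and "\<And>\<omega>. \<omega> \<in> space M \<Longrightarrow> \<bar>f \<omega>\<bar> \<le> c * (1 + X \<omega>^4 + Y \<omega>^4)"
  shows "integrable M f"
proof (rule Bochner_Integration.integrable_bound)
  show "integrable M (\<lambda>\<omega>. c * (1 + X \<omega>^4 + Y \<omega>^4))"
    using assms by (auto simp: L4_def)
  show "AE \<omega> in M. norm (f \<omega>) \<le> norm (c * (1 + X \<omega>^4 + Y \<omega>^4))"
    using assms(4) by (intro AE_I2) force
qed (use assms in auto)

lemma L4_int1: "L4 X \<Longrightarrow> integrable M X"
  using quartic_ineqs(1) by (intro L4_bound[of X "\<lambda>_. 0" _ 1]) (auto simp: L4_def)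
lemma L4_int2: "L4 X \<Longrightarrow> integrable M (\<lambda>\<omega>. (X \<omega>)^2)"
  using quartic_ineqs(2) by (intro L4_bound[of X "\<lambda>_. 0" _ 1]) (auto simp: L4_def)
lemma L4_int3: "L4 X \<Longrightarrow> integrable M (\<lambda>\<omega>. \<bar>X \<omega>\<bar>^3)"
  using quartic_ineqs(3) by (intro L4_bound[of X "\<lambda>_. 0" _ 1]) (auto simp: L4_def)
lemma L4_int4: "L4 X \<Longrightarrow> integrable M (\<lambda>\<omega>. (X \<omega>)^4)" by (simp add: L4_def)
lemma L4_mult2: "L4 X \<Longrightarrow> L4 Y \<Longrightarrow> integrable M (\<lambda>\<omega>. (X \<omega>)^2 * (Y \<omega>)^2)"
  using quartic_ineqs(5) by (intro L4_bound[of X Y _ 1]) (auto simp: L4_def add.assoc intro: add_increasing)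
lemma L4_add: assumes "L4 X" "L4 Y" shows "L4 (\<lambda>\<omega>. X \<omega> + Y \<omega>)"
proof -
  have "integrable M (\<lambda>\<omega>. (X \<omega> + Y \<omega>)^4)"
  proof (rule L4_bound[OF assms, of _ 8])
    fix \<omega>
    have "\<bar>(X \<omega> + Y \<omega>)^4\<bar> \<le> 8 * (X \<omega>^4 + Y \<omega>^4)" using quartic_ineqs(4)[of "X \<omega>" "Y \<omega>"] by simp
    thus "\<bar>(X \<omega> + Y \<omega>)^4\<bar> \<le> 8 * (1 + X \<omega>^4 + Y \<omega>^4)" by simp
  qed (use assms in \<open>auto simp: L4_def\<close>)
  thus ?thesis using assms by (auto simp: L4_def)
qed
lemma L4_cmult: "L4 X \<Longrightarrow> L4 (\<lambda>\<omega>. c * X \<omega>)"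
  by (auto simp: L4_def power_mult_distrib)
lemma L4_const: "L4 (\<lambda>_. c)"
  by (auto simp: L4_def)
lemma L4_sum: "(\<And>i. i \<in> I \<Longrightarrow> L4 (X i)) \<Longrightarrow> L4 (\<lambda>\<omega>. \<Sum>i\<in>I. X i \<omega>)"
  by (induction I rule: infinite_finite_induct) (auto simp: L4_const intro!: L4_add)

end

text \<open>The first order autoregression started from zero.  The two-parameter process of the theorem is the
  composition \<open>ar \<theta> (ar \<rho> v)\<close>, so that every estimate for one autoregression is used twice.\<close>
fun ar :: "real \<Rightarrow> (nat \<Rightarrow> real) \<Rightarrow> nat \<Rightarrow> real" where
  "ar a w 0 = 0"
| "ar a w (Suc n) = a * ar a w n + w (Suc n)"

text \<open>Convexity of the fourth power, with weights \<open>\<bar>a\<bar>\<close> and \<open>1 - \<bar>a\<bar>\<close>.  The factor \<open>\<bar>a\<bar> < 1\<close> in front of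
  \<open>x^4\<close> is what lets fourth moments stay bounded along an autoregression.\<close>
lemma quartic_contraction:
  fixes a x w :: real
  assumes a: "\<bar>a\<bar> < 1"
  shows "(a * x + w)^4 \<le> \<bar>a\<bar> * x^4 + w^4 / (1 - \<bar>a\<bar>)^3"
proof -
  have "convex_on UNIV (\<lambda>x::real. x^4)" by (rule convex_power_even) auto
  from convex_onD[OF this, of "1 - \<bar>a\<bar>" "sgn a * x" "w / (1 - \<bar>a\<bar>)"] a
  have "(\<bar>a\<bar> * (sgn a * x) + (1 - \<bar>a\<bar>) * (w / (1 - \<bar>a\<bar>)))^4
     \<le> \<bar>a\<bar> * (sgn a * x)^4 + (1 - \<bar>a\<bar>) * (w / (1 - \<bar>a\<bar>))^4" by simp
  moreover have "\<bar>a\<bar> * (sgn a * x) = a * x" by (simp add: sgn_if abs_if)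
  moreover have "\<bar>a\<bar> * (sgn a * x)^4 = \<bar>a\<bar> * x^4" by (simp add: sgn_if)
  moreover have "(1 - \<bar>a\<bar>) * (w / (1 - \<bar>a\<bar>)) = w" using a by simp
  moreover have "(1 - \<bar>a\<bar>) * (w / (1 - \<bar>a\<bar>))^4 = w^4 / (1 - \<bar>a\<bar>)^3"
    using power_Suc[of "1 - \<bar>a\<bar>" 3] a by (simp add: power_divide)
  ultimately show ?thesis by simp
qed

section \<open>The filtration of the noise\<close>

text \<open>The hypotheses are inherited by the shifted noise \<open>\<lambda>i. V (m + i)\<close> with the same constants \<open>\<sigma>\<close> and \<open>K\<close>, so
  that every bound that depends on \<open>\<sigma>\<close> and \<open>K\<close> alone is uniform over all restarted blocks.\<close>
locale centred_noise = prob_space M for M :: "'a measure" +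
  fixes V :: "nat \<Rightarrow> 'a \<Rightarrow> real" and \<sigma> K :: real
  assumes V_indep: "indep_vars (\<lambda>_. borel) V {1..}"
    and V_mean: "n \<ge> 1 \<Longrightarrow> expectation (V n) = 0"
    and V_var: "n \<ge> 1 \<Longrightarrow> expectation (\<lambda>\<omega>. (V n \<omega>)^2) = \<sigma>^2"
    and V_int4: "n \<ge> 1 \<Longrightarrow> integrable M (\<lambda>\<omega>. V n \<omega> ^ 4)"
    and V_mom4: "n \<ge> 1 \<Longrightarrow> expectation (\<lambda>\<omega>. V n \<omega> ^ 4) \<le> K"
begin

lemma V_meas [measurable]: "V (Suc n) \<in> borel_measurable M"
  using V_indep by (auto simp: indep_vars_def)

lemma V_meas': "n \<ge> 1 \<Longrightarrow> V n \<in> borel_measurable M"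
  using V_indep by (auto simp: indep_vars_def)

text \<open>The sigma-algebra generated by the noise variables with indices in \<open>J\<close>, pulled back from the product
  space.  Sets of this form for disjoint index sets are independent, both for the past against the next noise
  variable and for the blocks used in the lower half of the law of the iterated logarithm.\<close>
definition sig :: "nat set \<Rightarrow> 'a measure" where
  "sig J = vimage_algebra (space M) (\<lambda>\<omega>. \<lambda>i\<in>J. V i \<omega>) (PiM J (\<lambda>_. borel))"

lemma space_sig [simp]: "space (sig J) = space M"
  by (simp add: sig_def)

lemma sets_sig: "sets (sig J) = {(\<lambda>\<omega>. \<lambda>i\<in>J. V i \<omega>) -` A \<inter> space M | A. A \<in> sets (PiM J (\<lambda>_. borel))}"
  unfolding sig_def by (rule sets_vimage_algebra2) (auto simp: space_PiM)

lemma V_sig: assumes "i \<in> J" shows "V i \<in> borel_measurable (sig J)"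
proof -
  have "(\<lambda>\<omega>. \<lambda>i\<in>J. V i \<omega>) \<in> measurable (sig J) (PiM J (\<lambda>_. borel))"
    unfolding sig_def by (rule measurable_vimage_algebra1) (auto simp: space_PiM)
  moreover have "(\<lambda>x. x i) \<in> measurable (PiM J (\<lambda>_. borel)) (borel :: real measure)"
    using assms by measurable
  ultimately have "(\<lambda>\<omega>. (\<lambda>i\<in>J. V i \<omega>) i) \<in> borel_measurable (sig J)"
    by (rule measurable_compose)
  thus ?thesis using assms by (simp cong: measurable_cong)
qed

lemma sets_sig_mono:
  assumes "J \<subseteq> L" shows "sets (sig J) \<subseteq> sets (sig L)"
proof -
  have "(\<lambda>\<omega>. \<lambda>i\<in>J. V i \<omega>) \<in> measurable (sig L) (PiM J (\<lambda>_. borel))"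
    using assms by (intro measurable_restrict V_sig) auto
  from measurable_sets[OF this] show ?thesis
    by (auto simp: sets_sig[of J])
qed

lemma sets_sig_events:
  assumes "J \<subseteq> {1..}" shows "sets (sig J) \<subseteq> events"
proof -
  have "(\<lambda>\<omega>. \<lambda>i\<in>J. V i \<omega>) \<in> measurable M (PiM J (\<lambda>_. borel))"
    using assms by (intro measurable_restrict V_meas') auto
  from measurable_sets[OF this] show ?thesis
    by (auto simp: sets_sig[of J])
qed

lemma measurable_sig_mono: "J \<subseteq> L \<Longrightarrow> f \<in> borel_measurable (sig J) \<Longrightarrow> f \<in> borel_measurable (sig L)"
  using sets_sig_mono[of J L] by (auto simp: measurable_def)

lemma measurable_sig_M: "J \<subseteq> {1..} \<Longrightarrow> f \<in> borel_measurable (sig J) \<Longrightarrow> f \<in> borel_measurable M"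
  using sets_sig_events[of J] by (auto simp: measurable_def)

lemma indep_sets_sig:
  assumes "disjoint_family_on J L" "\<And>l. l \<in> L \<Longrightarrow> J l \<subseteq> {1..}"
  shows "indep_sets (\<lambda>l. sets (sig (J l))) L"
proof -
  have "indep_vars (\<lambda>j. PiM (J j) (\<lambda>_. borel)) (\<lambda>j \<omega>. restrict (\<lambda>i. V i \<omega>) (J j)) L"
    by (rule indep_vars_restrict[OF V_indep]) (use assms in auto)
  thus ?thesis
    unfolding indep_vars_def2 sets_sig by simp
qed

lemma indep_var_sig:
  fixes X Y :: "'a \<Rightarrow> real"
  assumes "I \<inter> J = {}" "I \<subseteq> {1..}" "J \<subseteq> {1..}"
    and X: "X \<in> borel_measurable (sig I)" and Y: "Y \<in> borel_measurable (sig J)"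
  shows "indep_var borel X borel Y"
proof -
  have "indep_sets (\<lambda>l. sets (sig (case_bool I J l))) UNIV"
    by (rule indep_sets_sig) (use assms in \<open>auto simp: disjoint_family_on_def split: bool.splits\<close>)
  moreover have "(\<lambda>l. sets (sig (case_bool I J l))) = case_bool (sets (sig I)) (sets (sig J))"
    by (auto simp: fun_eq_iff split: bool.splits)
  ultimately have *: "indep_set (sets (sig I)) (sets (sig J))" by (simp add: indep_set_def)
  have XM: "X \<in> borel_measurable M" "Y \<in> borel_measurable M"
    using measurable_sig_M assms by blast+
  have sub: "sigma_sets (space M) {f -` A \<inter> space M |A. A \<in> sets borel} \<subseteq> sets (sig L)"
    if "f \<in> borel_measurable (sig L)" for f :: "'a \<Rightarrow> real" and L
  proof -
    have "{f -` A \<inter> space M |A. A \<in> sets borel} \<subseteq> sets (sig L)"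
      using measurable_sets[OF that] by auto
    thus ?thesis using sets.sigma_sets_subset[of _ "sig L"] by simp
  qed
  have "indep_set (sigma_sets (space M) {X -` A \<inter> space M |A. A \<in> sets borel})
     (sigma_sets (space M) {Y -` A \<inter> space M |A. A \<in> sets borel})"
    unfolding indep_set_def
    by (rule indep_sets_mono_sets[OF *[unfolded indep_set_def]])
       (use sub[OF X] sub[OF Y] in \<open>simp split: bool.splits\<close>)
  thus ?thesis
    unfolding indep_var_eq using XM by simp
qed

abbreviation "Past n \<equiv> sig {1..n}"

lemma Past_M: "f \<in> borel_measurable (Past n) \<Longrightarrow> f \<in> borel_measurable M"
  by (rule measurable_sig_M) auto

lemma Past_mono: "m \<le> n \<Longrightarrow> f \<in> borel_measurable (Past m) \<Longrightarrow> f \<in> borel_measurable (Past n)"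
  by (rule measurable_sig_mono) auto

text \<open>All conditional expectations of the proof are replaced by this rule: a variable of the past factors out of
  the expectation of a function of the next noise variable.\<close>
lemma expectation_past_mult:
  fixes Z :: "'a \<Rightarrow> real" and h :: "real \<Rightarrow> real"
  assumes Z: "Z \<in> borel_measurable (Past n)" "integrable M Z"
    and h: "h \<in> borel_measurable borel" "integrable M (\<lambda>\<omega>. h (V (Suc n) \<omega>))"
  shows "integrable M (\<lambda>\<omega>. Z \<omega> * h (V (Suc n) \<omega>))"
    and "expectation (\<lambda>\<omega>. Z \<omega> * h (V (Suc n) \<omega>)) = expectation Z * expectation (\<lambda>\<omega>. h (V (Suc n) \<omega>))"
proof -
  have "V (Suc n) \<in> borel_measurable (sig {Suc n})" by (rule V_sig) auto
  hence "(\<lambda>\<omega>. h (V (Suc n) \<omega>)) \<in> borel_measurable (sig {Suc n})"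
    using h(1) by measurable
  hence ind: "indep_var borel Z borel (\<lambda>\<omega>. h (V (Suc n) \<omega>))"
    by (intro indep_var_sig[OF _ _ _ Z(1)]) auto
  show "integrable M (\<lambda>\<omega>. Z \<omega> * h (V (Suc n) \<omega>))"
    and "expectation (\<lambda>\<omega>. Z \<omega> * h (V (Suc n) \<omega>)) = expectation Z * expectation (\<lambda>\<omega>. h (V (Suc n) \<omega>))"
    using indep_var_integrable[OF ind Z(2) h(2)] indep_var_lebesgue_integral[OF ind Z(2) h(2)] by simp_all
qed

lemma L4_V: "L4 (V (Suc n))"
  using V_int4[of "Suc n"] by (auto simp: L4_def)

lemma K_nonneg: "K \<ge> 0"
  using V_mom4[of 1] order_trans[OF Bochner_Integration.integral_nonneg[of M "\<lambda>\<omega>. V 1 \<omega>^4"]] by auto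

lemma past_orthogonal:
  assumes Z: "Z \<in> borel_measurable (Past n)" "integrable M Z"
  shows "integrable M (\<lambda>\<omega>. Z \<omega> * V (Suc n) \<omega>)" "expectation (\<lambda>\<omega>. Z \<omega> * V (Suc n) \<omega>) = 0"
  using expectation_past_mult[OF Z, of "\<lambda>x. x"] V_mean[of "Suc n"] L4_int1[OF L4_V] by auto

lemma past_square:
  assumes Z: "Z \<in> borel_measurable (Past n)" "integrable M Z"
  shows "integrable M (\<lambda>\<omega>. Z \<omega> * (V (Suc n) \<omega>)^2)"
    "expectation (\<lambda>\<omega>. Z \<omega> * (V (Suc n) \<omega>)^2) = \<sigma>^2 * expectation Z"
  using expectation_past_mult[OF Z, of "\<lambda>x. x^2"] V_var[of "Suc n"] L4_int2[OF L4_V] by auto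

lemma past_fourth:
  assumes Z: "Z \<in> borel_measurable (Past n)" "integrable M Z" "\<And>\<omega>. Z \<omega> \<ge> 0"
  shows "integrable M (\<lambda>\<omega>. Z \<omega> * (V (Suc n) \<omega>)^4)"
    "expectation (\<lambda>\<omega>. Z \<omega> * (V (Suc n) \<omega>)^4) \<le> K * expectation Z"
proof -
  show "integrable M (\<lambda>\<omega>. Z \<omega> * (V (Suc n) \<omega>)^4)"
    using expectation_past_mult[OF Z(1,2), of "\<lambda>x. x^4"] V_int4[of "Suc n"] by auto
  have "expectation (\<lambda>\<omega>. Z \<omega> * (V (Suc n) \<omega>)^4) = expectation Z * expectation (\<lambda>\<omega>. (V (Suc n) \<omega>)^4)"
    using expectation_past_mult[OF Z(1,2), of "\<lambda>x. x^4"] V_int4[of "Suc n"] by auto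
  also have "\<dots> \<le> expectation Z * K"
    using Z(3) V_mom4[of "Suc n"] by (intro mult_left_mono) auto
  finally show "expectation (\<lambda>\<omega>. Z \<omega> * (V (Suc n) \<omega>)^4) \<le> K * expectation Z" by (simp add: mult.commute)
qed

text \<open>The inequality of Doob for a nonnegative submartingale.  Induction on the horizon: the event grows by the
  paths that exceed \<open>c\<close> for the first time, and the submartingale property moves the part already collected one
  step forward, so that no stopping time is needed.\<close>
lemma maximal_inequality:
  fixes \<Phi> :: "nat \<Rightarrow> 'a \<Rightarrow> real"
  assumes adapted: "\<And>n. \<Phi> n \<in> borel_measurable (Past n)"
    and int: "\<And>n. integrable M (\<Phi> n)"
    and nonneg: "\<And>n \<omega>. \<Phi> n \<omega> \<ge> 0"
    and sub: "\<And>n A. n < N \<Longrightarrow> A \<in> sets (Past n) \<Longrightarrow>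
       expectation (\<lambda>\<omega>. indicator A \<omega> * \<Phi> n \<omega>) \<le> expectation (\<lambda>\<omega>. indicator A \<omega> * \<Phi> (Suc n) \<omega>)"
    and c: "c > 0"
  shows "prob {\<omega>\<in>space M. \<exists>n\<le>N. \<Phi> n \<omega> \<ge> c} \<le> expectation (\<Phi> N) / c"
proof -
  define A where "A m = {\<omega>\<in>space M. \<exists>n\<le>m. \<Phi> n \<omega> \<ge> c}" for m
  have A_past: "A m \<in> sets (Past m)" for m
  proof -
    have "\<Phi> n \<in> borel_measurable (Past m)" if "n \<le> m" for n
      using adapted Past_mono that by blast
    hence "{\<omega>\<in>space (Past m). c \<le> \<Phi> n \<omega>} \<in> sets (Past m)" if "n \<le> m" for n
      using that by (intro borel_measurable_le) auto
    moreover have "A m = (\<Union>n\<in>{..m}. {\<omega>\<in>space (Past m). c \<le> \<Phi> n \<omega>})"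
      by (auto simp: A_def)
    ultimately show ?thesis by (auto intro!: sets.finite_UN)
  qed
  have A_ev: "A m \<in> events" for m
    using A_past sets_sig_events[of "{1..m}"] by auto
  have iA: "integrable M (\<lambda>\<omega>. indicator B \<omega> * \<Phi> n \<omega>)" if "B \<in> events" for B n
    using integrable_mult_indicator[OF that int[of n]] by simp
  have "m \<le> N \<Longrightarrow> c * prob (A m) \<le> expectation (\<lambda>\<omega>. indicator (A m) \<omega> * \<Phi> m \<omega>)" for m
  proof (induction m)
    case 0
    have "c * prob (A 0) = expectation (\<lambda>\<omega>. c * indicator (A 0) \<omega>)"
      using A_ev[of 0] by (simp add: measure_def)
    also have "\<dots> \<le> expectation (\<lambda>\<omega>. indicator (A 0) \<omega> * \<Phi> 0 \<omega>)"
      by (intro integral_mono iA A_ev integrable_mult_right integrable_real_indicator)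
         (auto simp: A_def indicator_def emeasure_eq_measure)
    finally show ?case .
  next
    case (Suc m)
    define B where "B = {\<omega>\<in>space M. \<Phi> (Suc m) \<omega> \<ge> c} - A m"
    have phiM: "\<Phi> (Suc m) \<in> borel_measurable M" using adapted Past_M by blast
    have "{\<omega>\<in>space M. \<Phi> (Suc m) \<omega> \<ge> c} \<in> events"
      using phiM by (intro borel_measurable_le) auto
    hence B_ev: "B \<in> events" using A_ev by (auto simp: B_def)
    have split: "A (Suc m) = A m \<union> B" by (auto simp: A_def B_def le_Suc_eq)
    have dis: "A m \<inter> B = {}" by (auto simp: B_def)
    have "c * prob (A (Suc m)) = c * prob (A m) + c * prob B"
      unfolding split using finite_measure_Union[OF A_ev B_ev dis] by (simp add: algebra_simps)
    also have "c * prob (A m) \<le> expectation (\<lambda>\<omega>. indicator (A m) \<omega> * \<Phi> m \<omega>)"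
      using Suc by simp
    also have "\<dots> \<le> expectation (\<lambda>\<omega>. indicator (A m) \<omega> * \<Phi> (Suc m) \<omega>)"
      using Suc.prems by (intro sub A_past) auto
    also have "c * prob B = expectation (\<lambda>\<omega>. c * indicator B \<omega>)"
      using B_ev by (simp add: measure_def)
    also have "\<dots> \<le> expectation (\<lambda>\<omega>. indicator B \<omega> * \<Phi> (Suc m) \<omega>)"
      by (intro integral_mono iA B_ev integrable_mult_right integrable_real_indicator)
         (auto simp: B_def indicator_def emeasure_eq_measure)
    finally have "c * prob (A (Suc m)) \<le> expectation (\<lambda>\<omega>. indicator (A m) \<omega> * \<Phi> (Suc m) \<omega>)
        + expectation (\<lambda>\<omega>. indicator B \<omega> * \<Phi> (Suc m) \<omega>)" by simp
    also have "\<dots> = expectation (\<lambda>\<omega>. indicator (A m) \<omega> * \<Phi> (Suc m) \<omega> + indicator B \<omega> * \<Phi> (Suc m) \<omega>)"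
      using iA[OF A_ev] iA[OF B_ev] by simp
    also have "\<dots> = expectation (\<lambda>\<omega>. indicator (A (Suc m)) \<omega> * \<Phi> (Suc m) \<omega>)"
      unfolding split using dis by (intro Bochner_Integration.integral_cong) (auto simp: indicator_def)
    finally show ?case .
  qed
  hence "c * prob (A N) \<le> expectation (\<lambda>\<omega>. indicator (A N) \<omega> * \<Phi> N \<omega>)" by simp
  also have "\<dots> \<le> expectation (\<Phi> N)"
    using nonneg[of N] by (intro integral_mono iA A_ev int) (auto simp: indicator_def)
  finally show ?thesis using c by (simp add: A_def field_simps)
qed

lemma ar_fourth_moment:
  assumes a: "\<bar>a\<bar> < 1" and c: "c \<ge> 0"
    and W: "\<And>n. n \<ge> 1 \<Longrightarrow> L4 (W n)" "\<And>n. n \<ge> 1 \<Longrightarrow> expectation (\<lambda>\<omega>. W n \<omega> ^ 4) \<le> c"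
  shows "L4 (\<lambda>\<omega>. ar a (\<lambda>i. W i \<omega>) n) \<and> expectation (\<lambda>\<omega>. ar a (\<lambda>i. W i \<omega>) n ^ 4) \<le> c / (1 - \<bar>a\<bar>)^4"
proof (induction n)
  case 0
  show ?case using a c by (auto simp: L4_def)
next
  case (Suc n)
  let ?x = "\<lambda>\<omega>. ar a (\<lambda>i. W i \<omega>) n"
  let ?w = "W (Suc n)"
  have L: "L4 (\<lambda>\<omega>. a * ?x \<omega> + ?w \<omega>)"
    using Suc W by (intro L4_add L4_cmult) auto
  have "expectation (\<lambda>\<omega>. (a * ?x \<omega> + ?w \<omega>)^4)
      \<le> expectation (\<lambda>\<omega>. \<bar>a\<bar> * ?x \<omega>^4 + ?w \<omega>^4 / (1 - \<bar>a\<bar>)^3)"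
    using Suc W L quartic_contraction[OF a] by (intro integral_mono) (auto simp: L4_def)
  also have "\<dots> = \<bar>a\<bar> * expectation (\<lambda>\<omega>. ?x \<omega>^4) + expectation (\<lambda>\<omega>. ?w \<omega>^4) / (1 - \<bar>a\<bar>)^3"
    using Suc W by (subst Bochner_Integration.integral_add) (auto simp: L4_def)
  also have "\<dots> \<le> \<bar>a\<bar> * (c / (1 - \<bar>a\<bar>)^4) + c / (1 - \<bar>a\<bar>)^3"
    using Suc W a by (intro add_mono mult_left_mono divide_right_mono) auto
  also have "\<dots> = c / (1 - \<bar>a\<bar>)^4"
  proof -
    define d where "d = 1 - \<bar>a\<bar>"
    have d: "d > 0" and ad: "\<bar>a\<bar> = 1 - d" using a by (auto simp: d_def)
    have "(1 - d) * (c / d^4) + c / d^3 = c / d^4"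
      using d by (simp add: field_simps power_numeral_reduce)
    thus ?thesis by (simp add: d_def)
  qed
  finally show ?case using L by simp
qed

end

section \<open>The zero-start process and its Poisson equation\<close>

text \<open>The stationary variance of the process divided by the variance of the noise.\<close>
definition var_ratio :: "real \<Rightarrow> real \<Rightarrow> real" where
  "var_ratio \<theta> \<rho> = (1 + \<theta>*\<rho>) / ((1 - \<theta>^2) * (1 - \<theta>*\<rho>) * (1 - \<rho>^2))"

text \<open>The coefficients of the quadratic form \<open>corrector\<close> in the state \<open>(y, e)\<close> that solves the Poisson
  equation for \<open>y^2\<close>; \<open>poisson_lin\<close> is the coefficient of the term that is linear in the new noise.\<close>
definition corr_ye :: "real \<Rightarrow> real \<Rightarrow> real" where
  "corr_ye \<theta> \<rho> = 2*\<theta>*\<rho> / (1 - \<theta>*\<rho>)"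
definition corr_ee :: "real \<Rightarrow> real \<Rightarrow> real" where
  "corr_ee \<theta> \<rho> = \<rho>^2 * (1 + corr_ye \<theta> \<rho>) / (1 - \<rho>^2)"
definition corrector :: "real \<Rightarrow> real \<Rightarrow> real \<Rightarrow> real \<Rightarrow> real" where
  "corrector \<theta> \<rho> y e = (y^2 + corr_ye \<theta> \<rho> * y * e + corr_ee \<theta> \<rho> * e^2) / (1 - \<theta>^2)"
definition poisson_lin :: "real \<Rightarrow> real \<Rightarrow> real \<Rightarrow> real \<Rightarrow> real" where
  "poisson_lin \<theta> \<rho> y e = ((2*\<theta> + corr_ye \<theta> \<rho> * \<theta>) * y + (2*\<rho> + 2*\<rho>*corr_ye \<theta> \<rho> + 2*\<rho>*corr_ee \<theta> \<rho>) * e) / (1 - \<theta>^2)"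

lemma stable_pos:
  fixes \<theta> \<rho> :: real
  assumes "\<bar>\<theta>\<bar> < 1" "\<bar>\<rho>\<bar> < 1"
  shows "1 - \<theta>^2 > 0" "1 - \<rho>^2 > 0" "1 - \<theta>*\<rho> > 0" "1 + \<theta>*\<rho> > 0"
proof -
  show "1 - \<theta>^2 > 0" "1 - \<rho>^2 > 0" using assms by (auto simp: abs_square_less_1)
  have "\<bar>\<theta>*\<rho>\<bar> < 1" using assms mult_strict_mono'[of "\<bar>\<theta>\<bar>" 1 "\<bar>\<rho>\<bar>" 1] by (simp add: abs_mult)
  thus "1 - \<theta>*\<rho> > 0" "1 + \<theta>*\<rho> > 0" by auto
qed

lemma var_ratio_pos: "\<bar>\<theta>\<bar> < 1 \<Longrightarrow> \<bar>\<rho>\<bar> < 1 \<Longrightarrow> var_ratio \<theta> \<rho> > 0"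
  unfolding var_ratio_def using stable_pos by simp

text \<open>Along the recursion, \<open>y^2\<close> differs from a multiple of the squared noise by a martingale increment and an
  increment of the corrector.  Expanding \<open>y'^2\<close>, \<open>y'e'\<close> and \<open>e'^2\<close> gives three relations; the coefficients are chosen to
  eliminate \<open>y e\<close> and \<open>e^2\<close> from them.  The equation gives the law of large numbers for the sum of squares and also
  controls the conditional variance of the martingale in the comparison with the heat equation.\<close>
lemma poisson_equation:
  assumes "\<bar>\<theta>\<bar> < 1" "\<bar>\<rho>\<bar> < 1"
    and e': "e' = \<rho> * e + v" and y': "y' = \<theta> * y + e'"
  shows "y^2 = var_ratio \<theta> \<rho> * v^2 + poisson_lin \<theta> \<rho> y e * v - (corrector \<theta> \<rho> y' e' - corrector \<theta> \<rho> y e)"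
proof -
  note p = stable_pos[OF assms(1,2)]
  define c1 c2 where "c1 = corr_ye \<theta> \<rho>" and "c2 = corr_ee \<theta> \<rho>"
  have c1: "c1 * (1 - \<theta>*\<rho>) = 2*\<theta>*\<rho>" using p by (simp add: c1_def corr_ye_def)
  have c2: "c2 * (1 - \<rho>^2) = \<rho>^2 * (1 + c1)" using p by (simp add: c2_def c1_def corr_ee_def)
  have "(1 + c1 + c2) * (1 - \<rho>^2) = 1 + c1"
    using c2 by (simp add: algebra_simps)
  hence "(1 + c1 + c2) * (1 - \<rho>^2) * (1 - \<theta>*\<rho>) = 1 + \<theta>*\<rho>"
    using c1 by (simp add: algebra_simps)
  hence "1 + c1 + c2 = (1 + \<theta>*\<rho>) / ((1 - \<theta>*\<rho>) * (1 - \<rho>^2))"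
    using p by (subst eq_divide_eq) (auto simp: mult_ac)
  hence A: "(1 - \<theta>^2) * var_ratio \<theta> \<rho> = 1 + c1 + c2"
    using p by (simp add: var_ratio_def)
  have L: "(1 - \<theta>^2) * poisson_lin \<theta> \<rho> y e = (2*\<theta> + c1 * \<theta>) * y + (2*\<rho> + 2*\<rho>*c1 + 2*\<rho>*c2) * e"
    using p by (simp add: poisson_lin_def c1_def c2_def)
  have R: "(1 - \<theta>^2) * corrector \<theta> \<rho> a b = a^2 + c1*a*b + c2*b^2" for a b
    using p by (simp add: corrector_def c1_def c2_def)
  have "(1 - \<theta>^2) * (var_ratio \<theta> \<rho> * v^2 + poisson_lin \<theta> \<rho> y e * v - (corrector \<theta> \<rho> y' e' - corrector \<theta> \<rho> y e))
     = ((1 - \<theta>^2) * var_ratio \<theta> \<rho>) * v^2 + ((1 - \<theta>^2) * poisson_lin \<theta> \<rho> y e) * v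
       - ((1 - \<theta>^2) * corrector \<theta> \<rho> y' e' - (1 - \<theta>^2) * corrector \<theta> \<rho> y e)"
    by (simp add: algebra_simps)
  also have "\<dots> = (1 - \<theta>^2) * y^2"
  proof -
    have "((1 + c1 + c2) * v^2 + ((2*\<theta> + c1 * \<theta>) * y + (2*\<rho> + 2*\<rho>*c1 + 2*\<rho>*c2) * e) * v
       - ((y'^2 + c1*y'*e' + c2*e'^2) - (y^2 + c1*y*e + c2*e^2))) - (1 - \<theta>^2) * y^2
      = y * e * (c1 * (1 - \<theta>*\<rho>) - 2*\<theta>*\<rho>) + e^2 * (c2 * (1 - \<rho>^2) - \<rho>^2 * (1 + c1))"
      unfolding e' y' by (simp add: power2_eq_square algebra_simps)
    thus ?thesis unfolding A L R c1 c2 by simp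
  qed
  finally show ?thesis using p by simp
qed

text \<open>The bound is written out, not merely shown to exist, because it must not depend on which block of the noise
  the process is built from.\<close>
definition moment_bound :: "real \<Rightarrow> real \<Rightarrow> real \<Rightarrow> real" where
  "moment_bound \<theta> \<rho> K =
    (let KE = K / (1 - \<bar>\<rho>\<bar>)^4; KY = KE / (1 - \<bar>\<theta>\<bar>)^4; c = (1 + \<bar>corr_ye \<theta> \<rho>\<bar> + \<bar>corr_ee \<theta> \<rho>\<bar>) / (1 - \<theta>^2)
     in 1 + K * KY + 8 * c^2 * (KY + KE))"

locale ar_noise = centred_noise M V \<sigma> K for M :: "'a measure" and V \<sigma> K +
  fixes \<theta> \<rho> :: real
  assumes \<theta>: "\<bar>\<theta>\<bar> < 1" and \<rho>: "\<bar>\<rho>\<bar> < 1"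
begin

definition E :: "nat \<Rightarrow> 'a \<Rightarrow> real" where "E n \<omega> = ar \<rho> (\<lambda>i. V i \<omega>) n"
definition Y :: "nat \<Rightarrow> 'a \<Rightarrow> real" where "Y n \<omega> = ar \<theta> (\<lambda>i. E i \<omega>) n"
definition D :: "nat \<Rightarrow> 'a \<Rightarrow> real" where "D n \<omega> = V (Suc n) \<omega> * Y n \<omega>"
definition Mart :: "nat \<Rightarrow> 'a \<Rightarrow> real" where "Mart n \<omega> = (\<Sum>k<n. D k \<omega>)"
definition R :: "nat \<Rightarrow> 'a \<Rightarrow> real" where "R n \<omega> = corrector \<theta> \<rho> (Y n \<omega>) (E n \<omega>)"
definition Lin :: "nat \<Rightarrow> 'a \<Rightarrow> real" where "Lin n \<omega> = poisson_lin \<theta> \<rho> (Y n \<omega>) (E n \<omega>)"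

abbreviation "KE \<equiv> K / (1 - \<bar>\<rho>\<bar>)^4"
abbreviation "KY \<equiv> KE / (1 - \<bar>\<theta>\<bar>)^4"
abbreviation "A \<equiv> var_ratio \<theta> \<rho>"
abbreviation "\<Gamma> \<equiv> moment_bound \<theta> \<rho> K"

lemma E_0 [simp]: "E 0 \<omega> = 0" and E_Suc: "E (Suc n) \<omega> = \<rho> * E n \<omega> + V (Suc n) \<omega>"
  by (simp_all add: E_def)
lemma Y_0 [simp]: "Y 0 \<omega> = 0" and Y_Suc: "Y (Suc n) \<omega> = \<theta> * Y n \<omega> + E (Suc n) \<omega>"
  by (simp_all add: Y_def)
lemma Mart_0 [simp]: "Mart 0 \<omega> = 0" and Mart_Suc: "Mart (Suc n) \<omega> = Mart n \<omega> + D n \<omega>"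
  by (simp_all add: Mart_def)
lemma R_0 [simp]: "R 0 \<omega> = 0" by (simp add: R_def corrector_def)

lemma V_Past: "V (Suc n) \<in> borel_measurable (Past (Suc n))"
  by (rule V_sig) auto

lemma E_Past [measurable]: "E n \<in> borel_measurable (Past n)"
proof (induction n)
  case (Suc n)
  have "E n \<in> borel_measurable (Past (Suc n))" using Suc by (rule Past_mono[rotated]) simp
  hence "(\<lambda>\<omega>. \<rho> * E n \<omega> + V (Suc n) \<omega>) \<in> borel_measurable (Past (Suc n))"
    using V_Past by measurable
  thus ?case by (simp add: E_Suc[abs_def])
qed (simp add: E_def)

lemma Y_Past [measurable]: "Y n \<in> borel_measurable (Past n)"
proof (induction n)
  case (Suc n)
  have "Y n \<in> borel_measurable (Past (Suc n))" using Suc by (rule Past_mono[rotated]) simp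
  hence "(\<lambda>\<omega>. \<theta> * Y n \<omega> + E (Suc n) \<omega>) \<in> borel_measurable (Past (Suc n))"
    by measurable
  thus ?case by (simp add: Y_Suc[abs_def])
qed (simp add: Y_def)

lemma R_Past [measurable]: "R n \<in> borel_measurable (Past n)"
  unfolding R_def corrector_def by measurable

lemma Lin_Past [measurable]: "Lin n \<in> borel_measurable (Past n)"
  unfolding Lin_def poisson_lin_def by measurable

lemma D_Past: "D n \<in> borel_measurable (Past (Suc n))"
proof -
  have "Y n \<in> borel_measurable (Past (Suc n))" by (rule Past_mono[OF _ Y_Past]) simp
  thus ?thesis unfolding D_def using V_Past by measurable
qed

lemma Mart_Past [measurable]: "Mart n \<in> borel_measurable (Past n)"
  unfolding Mart_def
proof (rule borel_measurable_sum)
  fix k assume "k \<in> {..<n}"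
  thus "D k \<in> borel_measurable (Past n)" by (intro Past_mono[OF _ D_Past]) auto
qed

lemma E_M [measurable]: "E n \<in> borel_measurable M" by (rule Past_M) measurable
lemma Y_M [measurable]: "Y n \<in> borel_measurable M" by (rule Past_M) measurable
lemma R_M [measurable]: "R n \<in> borel_measurable M" by (rule Past_M) measurable
lemma Lin_M [measurable]: "Lin n \<in> borel_measurable M" by (rule Past_M) measurable
lemma Mart_M [measurable]: "Mart n \<in> borel_measurable M" by (rule Past_M) measurable
lemma D_M [measurable]: "D n \<in> borel_measurable M" by (rule Past_M[OF D_Past])

lemma KE_nonneg: "KE \<ge> 0" and KY_nonneg: "KY \<ge> 0"
  using K_nonneg by auto

lemma L4_E: "L4 (E n)" and mom_E: "expectation (\<lambda>\<omega>. E n \<omega>^4) \<le> KE"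
proof -
  have "L4 (V n)" if "n \<ge> 1" for n using that L4_V[of "n-1"] by simp
  from ar_fourth_moment[where n=n, OF \<rho> K_nonneg this V_mom4]
  show "L4 (E n)" "expectation (\<lambda>\<omega>. E n \<omega>^4) \<le> KE" by (auto simp: E_def[abs_def])
qed

lemma L4_Y: "L4 (Y n)" and mom_Y: "expectation (\<lambda>\<omega>. Y n \<omega>^4) \<le> KY"
  using ar_fourth_moment[where n=n, OF \<theta> KE_nonneg L4_E mom_E] by (auto simp: Y_def[abs_def])

lemma L4_Lin: "L4 (Lin n)"
proof -
  have eq: "Lin n = (\<lambda>\<omega>. ((2*\<theta> + corr_ye \<theta> \<rho> * \<theta>)/(1 - \<theta>^2)) * Y n \<omega>
      + ((2*\<rho> + 2*\<rho>*corr_ye \<theta> \<rho> + 2*\<rho>*corr_ee \<theta> \<rho>)/(1-\<theta>^2)) * E n \<omega>)"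
  proof -
    have "(a * y + b * e) / c = a / c * y + b / c * e" for a b c y e :: real
      by (simp add: add_divide_distrib)
    thus ?thesis by (intro ext) (simp only: Lin_def poisson_lin_def)
  qed
  show ?thesis unfolding eq by (intro L4_add L4_cmult L4_E L4_Y)
qed

lemma L4_D: "L4 (D n)" and mom_D: "expectation (\<lambda>\<omega>. D n \<omega>^4) \<le> K * KY"
proof -
  have eq: "D n \<omega>^4 = Y n \<omega>^4 * V (Suc n) \<omega>^4" for \<omega>
    by (simp add: D_def power_mult_distrib)
  have Z: "(\<lambda>\<omega>. Y n \<omega>^4) \<in> borel_measurable (Past n)" by measurable
  note * = past_fourth[OF Z L4_int4[OF L4_Y]]
  show "L4 (D n)" using * by (auto simp: L4_def eq)
  have "expectation (\<lambda>\<omega>. D n \<omega>^4) \<le> K * expectation (\<lambda>\<omega>. Y n \<omega>^4)"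
    using * by (simp add: eq)
  also have "\<dots> \<le> K * KY" using mom_Y K_nonneg by (intro mult_left_mono)
  finally show "expectation (\<lambda>\<omega>. D n \<omega>^4) \<le> K * KY" .
qed

lemma L4_Mart: "L4 (Mart n)"
  unfolding Mart_def by (intro L4_sum L4_D)

lemma poisson: "(Y n \<omega>)^2 = A * (V (Suc n) \<omega>)^2 + Lin n \<omega> * V (Suc n) \<omega> - (R (Suc n) \<omega> - R n \<omega>)"
  unfolding R_def Lin_def by (rule poisson_equation[OF \<theta> \<rho>]) (simp_all add: Y_Suc E_Suc)

lemma int_R2: "integrable M (\<lambda>\<omega>. (R n \<omega>)^2)"
  and exp_R2: "expectation (\<lambda>\<omega>. (R n \<omega>)^2) \<le> 8 * ((1 + \<bar>corr_ye \<theta> \<rho>\<bar> + \<bar>corr_ee \<theta> \<rho>\<bar>) / (1 - \<theta>^2))^2 * (KY + KE)"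
proof -
  define c1 c2 where "c1 = corr_ye \<theta> \<rho>" and "c2 = corr_ee \<theta> \<rho>"
  define c where "c = (1 + \<bar>c1\<bar> + \<bar>c2\<bar>) / (1 - \<theta>^2)"
  note p = stable_pos[OF \<theta> \<rho>]
  have bound: "(corrector \<theta> \<rho> y e)^2 \<le> 8 * c^2 * (y^4 + e^4)" for y e
  proof -
    have "2 * \<bar>y*e\<bar> \<le> y^2 + e^2" using zero_le_power2[of "\<bar>y\<bar>-\<bar>e\<bar>"]
      by (simp add: power2_eq_square algebra_simps abs_mult)
    moreover have "0 \<le> \<bar>y*e\<bar>" by simp
    ultimately have ye: "\<bar>y*e\<bar> \<le> y^2 + e^2" by linarith
    have "\<bar>y^2 + c1*y*e + c2*e^2\<bar> \<le> y^2 + \<bar>c1\<bar>*\<bar>y*e\<bar> + \<bar>c2\<bar>*e^2"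
      using abs_triangle_ineq[of "y^2 + c1*y*e" "c2*e^2"] abs_triangle_ineq[of "y^2" "c1*y*e"]
      by (simp add: abs_mult mult.assoc)
    also have "\<dots> \<le> 1 * (y^2+e^2) + \<bar>c1\<bar>*(y^2+e^2) + \<bar>c2\<bar>*(y^2+e^2)"
      using ye by (intro add_mono mult_left_mono) auto
    finally have "\<bar>corrector \<theta> \<rho> y e\<bar> \<le> c * (y^2+e^2)"
      using p by (simp add: corrector_def c_def c1_def c2_def abs_divide divide_right_mono algebra_simps
          flip: add_divide_distrib)
    hence "\<bar>corrector \<theta> \<rho> y e\<bar>^2 \<le> (c * (y^2+e^2))^2" by (intro power_mono) auto
    also have "\<dots> \<le> c^2 * (2 * (y^4 + e^4))"
      unfolding power_mult_distrib
      using zero_le_power2[of "y^2-e^2"]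
      by (intro mult_left_mono) (auto simp: power2_diff power2_sum simp flip: power_mult)
    also have "\<dots> \<le> c^2 * (8 * (y^4 + e^4))"
      by (intro mult_left_mono) auto
    finally show ?thesis by (simp add: algebra_simps)
  qed
  have i: "integrable M (\<lambda>\<omega>. 8 * c^2 * (Y n \<omega>^4 + E n \<omega>^4))"
    using L4_int4[OF L4_Y] L4_int4[OF L4_E] by auto
  show i2: "integrable M (\<lambda>\<omega>. (R n \<omega>)^2)"
  proof (rule Bochner_Integration.integrable_bound[OF i])
    show "AE \<omega> in M. norm ((R n \<omega>)^2) \<le> norm (8 * c^2 * (Y n \<omega>^4 + E n \<omega>^4))"
      using bound by (intro AE_I2) (auto simp: R_def intro!: order_trans[OF bound])
  qed measurable
  have "expectation (\<lambda>\<omega>. (R n \<omega>)^2) \<le> expectation (\<lambda>\<omega>. 8 * c^2 * (Y n \<omega>^4 + E n \<omega>^4))"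
    using i i2 bound by (intro integral_mono) (auto simp: R_def)
  also have "\<dots> = 8 * c^2 * (expectation (\<lambda>\<omega>. Y n \<omega>^4) + expectation (\<lambda>\<omega>. E n \<omega>^4))"
    using L4_int4[OF L4_Y] L4_int4[OF L4_E] by simp
  also have "\<dots> \<le> 8 * c^2 * (KY + KE)"
    using mom_E mom_Y by (intro mult_left_mono add_mono) auto
  finally show "expectation (\<lambda>\<omega>. (R n \<omega>)^2) \<le> 8 * ((1 + \<bar>corr_ye \<theta> \<rho>\<bar> + \<bar>corr_ee \<theta> \<rho>\<bar>) / (1 - \<theta>^2))^2 * (KY + KE)"
    by (simp add: c_def c1_def c2_def)
qed

definition \<Gamma>D :: real where "\<Gamma>D = K * KY"
definition \<Gamma>R :: real where "\<Gamma>R = 8 * ((1 + \<bar>corr_ye \<theta> \<rho>\<bar> + \<bar>corr_ee \<theta> \<rho>\<bar>) / (1 - \<theta>^2))^2 * (KY + KE)"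

lemma \<Gamma>_eq: "\<Gamma> = 1 + \<Gamma>D + \<Gamma>R"
  by (simp add: moment_bound_def Let_def \<Gamma>D_def \<Gamma>R_def)

lemma \<Gamma>D_nonneg: "\<Gamma>D \<ge> 0" and \<Gamma>R_nonneg: "\<Gamma>R \<ge> 0"
  unfolding \<Gamma>D_def \<Gamma>R_def using KE_nonneg KY_nonneg K_nonneg
  by (intro mult_nonneg_nonneg add_nonneg_nonneg; simp)+

lemma \<Gamma>_nonneg: "\<Gamma> \<ge> 0"
  unfolding \<Gamma>_eq using \<Gamma>D_nonneg \<Gamma>R_nonneg by simp

lemma exp_R2': "expectation (\<lambda>\<omega>. (R n \<omega>)^2) \<le> \<Gamma>R" unfolding \<Gamma>R_def by (rule exp_R2)
lemma mom_D': "expectation (\<lambda>\<omega>. D n \<omega>^4) \<le> \<Gamma>D" unfolding \<Gamma>D_def by (rule mom_D)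

lemma int_R: "integrable M (R n)" and exp_R: "expectation (\<lambda>\<omega>. \<bar>R n \<omega>\<bar>) \<le> \<Gamma>"
proof -
  have b: "\<bar>R n \<omega>\<bar> \<le> 1 + (R n \<omega>)^2" for \<omega>
  proof -
    have "2 * \<bar>R n \<omega>\<bar> \<le> 1 + (R n \<omega>)^2"
      using zero_le_power2[of "\<bar>R n \<omega>\<bar> - 1"] by (simp add: power2_diff)
    moreover have "0 \<le> \<bar>R n \<omega>\<bar>" by simp
    ultimately show ?thesis by linarith
  qed
  have i: "integrable M (\<lambda>\<omega>. 1 + (R n \<omega>)^2)" using int_R2 by simp
  show i2: "integrable M (R n)"
    by (rule Bochner_Integration.integrable_bound[OF i]) (auto intro!: AE_I2 order_trans[OF b])
  have "expectation (\<lambda>\<omega>. \<bar>R n \<omega>\<bar>) \<le> expectation (\<lambda>\<omega>. 1 + (R n \<omega>)^2)"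
    using i i2 b by (intro integral_mono) auto
  also have "\<dots> = 1 + expectation (\<lambda>\<omega>. (R n \<omega>)^2)" using int_R2 by (simp add: prob_space)
  also have "\<dots> \<le> \<Gamma>" using exp_R2'[of n] \<Gamma>D_nonneg unfolding \<Gamma>_eq by simp
  finally show "expectation (\<lambda>\<omega>. \<bar>R n \<omega>\<bar>) \<le> \<Gamma>" .
qed

lemma exp_D3: "expectation (\<lambda>\<omega>. \<bar>D n \<omega>\<bar>^3) \<le> \<Gamma>"
proof -
  have "expectation (\<lambda>\<omega>. \<bar>D n \<omega>\<bar>^3) \<le> expectation (\<lambda>\<omega>. 1 + D n \<omega>^4)"
    using L4_int3[OF L4_D] L4_int4[OF L4_D] quartic_ineqs(3) by (intro integral_mono) auto
  also have "\<dots> = 1 + expectation (\<lambda>\<omega>. D n \<omega>^4)" using L4_int4[OF L4_D] by (simp add: prob_space)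
  also have "\<dots> \<le> \<Gamma>"  using mom_D'[of n] \<Gamma>R_nonneg unfolding \<Gamma>_eq by simp
  finally show ?thesis .
qed

lemma int_DR: "integrable M (\<lambda>\<omega>. D n \<omega> * R m \<omega>)" and exp_DR: "expectation (\<lambda>\<omega>. \<bar>D n \<omega>\<bar> * \<bar>R m \<omega>\<bar>) \<le> \<Gamma>"
proof -
  have b: "\<bar>D n \<omega>\<bar> * \<bar>R m \<omega>\<bar> \<le> 1 + D n \<omega>^4 + (R m \<omega>)^2" for \<omega>
  proof -
    have "2 * (\<bar>D n \<omega>\<bar> * \<bar>R m \<omega>\<bar>) \<le> (D n \<omega>)^2 + (R m \<omega>)^2"
      using zero_le_power2[of "\<bar>D n \<omega>\<bar> - \<bar>R m \<omega>\<bar>"] by (simp add: power2_diff)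
    moreover have "(D n \<omega>)^2 \<le> 1 + D n \<omega>^4" by (rule quartic_ineqs)
    moreover have "0 \<le> \<bar>D n \<omega>\<bar> * \<bar>R m \<omega>\<bar>" by simp
    ultimately show ?thesis by linarith
  qed
  have i: "integrable M (\<lambda>\<omega>. 1 + D n \<omega>^4 + (R m \<omega>)^2)" using int_R2 L4_int4[OF L4_D] by simp
  show i2: "integrable M (\<lambda>\<omega>. D n \<omega> * R m \<omega>)"
    by (rule Bochner_Integration.integrable_bound[OF i]) (auto simp: abs_mult intro!: AE_I2 order_trans[OF b])
  have "expectation (\<lambda>\<omega>. \<bar>D n \<omega>\<bar> * \<bar>R m \<omega>\<bar>) \<le> expectation (\<lambda>\<omega>. 1 + D n \<omega>^4 + (R m \<omega>)^2)"
    using i integrable_abs[OF i2] b by (intro integral_mono) (auto simp: abs_mult)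
  also have "\<dots> = 1 + expectation (\<lambda>\<omega>. D n \<omega>^4) + expectation (\<lambda>\<omega>. (R m \<omega>)^2)"
    using int_R2 L4_int4[OF L4_D] by (simp add: prob_space)
  also have "\<dots> \<le> \<Gamma>" unfolding \<Gamma>_eq using exp_R2'[of m] mom_D'[of n] by simp
  finally show "expectation (\<lambda>\<omega>. \<bar>D n \<omega>\<bar> * \<bar>R m \<omega>\<bar>) \<le> \<Gamma>" .
qed

lemma integrable_bounded_mult:
  fixes h f :: "'a \<Rightarrow> real"
  assumes "h \<in> borel_measurable M" "\<And>\<omega>. \<bar>h \<omega>\<bar> \<le> B" "integrable M f"
  shows "integrable M (\<lambda>\<omega>. h \<omega> * f \<omega>)"
proof (rule Bochner_Integration.integrable_bound)
  show "integrable M (\<lambda>\<omega>. B * f \<omega>)" using assms by simp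
  show "AE \<omega> in M. norm (h \<omega> * f \<omega>) \<le> norm (B * f \<omega>)"
    by (intro AE_I2) (auto simp: abs_mult intro!: mult_right_mono order_trans[OF assms(2) abs_ge_self])
qed (use assms in auto)

text \<open>The conditional variance of the increment is random.  Against a bounded weight \<open>h\<close> from the past it may be
  replaced by its limit, up to the increment of the corrector weighted by \<open>h\<close>.\<close>
lemma corrected_second_moment:
  assumes h: "h \<in> borel_measurable (Past n)" and hb: "\<And>\<omega>. \<bar>h \<omega>\<bar> \<le> B"
  shows "integrable M (\<lambda>\<omega>. h \<omega> * (D n \<omega>)^2)"
    and "expectation (\<lambda>\<omega>. h \<omega> * (D n \<omega>)^2) - \<sigma>^4 * A * expectation h
     = \<sigma>^2 * (expectation (\<lambda>\<omega>. h \<omega> * R n \<omega>) - expectation (\<lambda>\<omega>. h \<omega> * R (Suc n) \<omega>))"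
proof -
  note [measurable] = Past_M[OF h]
  have hM: "h \<in> borel_measurable M" by measurable
  have hi: "integrable M h" using integrable_bounded_mult[OF hM hb, of "\<lambda>_. 1"] by simp
  have hY: "integrable M (\<lambda>\<omega>. h \<omega> * (Y n \<omega>)^2)"
    by (rule integrable_bounded_mult[OF hM hb L4_int2[OF L4_Y]])
  have hL: "integrable M (\<lambda>\<omega>. h \<omega> * Lin n \<omega>)"
    by (rule integrable_bounded_mult[OF hM hb L4_int1[OF L4_Lin]])
  have hR: "integrable M (\<lambda>\<omega>. h \<omega> * R m \<omega>)" for m
    by (rule integrable_bounded_mult[OF hM hb int_R])
  have mY: "(\<lambda>\<omega>. h \<omega> * (Y n \<omega>)^2) \<in> borel_measurable (Past n)"
    and mL: "(\<lambda>\<omega>. h \<omega> * Lin n \<omega>) \<in> borel_measurable (Past n)"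
    using h by measurable
  note sqY = past_square[OF mY hY] and sqh = past_square[OF h hi] and oL = past_orthogonal[OF mL hL]
  have eq: "h \<omega> * (D n \<omega>)^2 = h \<omega> * (Y n \<omega>)^2 * (V (Suc n) \<omega>)^2" for \<omega>
    by (simp add: D_def power_mult_distrib)
  show "integrable M (\<lambda>\<omega>. h \<omega> * (D n \<omega>)^2)" using sqY(1) by (simp add: eq)
  have "expectation (\<lambda>\<omega>. h \<omega> * (Y n \<omega>)^2)
      = expectation (\<lambda>\<omega>. A * (h \<omega> * (V (Suc n) \<omega>)^2) + h \<omega> * Lin n \<omega> * V (Suc n) \<omega>
          - h \<omega> * R (Suc n) \<omega> + h \<omega> * R n \<omega>)"
    unfolding poisson by (intro Bochner_Integration.integral_cong) (auto simp: algebra_simps)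
  also have "\<dots> = A * (\<sigma>^2 * expectation h) - expectation (\<lambda>\<omega>. h \<omega> * R (Suc n) \<omega>)
      + expectation (\<lambda>\<omega>. h \<omega> * R n \<omega>)"
    using sqh oL hR by simp
  finally have e1: "expectation (\<lambda>\<omega>. h \<omega> * (D n \<omega>)^2) = \<sigma>^2 * (A * (\<sigma>^2 * expectation h)
      - expectation (\<lambda>\<omega>. h \<omega> * R (Suc n) \<omega>) + expectation (\<lambda>\<omega>. h \<omega> * R n \<omega>))"
    using sqY(2) by (simp add: eq)
  have s4: "\<sigma>^4 = \<sigma>^2 * \<sigma>^2" by (simp add: power2_eq_square power4_eq_xxxx)
  show "expectation (\<lambda>\<omega>. h \<omega> * (D n \<omega>)^2) - \<sigma>^4 * A * expectation h
     = \<sigma>^2 * (expectation (\<lambda>\<omega>. h \<omega> * R n \<omega>) - expectation (\<lambda>\<omega>. h \<omega> * R (Suc n) \<omega>))"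
    unfolding e1 s4 by (simp add: algebra_simps)
qed

text \<open>A version of the replacement method of Lindeberg.  A family \<open>g\<close> that decreases along the heat flow with
  variance \<open>\<sigma>^4 * A\<close> per step turns the martingale into an approximate supermartingale.  Taylor expansion costs a third
  moment per step.  The fluctuation of the conditional variance is a sum of corrector increments weighted by second
  derivatives; summation by parts moves the differences onto the weights, which vary slowly.  With \<open>g\<close> on the scale
  \<open>sqrt N\<close> the total error is of order \<open>1 / sqrt N\<close>, although only fourth moments are available.\<close>
lemma heat_comparison:
  fixes g g1 g2 :: "nat \<Rightarrow> real \<Rightarrow> real"
  assumes meas [measurable]: "\<And>k. g k \<in> borel_measurable borel" "\<And>k. g1 k \<in> borel_measurable borel"
      "\<And>k. g2 k \<in> borel_measurable borel"
    and growth: "\<And>k x. \<bar>g k x\<bar> \<le> B0 * (1 + \<bar>x\<bar>)"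
    and b1: "\<And>k x. \<bar>g1 k x\<bar> \<le> B1" and b2: "\<And>k x. \<bar>g2 k x\<bar> \<le> B2"
    and taylor: "\<And>k x d. k < N \<Longrightarrow> g (Suc k) (x + d) \<le> g (Suc k) x + g1 k x * d + g2 k x * d^2 / 2 + K3 * \<bar>d\<bar>^3"
    and super: "\<And>k x. k < N \<Longrightarrow> g (Suc k) x + \<sigma>^4 * A / 2 * g2 k x \<le> g k x + \<delta>"
    and smooth: "\<And>k x d. Suc k < N \<Longrightarrow> \<bar>g2 (Suc k) (x + d) - g2 k x\<bar> \<le> K4 * \<bar>d\<bar> + \<eta>"
    and nonneg: "K3 \<ge> 0" "K4 \<ge> 0" "\<eta> \<ge> 0" and N: "N > 0"
  shows "expectation (\<lambda>\<omega>. g N (Mart N \<omega>))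
    \<le> g 0 0 + real N * (\<delta> + \<Gamma> * (K3 + \<sigma>^2 / 2 * (K4 + \<eta>))) + \<sigma>^2 / 2 * \<Gamma> * B2"
proof -
  define h where "h n \<omega> = g2 n (Mart n \<omega>)" for n \<omega>
  have h_Past: "h n \<in> borel_measurable (Past n)" for n unfolding h_def by measurable
  have hM [measurable]: "h n \<in> borel_measurable M" for n by (rule Past_M[OF h_Past])
  have hb: "\<bar>h n \<omega>\<bar> \<le> B2" for n \<omega> by (simp add: h_def b2)
  have hi: "integrable M (h n)" for n using integrable_bounded_mult[OF hM hb, of "\<lambda>_. 1"] by simp
  have hR: "integrable M (\<lambda>\<omega>. h m \<omega> * R n \<omega>)" for m n
    by (rule integrable_bounded_mult[OF hM hb int_R])
  have gi: "integrable M (\<lambda>\<omega>. g k (Mart n \<omega>))" for k n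
  proof (rule Bochner_Integration.integrable_bound)
    show "integrable M (\<lambda>\<omega>. B0 * (1 + \<bar>Mart n \<omega>\<bar>))"
      using L4_int1[OF L4_Mart] by auto
    show "AE \<omega> in M. norm (g k (Mart n \<omega>)) \<le> norm (B0 * (1 + \<bar>Mart n \<omega>\<bar>))"
      using growth by (intro AE_I2) (auto intro: order_trans[OF _ abs_ge_self])
  qed measurable
  have g1D: "integrable M (\<lambda>\<omega>. g1 n (Mart n \<omega>) * D n \<omega>)"
    "expectation (\<lambda>\<omega>. g1 n (Mart n \<omega>) * D n \<omega>) = 0" for n
  proof -
    have m: "(\<lambda>\<omega>. g1 n (Mart n \<omega>) * Y n \<omega>) \<in> borel_measurable (Past n)" by measurable
    have i: "integrable M (\<lambda>\<omega>. g1 n (Mart n \<omega>) * Y n \<omega>)"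
      by (rule integrable_bounded_mult[OF _ b1 L4_int1[OF L4_Y]]) measurable
    from past_orthogonal[OF m i] show "integrable M (\<lambda>\<omega>. g1 n (Mart n \<omega>) * D n \<omega>)"
      "expectation (\<lambda>\<omega>. g1 n (Mart n \<omega>) * D n \<omega>) = 0"
      by (simp_all add: D_def mult_ac)
  qed
  (* The correction h R is kept together with g, so that one step is closed up to an error that is small in every step. *)
  have step: "expectation (\<lambda>\<omega>. g (Suc n) (Mart (Suc n) \<omega>)) + \<sigma>^2/2 * expectation (\<lambda>\<omega>. h n \<omega> * R (Suc n) \<omega>)
     \<le> expectation (\<lambda>\<omega>. g n (Mart n \<omega>)) + \<sigma>^2/2 * expectation (\<lambda>\<omega>. h n \<omega> * R n \<omega>) + \<delta> + \<Gamma> * K3"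
    if "n < N" for n
  proof -
    note csm = corrected_second_moment[OF h_Past hb, of n]
    have "expectation (\<lambda>\<omega>. g (Suc n) (Mart (Suc n) \<omega>)) \<le> expectation (\<lambda>\<omega>. g n (Mart n \<omega>) + \<delta>
        - \<sigma>^4 * A / 2 * h n \<omega> + g1 n (Mart n \<omega>) * D n \<omega> + h n \<omega> * (D n \<omega>)^2 / 2 + K3 * \<bar>D n \<omega>\<bar>^3)"
    proof (rule integral_mono)
      fix \<omega>
      show "g (Suc n) (Mart (Suc n) \<omega>) \<le> g n (Mart n \<omega>) + \<delta>
        - \<sigma>^4 * A / 2 * h n \<omega> + g1 n (Mart n \<omega>) * D n \<omega> + h n \<omega> * (D n \<omega>)^2 / 2 + K3 * \<bar>D n \<omega>\<bar>^3"
        using taylor[OF that, of "Mart n \<omega>" "D n \<omega>"] super[OF that, of "Mart n \<omega>"]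
        unfolding h_def Mart_Suc by linarith
    qed (use gi hi g1D csm L4_int3[OF L4_D] in auto)
    also have "\<dots> = expectation (\<lambda>\<omega>. g n (Mart n \<omega>)) + \<delta> - \<sigma>^4 * A / 2 * expectation (h n)
        + expectation (\<lambda>\<omega>. h n \<omega> * (D n \<omega>)^2) / 2 + K3 * expectation (\<lambda>\<omega>. \<bar>D n \<omega>\<bar>^3)"
      using gi hi g1D csm(1) L4_int3[OF L4_D] by (simp add: prob_space)
    also have "\<dots> \<le> expectation (\<lambda>\<omega>. g n (Mart n \<omega>)) + \<delta> - \<sigma>^4 * A / 2 * expectation (h n)
        + expectation (\<lambda>\<omega>. h n \<omega> * (D n \<omega>)^2) / 2 + K3 * \<Gamma>"
      using exp_D3 nonneg by (intro add_left_mono mult_left_mono) auto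
    finally show ?thesis using csm(2) by (simp add: algebra_simps)
  qed
  (* Summation by parts: exchanging the weight h n for h (n+1) costs the variation of g2 over one step. *)
  have shift: "expectation (\<lambda>\<omega>. h (Suc n) \<omega> * R (Suc n) \<omega>) \<le> expectation (\<lambda>\<omega>. h n \<omega> * R (Suc n) \<omega>) + \<Gamma> * (K4 + \<eta>)"
    if "Suc n < N" for n
  proof -
    have "expectation (\<lambda>\<omega>. h (Suc n) \<omega> * R (Suc n) \<omega>) \<le> expectation (\<lambda>\<omega>. h n \<omega> * R (Suc n) \<omega>
       + K4 * \<bar>D n \<omega> * R (Suc n) \<omega>\<bar> + \<eta> * \<bar>R (Suc n) \<omega>\<bar>)"
    proof (rule integral_mono)
      fix \<omega>
      have "(h (Suc n) \<omega> - h n \<omega>) * R (Suc n) \<omega> \<le> \<bar>h (Suc n) \<omega> - h n \<omega>\<bar> * \<bar>R (Suc n) \<omega>\<bar>"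
        by (metis abs_ge_self abs_mult)
      also have "\<dots> \<le> (K4 * \<bar>D n \<omega>\<bar> + \<eta>) * \<bar>R (Suc n) \<omega>\<bar>"
        using smooth[OF that, of "Mart n \<omega>" "D n \<omega>"] by (intro mult_right_mono) (auto simp: h_def Mart_Suc)
      finally show "h (Suc n) \<omega> * R (Suc n) \<omega> \<le> h n \<omega> * R (Suc n) \<omega>
       + K4 * \<bar>D n \<omega> * R (Suc n) \<omega>\<bar> + \<eta> * \<bar>R (Suc n) \<omega>\<bar>" by (simp add: algebra_simps abs_mult)
    qed (use hR int_DR int_R in auto)
    also have "\<dots> = expectation (\<lambda>\<omega>. h n \<omega> * R (Suc n) \<omega>) + K4 * expectation (\<lambda>\<omega>. \<bar>D n \<omega> * R (Suc n) \<omega>\<bar>)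
       + \<eta> * expectation (\<lambda>\<omega>. \<bar>R (Suc n) \<omega>\<bar>)"
      using hR integrable_abs[OF int_DR] integrable_abs[OF int_R] by simp
    also have "\<dots> \<le> expectation (\<lambda>\<omega>. h n \<omega> * R (Suc n) \<omega>) + K4 * \<Gamma> + \<eta> * \<Gamma>"
      using exp_DR exp_R nonneg by (intro add_mono mult_left_mono) (auto simp: abs_mult)
    finally show ?thesis by (simp add: algebra_simps)
  qed
  have "Suc n \<le> N \<Longrightarrow> expectation (\<lambda>\<omega>. g (Suc n) (Mart (Suc n) \<omega>)) + \<sigma>^2/2 * expectation (\<lambda>\<omega>. h n \<omega> * R (Suc n) \<omega>)
     \<le> g 0 0 + real (Suc n) * (\<delta> + \<Gamma> * (K3 + \<sigma>^2 / 2 * (K4 + \<eta>)))" for n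
  proof (induction n)
    case 0
    have "\<Gamma> * (\<sigma>^2 / 2 * (K4 + \<eta>)) \<ge> 0" using \<Gamma>_nonneg nonneg by simp
    moreover have "real (Suc 0) * (\<delta> + \<Gamma> * (K3 + \<sigma>^2 / 2 * (K4 + \<eta>))) = \<delta> + \<Gamma> * K3 + \<Gamma> * (\<sigma>^2 / 2 * (K4 + \<eta>))"
      by (simp add: algebra_simps)
    moreover have "expectation (\<lambda>\<omega>. g 0 (Mart 0 \<omega>)) + \<sigma>^2/2 * expectation (\<lambda>\<omega>. h 0 \<omega> * R 0 \<omega>) = g 0 0"
      by (simp add: prob_space)
    ultimately show ?case using step[OF N] by linarith
  next
    case (Suc n)
    define X where "X = \<delta> + \<Gamma> * (K3 + \<sigma>^2 / 2 * (K4 + \<eta>))"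
    have sh: "\<sigma>^2/2 * expectation (\<lambda>\<omega>. h (Suc n) \<omega> * R (Suc n) \<omega>)
       \<le> \<sigma>^2/2 * (expectation (\<lambda>\<omega>. h n \<omega> * R (Suc n) \<omega>) + \<Gamma> * (K4 + \<eta>))"
      using shift[of n] Suc.prems by (intro mult_left_mono) auto
    have "expectation (\<lambda>\<omega>. g (Suc (Suc n)) (Mart (Suc (Suc n)) \<omega>)) + \<sigma>^2/2 * expectation (\<lambda>\<omega>. h (Suc n) \<omega> * R (Suc (Suc n)) \<omega>)
      \<le> expectation (\<lambda>\<omega>. g (Suc n) (Mart (Suc n) \<omega>)) + \<sigma>^2/2 * expectation (\<lambda>\<omega>. h (Suc n) \<omega> * R (Suc n) \<omega>) + \<delta> + \<Gamma> * K3"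
      using Suc.prems by (intro step) simp
    also have "\<dots> \<le> expectation (\<lambda>\<omega>. g (Suc n) (Mart (Suc n) \<omega>)) + \<sigma>^2/2 * (expectation (\<lambda>\<omega>. h n \<omega> * R (Suc n) \<omega>) + \<Gamma> * (K4 + \<eta>)) + \<delta> + \<Gamma> * K3"
      by (intro add_mono sh order_refl)
    also have "\<dots> = (expectation (\<lambda>\<omega>. g (Suc n) (Mart (Suc n) \<omega>)) + \<sigma>^2/2 * expectation (\<lambda>\<omega>. h n \<omega> * R (Suc n) \<omega>)) + X"
      by (simp add: X_def algebra_simps)
    also have "\<dots> \<le> (g 0 0 + real (Suc n) * X) + X"
      using Suc.IH[OF Suc_leD[OF Suc.prems]] unfolding X_def by (rule add_right_mono)
    also have "\<dots> = g 0 0 + real (Suc (Suc n)) * X" by (simp add: algebra_simps)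
    finally show ?case unfolding X_def .
  qed
  from this[of "N - 1"] N have "expectation (\<lambda>\<omega>. g N (Mart N \<omega>)) + \<sigma>^2/2 * expectation (\<lambda>\<omega>. h (N-1) \<omega> * R N \<omega>)
     \<le> g 0 0 + real N * (\<delta> + \<Gamma> * (K3 + \<sigma>^2 / 2 * (K4 + \<eta>)))" by simp
  moreover have "- expectation (\<lambda>\<omega>. h (N-1) \<omega> * R N \<omega>) \<le> B2 * \<Gamma>"
  proof -
    have B2: "B2 \<ge> 0" using b2[of 0 0] by linarith
    have "- expectation (\<lambda>\<omega>. h (N-1) \<omega> * R N \<omega>) = expectation (\<lambda>\<omega>. - (h (N-1) \<omega> * R N \<omega>))" by simp
    also have "\<dots> \<le> expectation (\<lambda>\<omega>. B2 * \<bar>R N \<omega>\<bar>)"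
    proof (rule integral_mono)
      fix \<omega>
      have "- (h (N-1) \<omega> * R N \<omega>) \<le> \<bar>h (N-1) \<omega>\<bar> * \<bar>R N \<omega>\<bar>" by (metis abs_ge_minus_self abs_mult)
      also have "\<dots> \<le> B2 * \<bar>R N \<omega>\<bar>" by (intro mult_right_mono hb) auto
      finally show "- (h (N-1) \<omega> * R N \<omega>) \<le> B2 * \<bar>R N \<omega>\<bar>" .
    qed (use hR int_R in auto)
    also have "\<dots> \<le> B2 * \<Gamma>" using exp_R B2 by (auto intro: mult_left_mono)
    finally show ?thesis .
  qed
  hence "\<sigma>^2/2 * (- expectation (\<lambda>\<omega>. h (N-1) \<omega> * R N \<omega>)) \<le> \<sigma>^2/2 * (B2 * \<Gamma>)"
    by (intro mult_left_mono) auto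
  ultimately show ?thesis by (simp add: algebra_simps)
qed

end

section \<open>The upper half of the law of the iterated logarithm\<close>

lemma taylor1:
  fixes f :: "real \<Rightarrow> real"
  assumes f: "\<And>x. (f has_real_derivative f1 x) (at x)"
  shows "\<exists>t. f (x + d) = f x + f1 t * d"
proof -
  define D :: "nat \<Rightarrow> real \<Rightarrow> real" where "D m t = (if m = 0 then f (x+t) else f1 (x+t))" for m t
  have "\<exists>t. \<bar>t\<bar> \<le> \<bar>d\<bar> \<and> f (x + d) = (\<Sum>m<1. D m 0 / fact m * d ^ m) + D 1 t / fact 1 * d ^ 1"
  proof (rule Maclaurin_bi_le[where f="\<lambda>t. f (x + t)"])
    show "\<forall>m t. m < 1 \<and> \<bar>t\<bar> \<le> \<bar>d\<bar> \<longrightarrow> (D m has_real_derivative D (Suc m) t) (at t)"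
      using DERIV_shift[of f "f1 (x+t)" t x for t] f by (auto simp: D_def[abs_def] add.commute)
  qed (simp add: D_def fun_eq_iff)
  thus ?thesis by (auto simp: D_def)
qed

lemma taylor2:
  fixes f :: "real \<Rightarrow> real"
  assumes f: "\<And>x. (f has_real_derivative f1 x) (at x)" and f1: "\<And>x. (f1 has_real_derivative f2 x) (at x)"
  shows "\<exists>t. f (x + d) = f x + f1 x * d + f2 t * d^2 / 2"
proof -
  define D :: "nat \<Rightarrow> real \<Rightarrow> real" where
    "D m t = (if m = 0 then f (x+t) else if m = 1 then f1 (x+t) else f2 (x+t))" for m t
  have "\<exists>t. \<bar>t\<bar> \<le> \<bar>d\<bar> \<and> f (x + d) = (\<Sum>m<2. D m 0 / fact m * d ^ m) + D 2 t / fact 2 * d ^ 2"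
  proof (rule Maclaurin_bi_le[where f="\<lambda>t. f (x + t)"])
    show "\<forall>m t. m < 2 \<and> \<bar>t\<bar> \<le> \<bar>d\<bar> \<longrightarrow> (D m has_real_derivative D (Suc m) t) (at t)"
      using DERIV_shift[of f "f1 (x+t)" t x for t] DERIV_shift[of f1 "f2 (x+t)" t x for t] f f1
      by (auto simp: D_def[abs_def] add.commute less_2_cases_iff)
  qed (simp add: D_def fun_eq_iff)
  thus ?thesis by (auto simp: D_def numeral_2_eq_2)
qed

lemma taylor3:
  fixes f :: "real \<Rightarrow> real"
  assumes f: "\<And>x. (f has_real_derivative f1 x) (at x)" and f1: "\<And>x. (f1 has_real_derivative f2 x) (at x)"
    and f2: "\<And>x. (f2 has_real_derivative f3 x) (at x)"
  shows "\<exists>t. f (x + d) = f x + f1 x * d + f2 x * d^2 / 2 + f3 t * d^3 / 6"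
proof -
  define D :: "nat \<Rightarrow> real \<Rightarrow> real" where
    "D m t = (if m = 0 then f (x+t) else if m = 1 then f1 (x+t) else if m = 2 then f2 (x+t) else f3 (x+t))" for m t
  have "\<exists>t. \<bar>t\<bar> \<le> \<bar>d\<bar> \<and> f (x + d) = (\<Sum>m<3. D m 0 / fact m * d ^ m) + D 3 t / fact 3 * d ^ 3"
  proof (rule Maclaurin_bi_le[where f="\<lambda>t. f (x + t)"])
    have "m < 3 \<longleftrightarrow> m = 0 \<or> m = 1 \<or> m = 2" for m :: nat by auto
    thus "\<forall>m t. m < 3 \<and> \<bar>t\<bar> \<le> \<bar>d\<bar> \<longrightarrow> (D m has_real_derivative D (Suc m) t) (at t)"
      using DERIV_shift[of f "f1 (x+t)" t x for t] DERIV_shift[of f1 "f2 (x+t)" t x for t]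
        DERIV_shift[of f2 "f3 (x+t)" t x for t] f f1 f2
      by (auto simp: D_def[abs_def] add.commute)
  qed (simp add: D_def fun_eq_iff)
  thus ?thesis by (auto simp: D_def numeral_3_eq_3 fact_numeral power2_eq_square)
qed

text \<open>The test function of the upper half.  It is convex, so that the maximal inequality applies; its second
  derivative is at most its first, so that shifting its argument linearly in time gives an exact supersolution of
  the heat equation; its derivatives are bounded, so that no truncation is needed; and it is below the exponential, so that
  it yields the Gaussian tail.\<close>
definition softplus :: "real \<Rightarrow> real" where "softplus z = ln (1 + exp z)"
definition logistic :: "real \<Rightarrow> real" where "logistic z = exp z / (1 + exp z)"

lemma one_plus_exp_pos: "1 + exp (z::real) > 0"
  by (rule add_pos_pos) auto

lemma logistic_bounds: "0 < logistic z" "logistic z < 1"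
  unfolding logistic_def using one_plus_exp_pos[of z] by (auto simp: field_simps)

lemma softplus_deriv: "(softplus has_real_derivative logistic z) (at z)"
  unfolding softplus_def logistic_def
  by (auto intro!: derivative_eq_intros simp: one_plus_exp_pos)

lemma logistic_deriv: "(logistic has_real_derivative logistic z * (1 - logistic z)) (at z)"
proof -
  have "((\<lambda>z. exp z / (1 + exp z)) has_real_derivative
      (exp z * (1 + exp z) - exp z * (0 + exp z)) / ((1 + exp z) * (1 + exp z))) (at z)"
    using one_plus_exp_pos[of z] by (intro derivative_intros DERIV_divide) auto
  moreover have "(exp z * (1 + exp z) - exp z * (0 + exp z)) / ((1 + exp z) * (1 + exp z)) = logistic z * (1 - logistic z)"
    using one_plus_exp_pos[of z] by (simp add: logistic_def divide_simps) (simp add: algebra_simps)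
  ultimately show ?thesis by (simp add: logistic_def[abs_def])
qed

lemma logistic_deriv2: "((\<lambda>z. logistic z * (1 - logistic z)) has_real_derivative
    logistic z * (1 - logistic z) * (1 - 2 * logistic z)) (at z)"
  by (rule derivative_eq_intros logistic_deriv refl)+ (simp add: algebra_simps)

lemma logistic_var_bounds: "0 \<le> logistic z * (1 - logistic z)" "logistic z * (1 - logistic z) \<le> logistic z"
  "logistic z * (1 - logistic z) \<le> 1"
  "\<bar>logistic z * (1 - logistic z) * (1 - 2 * logistic z)\<bar> \<le> 1"
proof -
  note b = logistic_bounds[of z]
  show 1: "0 \<le> logistic z * (1 - logistic z)" using b by simp
  show 2: "logistic z * (1 - logistic z) \<le> logistic z" using b by (simp add: mult_left_le)
  show 3: "logistic z * (1 - logistic z) \<le> 1" using 2 b(2) by linarith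
  have "\<bar>logistic z * (1 - logistic z)\<bar> * \<bar>1 - 2 * logistic z\<bar> \<le> 1 * 1"
    using 1 3 b by (intro mult_mono) auto
  thus "\<bar>logistic z * (1 - logistic z) * (1 - 2 * logistic z)\<bar> \<le> 1" by (simp add: abs_mult)
qed

lemma softplus_convex: "softplus (z + w) \<ge> softplus z + logistic z * w"
proof -
  obtain t where "softplus (z + w) = softplus z + logistic z * w + logistic t * (1 - logistic t) * w^2 / 2"
    using taylor2[OF softplus_deriv logistic_deriv] by blast
  moreover have "logistic t * (1 - logistic t) * w^2 / 2 \<ge> 0" using logistic_var_bounds(1)[of t] by simp
  ultimately show ?thesis by linarith
qed

lemma softplus_taylor: "softplus (z + w) \<le> softplus z + logistic z * w + logistic z * (1 - logistic z) * w^2 / 2 + \<bar>w\<bar>^3"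
proof -
  obtain t where t: "softplus (z + w) = softplus z + logistic z * w + logistic z * (1 - logistic z) * w^2 / 2
      + logistic t * (1 - logistic t) * (1 - 2 * logistic t) * w^3 / 6"
    using taylor3[OF softplus_deriv logistic_deriv logistic_deriv2] by blast
  have "logistic t * (1 - logistic t) * (1 - 2 * logistic t) * w^3
     \<le> \<bar>logistic t * (1 - logistic t) * (1 - 2 * logistic t)\<bar> * \<bar>w\<bar>^3"
    by (metis abs_ge_self abs_mult power_abs)
  also have "\<dots> \<le> 1 * \<bar>w\<bar>^3" using logistic_var_bounds(4) by (intro mult_right_mono) auto
  finally have "logistic t * (1 - logistic t) * (1 - 2 * logistic t) * w^3 / 6 \<le> \<bar>w\<bar>^3 / 6" by simp
  moreover have "0 \<le> \<bar>w\<bar>^3" by simp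
  ultimately show ?thesis using t by linarith
qed

lemma logistic_var_lipschitz:
  "\<bar>logistic (z + w) * (1 - logistic (z + w)) - logistic z * (1 - logistic z)\<bar> \<le> \<bar>w\<bar>"
proof -
  obtain t where "logistic (z + w) * (1 - logistic (z + w)) = logistic z * (1 - logistic z)
      + logistic t * (1 - logistic t) * (1 - 2 * logistic t) * w"
    using taylor1[OF logistic_deriv2, of z w] by blast
  moreover have "\<bar>logistic t * (1 - logistic t) * (1 - 2 * logistic t)\<bar> * \<bar>w\<bar> \<le> 1 * \<bar>w\<bar>"
    by (intro mult_right_mono logistic_var_bounds) auto
  ultimately show ?thesis by (simp add: abs_mult)
qed

lemma softplus_nonneg: "softplus z \<ge> 0"
  by (simp add: softplus_def)

lemma softplus_le_exp: "softplus z \<le> exp z"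
  unfolding softplus_def by (rule ln_add_one_self_le_self) simp

lemma softplus_ge: "z \<ge> 0 \<Longrightarrow> softplus z \<ge> ln 2"
  unfolding softplus_def by (subst ln_le_cancel_iff) (auto intro: add_pos_pos)

lemma softplus_growth: "\<bar>softplus z\<bar> \<le> 1 + \<bar>z\<bar>"
proof -
  have "softplus z \<le> ln (2 * exp \<bar>z\<bar>)"
  proof -
    have "exp z \<le> exp \<bar>z\<bar>" "1 \<le> exp \<bar>z\<bar>" by simp_all
    hence "1 + exp z \<le> 2 * exp \<bar>z\<bar>" by linarith
    thus ?thesis unfolding softplus_def using one_plus_exp_pos[of z] by (subst ln_le_cancel_iff) auto
  qed
  also have "\<dots> = ln 2 + \<bar>z\<bar>" by (simp add: ln_mult)
  also have "\<dots> \<le> 1 + \<bar>z\<bar>" using ln_le_minus_one[of "2::real"] by simp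
  finally show ?thesis using softplus_nonneg[of z] by simp
qed

lemma softplus_measurable [measurable]: "softplus \<in> borel_measurable borel"
  unfolding softplus_def[abs_def] by measurable

lemma logistic_measurable [measurable]: "logistic \<in> borel_measurable borel"
  unfolding logistic_def[abs_def] by measurable

lemma bigo_cmult:
  fixes f g :: "nat \<Rightarrow> real"
  shows "f \<in> O(g) \<Longrightarrow> (\<lambda>x. c * f x) \<in> O(g)"
  using landau_o.big.mult[OF bigo_const[of c sequentially], of f g] by simp

lemma geometric_asymptotics:
  fixes \<kappa> S :: real
  assumes "\<kappa> > 0" "S > 0"
  shows "(\<lambda>j. 2 * ln (\<kappa> * real j) / (S * exp (\<kappa> * real j))) \<longlonglongrightarrow> 0"
    and "(\<lambda>j. exp (\<kappa> * real j) * (sqrt (2 * ln (\<kappa> * real j) / (S * exp (\<kappa> * real j))))^3) \<in> O(\<lambda>j. real j powr (-2))"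
    and "(\<lambda>j. (sqrt (2 * ln (\<kappa> * real j) / (S * exp (\<kappa> * real j))))^2) \<in> O(\<lambda>j. real j powr (-2))"
  using assms by real_asymp+

context ar_noise
begin

abbreviation "lim_var \<equiv> \<sigma>^4 * A"

lemma lim_var_nonneg: "lim_var \<ge> 0"
  using var_ratio_pos[OF \<theta> \<rho>] by simp

text \<open>The exponential bound for the moment generating function holds up to an error term, which for the
  slopes \<open>a\<close> used below is \<open>1 / sqrt N\<close> up to powers of \<open>ln (ln N)\<close>.\<close>
lemma softplus_expectation:
  assumes N: "N > 0"
  shows "expectation (\<lambda>\<omega>. softplus (a * Mart N \<omega> - c))
    \<le> exp (a^2 * lim_var / 2 * real N - c)
      + real N * (\<Gamma> * (\<bar>a\<bar>^3 + \<sigma>^2 / 2 * (\<bar>a\<bar>^3 + a^4 * lim_var / 2))) + \<sigma>^2 / 2 * \<Gamma> * a^2"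
proof -
  (* Each remaining step adds the drift h, which compensates half the second derivative times the variance. *)
  define h where "h = a^2 * lim_var / 2"
  have h: "h \<ge> 0" using lim_var_nonneg by (simp add: h_def)
  define z where "z k x = a * x - c + h * real (N - k)" for k x
  define g where "g k x = softplus (z k x)" for k x
  define g1 where "g1 k x = a * logistic (z (Suc k) x)" for k x
  define g2 where "g2 k x = a^2 * (logistic (z (Suc k) x) * (1 - logistic (z (Suc k) x)))" for k x
  have z_add: "z k (x + d) = z k x + a * d" for k x d by (simp add: z_def algebra_simps)
  have z_step: "z k x = z (Suc k) x + h" if "k < N" for k x
  proof -
    have "N - k = Suc (N - Suc k)" using that by simp
    thus ?thesis by (simp add: z_def algebra_simps)
  qed
  have "expectation (\<lambda>\<omega>. g N (Mart N \<omega>))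
    \<le> g 0 0 + real N * (0 + \<Gamma> * (\<bar>a\<bar>^3 + \<sigma>^2 / 2 * (\<bar>a\<bar>^3 + a^2 * h))) + \<sigma>^2 / 2 * \<Gamma> * a^2"
  proof (rule heat_comparison[where ?g1.0=g1 and ?g2.0=g2 and ?B0.0="1 + \<bar>a\<bar> + \<bar>c\<bar> + h * real N" and ?B1.0="\<bar>a\<bar>"])
    fix k x d
    show "g k \<in> borel_measurable borel" "g1 k \<in> borel_measurable borel" "g2 k \<in> borel_measurable borel"
      unfolding g_def g1_def g2_def z_def by measurable
    show "\<bar>g k x\<bar> \<le> (1 + \<bar>a\<bar> + \<bar>c\<bar> + h * real N) * (1 + \<bar>x\<bar>)"
    proof -
      have "\<bar>g k x\<bar> \<le> 1 + \<bar>z k x\<bar>" unfolding g_def by (rule softplus_growth)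
      also have "\<bar>z k x\<bar> \<le> \<bar>a * x\<bar> + \<bar>c\<bar> + \<bar>h * real (N - k)\<bar>" unfolding z_def by linarith
      also have "\<bar>h * real (N - k)\<bar> \<le> h * real N" using h by (auto intro!: mult_left_mono)
      finally have "\<bar>g k x\<bar> \<le> 1 + (\<bar>a\<bar> * \<bar>x\<bar> + \<bar>c\<bar> + h * real N)" by (simp add: abs_mult)
      moreover have "0 \<le> \<bar>a\<bar> + (1 + \<bar>c\<bar> + h * real N) * \<bar>x\<bar>" using h by (intro add_nonneg_nonneg) auto
      ultimately have "\<bar>g k x\<bar> \<le> 1 + (\<bar>a\<bar> * \<bar>x\<bar> + \<bar>c\<bar> + h * real N) + (\<bar>a\<bar> + (1 + \<bar>c\<bar> + h * real N) * \<bar>x\<bar>)"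
        by (rule add_increasing2[rotated])
      thus ?thesis by (simp add: algebra_simps)
    qed
    show "\<bar>g1 k x\<bar> \<le> \<bar>a\<bar>"
      using logistic_bounds[of "z (Suc k) x"] by (auto simp: g1_def abs_mult intro!: mult_left_le)
    show "\<bar>g2 k x\<bar> \<le> a^2"
      using logistic_var_bounds[of "z (Suc k) x"] by (auto simp: g2_def abs_mult intro!: mult_left_le)
    show "g (Suc k) (x + d) \<le> g (Suc k) x + g1 k x * d + g2 k x * d^2 / 2 + \<bar>a\<bar>^3 * \<bar>d\<bar>^3"
      using softplus_taylor[of "z (Suc k) x" "a * d"]
      unfolding g_def g1_def g2_def z_add by (simp add: power_mult_distrib abs_mult algebra_simps)
    show "g (Suc k) x + \<sigma>^4 * A / 2 * g2 k x \<le> g k x + 0" if "k < N"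
    proof -
      have "\<sigma>^4 * A / 2 * g2 k x = logistic (z (Suc k) x) * (1 - logistic (z (Suc k) x)) * h"
        by (simp add: g2_def h_def)
      also have "\<dots> \<le> logistic (z (Suc k) x) * h"
        by (intro mult_right_mono logistic_var_bounds h)
      finally show ?thesis using softplus_convex[of "z (Suc k) x" h] unfolding g_def z_step[OF that] by simp
    qed
    show "\<bar>g2 (Suc k) (x + d) - g2 k x\<bar> \<le> \<bar>a\<bar>^3 * \<bar>d\<bar> + a^2 * h" if "Suc k < N"
    proof -
      have eq: "z (Suc (Suc k)) (x + d) = z (Suc k) x + (a * d - h)"
        using z_step[OF that, of x] by (simp add: z_add)
      have "\<bar>g2 (Suc k) (x + d) - g2 k x\<bar> = a^2 * \<bar>logistic (z (Suc (Suc k)) (x + d)) * (1 - logistic (z (Suc (Suc k)) (x + d)))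
          - logistic (z (Suc k) x) * (1 - logistic (z (Suc k) x))\<bar>"
        unfolding g2_def right_diff_distrib[symmetric] abs_mult by simp
      also have "\<dots> \<le> a^2 * \<bar>a * d - h\<bar>"
        unfolding eq by (intro mult_left_mono logistic_var_lipschitz) auto
      also have "\<dots> \<le> a^2 * (\<bar>a * d\<bar> + h)" using h by (intro mult_left_mono) auto
      also have "\<dots> = \<bar>a\<bar>^3 * \<bar>d\<bar> + a^2 * h"
        by (simp add: algebra_simps abs_mult power3_eq_cube power2_eq_square)
      finally show ?thesis .
    qed
  qed (use h N in auto)
  moreover have "g 0 0 \<le> exp (h * real N - c)" using softplus_le_exp[of "h * real N - c"]
    by (simp add: g_def z_def)
  moreover have "g N x = softplus (a * x - c)" for x by (simp add: g_def z_def)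
  moreover have "a^2 * h = a^4 * lim_var / 2" by (simp add: h_def power2_eq_square power4_eq_xxxx)
  ultimately show ?thesis by (simp add: h_def)
qed

text \<open>The event says that \<open>softplus (a * M - c)\<close> reaches the value \<open>softplus 0 = ln 2\<close>, to which the maximal inequality applies.\<close>
lemma maximal_tail:
  assumes N: "N > 0"
  shows "prob {\<omega>\<in>space M. \<exists>n\<le>N. a * Mart n \<omega> \<ge> c} \<le> (exp (a^2 * lim_var / 2 * real N - c)
      + real N * (\<Gamma> * (\<bar>a\<bar>^3 + \<sigma>^2 / 2 * (\<bar>a\<bar>^3 + a^4 * lim_var / 2))) + \<sigma>^2 / 2 * \<Gamma> * a^2) / ln 2"
proof -
  define \<Phi> where "\<Phi> n \<omega> = softplus (a * Mart n \<omega> - c)" for n \<omega>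
  have Phi_Past: "\<Phi> n \<in> borel_measurable (Past n)" for n unfolding \<Phi>_def by measurable
  have Phi_int: "integrable M (\<Phi> n)" for n
  proof (rule Bochner_Integration.integrable_bound)
    show "integrable M (\<lambda>\<omega>. 1 + \<bar>a * Mart n \<omega> - c\<bar>)" using L4_int1[OF L4_Mart] by auto
    show "AE \<omega> in M. norm (\<Phi> n \<omega>) \<le> norm (1 + \<bar>a * Mart n \<omega> - c\<bar>)"
      using softplus_growth by (intro AE_I2) (auto simp: \<Phi>_def)
  qed (rule Past_M[OF Phi_Past])
  have "prob {\<omega>\<in>space M. \<exists>n\<le>N. \<Phi> n \<omega> \<ge> ln 2} \<le> expectation (\<Phi> N) / ln 2"
  proof (rule maximal_inequality[OF Phi_Past Phi_int])
    show "\<Phi> n \<omega> \<ge> 0" for n \<omega> by (simp add: \<Phi>_def softplus_nonneg)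
  next
    fix n B assume B: "B \<in> sets (Past n)"
    have BM: "B \<in> events" using B sets_sig_events[of "{1..n}"] by auto
    define Z where "Z \<omega> = (indicator B \<omega> * (logistic (a * Mart n \<omega> - c) * a)) * Y n \<omega>" for \<omega>
    have Z: "Z \<in> borel_measurable (Past n)" unfolding Z_def using B by measurable
    have wM: "(\<lambda>\<omega>. indicator B \<omega> * (logistic (a * Mart n \<omega> - c) * a)) \<in> borel_measurable M"
      using BM by measurable
    have wb: "\<bar>indicator B \<omega> * (logistic (a * Mart n \<omega> - c) * a)\<bar> \<le> \<bar>a\<bar>" for \<omega>
      using logistic_bounds[of "a * Mart n \<omega> - c"] by (auto simp: indicator_def abs_mult intro!: mult_left_le_one_le)
    have Zi: "integrable M Z"
      unfolding Z_def by (rule integrable_bounded_mult[OF wM wb L4_int1[OF L4_Y]])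
    have i1: "integrable M (\<lambda>\<omega>. indicator B \<omega> * \<Phi> m \<omega>)" for m
      using integrable_mult_indicator[OF BM Phi_int] by simp
    note o = past_orthogonal[OF Z Zi]
    have "expectation (\<lambda>\<omega>. indicator B \<omega> * \<Phi> n \<omega>) = expectation (\<lambda>\<omega>. indicator B \<omega> * \<Phi> n \<omega> + Z \<omega> * V (Suc n) \<omega>)"
      using i1 o by simp
    also have "\<dots> \<le> expectation (\<lambda>\<omega>. indicator B \<omega> * \<Phi> (Suc n) \<omega>)"
    proof (rule integral_mono)
      fix \<omega>
      have "\<Phi> (Suc n) \<omega> \<ge> \<Phi> n \<omega> + logistic (a * Mart n \<omega> - c) * (a * D n \<omega>)"
        using softplus_convex[of "a * Mart n \<omega> - c" "a * D n \<omega>"]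
        by (simp add: \<Phi>_def Mart_Suc algebra_simps)
      thus "indicator B \<omega> * \<Phi> n \<omega> + Z \<omega> * V (Suc n) \<omega> \<le> indicator B \<omega> * \<Phi> (Suc n) \<omega>"
        by (auto simp: indicator_def Z_def D_def mult_ac)
    qed (use i1 o in auto)
    finally show "expectation (\<lambda>\<omega>. indicator B \<omega> * \<Phi> n \<omega>) \<le> expectation (\<lambda>\<omega>. indicator B \<omega> * \<Phi> (Suc n) \<omega>)" .
  qed simp
  moreover have "prob {\<omega>\<in>space M. \<exists>n\<le>N. a * Mart n \<omega> \<ge> c} \<le> prob {\<omega>\<in>space M. \<exists>n\<le>N. \<Phi> n \<omega> \<ge> ln 2}"
  proof (rule finite_measure_mono)
    show "{\<omega>\<in>space M. \<exists>n\<le>N. a * Mart n \<omega> \<ge> c} \<subseteq> {\<omega>\<in>space M. \<exists>n\<le>N. \<Phi> n \<omega> \<ge> ln 2}"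
      using softplus_ge by (force simp: \<Phi>_def)
    have [measurable]: "\<Phi> n \<in> borel_measurable M" for n by (rule Past_M[OF Phi_Past])
    show "{\<omega>\<in>space M. \<exists>n\<le>N. \<Phi> n \<omega> \<ge> ln 2} \<in> events" by measurable
  qed
  moreover have "expectation (\<Phi> N) / ln 2 \<le> (exp (a^2 * lim_var / 2 * real N - c)
      + real N * (\<Gamma> * (\<bar>a\<bar>^3 + \<sigma>^2 / 2 * (\<bar>a\<bar>^3 + a^4 * lim_var / 2))) + \<sigma>^2 / 2 * \<Gamma> * a^2) / ln 2"
    unfolding \<Phi>_def by (intro divide_right_mono softplus_expectation N) auto
  ultimately show ?thesis by linarith
qed

lemma Mart_maximal_event: "{\<omega>\<in>space M. \<exists>n\<le>N. a * Mart n \<omega> \<ge> c} \<in> events"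
  by measurable

text \<open>The maximal inequality along the times \<open>q^j\<close> with \<open>q = 1 + \<epsilon>\<close> and the Borel-Cantelli lemma.  The factor lost by
  passing from \<open>q^j\<close> to \<open>q^(j+1)\<close> is covered by the excess \<open>\<epsilon>\<close> in the threshold: the probabilities are at most of order \<open>j powr (-q)\<close>.\<close>
lemma upper_LIL_one_sided:
  assumes \<sigma>: "\<sigma>^2 > 0" and \<epsilon>: "\<epsilon> > 0" and sgn: "\<bar>\<tau>\<bar> = 1"
  shows "AE \<omega> in M. \<forall>\<^sub>F n in sequentially. \<tau> * Mart n \<omega> \<le> (1 + \<epsilon>) * sqrt lim_var * sqrt (2 * real n * ln (ln (real n)))"
proof -
  define q where "q = 1 + \<epsilon>"
  define \<kappa> where "\<kappa> = ln q"
  have q: "q > 1" and \<kappa>: "\<kappa> > 0" using \<epsilon> by (auto simp: q_def \<kappa>_def)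
  have lim_var: "lim_var > 0" using \<sigma> var_ratio_pos[OF \<theta> \<rho>] by simp
  hence nz: "\<sigma> \<noteq> 0" "A \<noteq> 0" by auto
  define T where "T j = exp (\<kappa> * real j)" for j :: nat
  define lam where "lam j = ln (ln (T j))" for j
  have T_pos: "T j > 0" for j by (simp add: T_def)
  have T_Suc: "T (Suc j) = q * T j" for j
    using q by (simp add: T_def \<kappa>_def algebra_simps exp_add)
  define N where "N j = nat \<lfloor>T (Suc j)\<rfloor>" for j
  have T1: "T (Suc j) \<ge> 1" for j using \<kappa> by (simp add: T_def)
  have N: "N j > 0" and N_le: "real (N j) \<le> q * T j" for j
    using T1[of j] by (auto simp: N_def T_Suc[symmetric])
  (* u is the threshold over the block; a is the slope that is optimal for N = q T, and then the event
     a M >= c is the same as tau M >= u, with exponent a^2 lim_var N / 2 - c <= - q lam. *)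
  define u where "u j = q * sqrt (lim_var * (2 * T j * lam j))" for j
  define a where "a j = \<tau> * sqrt (2 * lam j / (lim_var * T j))" for j
  define c where "c j = 2 * q * lam j" for j
  define Ev where "Ev j = {\<omega>\<in>space M. \<exists>n\<le>N j. a j * Mart n \<omega> \<ge> c j}" for j
  have Ev: "Ev j \<in> events" for j unfolding Ev_def by (rule Mart_maximal_event)
  define C where "C = \<Gamma> * (1 + \<sigma>^2 / 2 * (1 + lim_var / 2))"
  define B where "B j = ((\<kappa> * real j) powr (-q) + (q * T j * (C * \<bar>a j\<bar>^3) + \<sigma>^2 / 2 * \<Gamma> * \<bar>a j\<bar>^2)) / ln 2" for j
  have lam_eq: "lam j = ln (\<kappa> * real j)" for j by (simp add: lam_def T_def)
  have ev_lam: "\<forall>\<^sub>F j in sequentially. lam j > 0"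
    unfolding lam_eq using \<kappa> by real_asymp
  have ev_a: "\<forall>\<^sub>F j in sequentially. \<bar>a j\<bar> \<le> 1"
  proof -
    have "(\<lambda>j. 2 * ln (\<kappa> * real j) / (lim_var * exp (\<kappa> * real j))) \<longlonglongrightarrow> 0"
      by (rule geometric_asymptotics(1)[OF \<kappa> lim_var])
    hence "\<forall>\<^sub>F j in sequentially. 2 * ln (\<kappa> * real j) / (lim_var * exp (\<kappa> * real j)) < 1"
      by (rule order_tendstoD) simp
    thus ?thesis using ev_lam
    proof eventually_elim
      case (elim j)
      hence "2 * lam j / (lim_var * T j) \<le> 1" "2 * lam j / (lim_var * T j) \<ge> 0"
        using lim_var T_pos[of j] by (simp_all add: lam_eq T_def)
      thus ?case using sgn by (simp add: a_def abs_mult)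
    qed
  qed
  have bound: "\<forall>\<^sub>F j in sequentially. prob (Ev j) \<le> B j"
    using ev_lam ev_a eventually_gt_at_top[of 0]
  proof eventually_elim
    case (elim j)
    have a2: "\<bar>a j\<bar>^2 = 2 * lam j / (lim_var * T j)"
      using elim lim_var T_pos[of j] sgn by (simp add: a_def abs_mult power_mult_distrib)
    have "a j^2 * lim_var / 2 * real (N j) \<le> a j^2 * lim_var / 2 * (q * T j)"
      using N_le lim_var_nonneg by (intro mult_left_mono) auto
    also have "a j^2 * lim_var / 2 * (q * T j) = q * lam j"
    proof -
      have "a j^2 = 2 * lam j / (lim_var * T j)" using a2 by simp
      thus ?thesis using nz T_pos[of j] by (simp add: field_simps)
    qed
    finally have "exp (a j^2 * lim_var / 2 * real (N j) - c j) \<le> exp (- q * lam j)"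
      by (simp add: c_def)
    also have "\<dots> = (\<kappa> * real j) powr (-q)"
      using elim \<kappa> by (simp add: lam_eq powr_def)
    finally have 1: "exp (a j^2 * lim_var / 2 * real (N j) - c j) \<le> (\<kappa> * real j) powr (-q)" .
    have "a j^4 \<le> \<bar>a j\<bar>^3"
    proof -
      have "\<bar>a j\<bar>^4 \<le> \<bar>a j\<bar>^3" using elim by (intro power_decreasing) auto
      thus ?thesis by simp
    qed
    hence "\<Gamma> * (\<bar>a j\<bar>^3 + \<sigma>^2 / 2 * (\<bar>a j\<bar>^3 + a j^4 * lim_var / 2)) \<le> \<Gamma> * (\<bar>a j\<bar>^3 + \<sigma>^2 / 2 * (\<bar>a j\<bar>^3 + \<bar>a j\<bar>^3 * lim_var / 2))"
      using \<Gamma>_nonneg lim_var_nonneg by (intro mult_left_mono add_left_mono divide_right_mono mult_right_mono) auto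
    also have "\<dots> = C * \<bar>a j\<bar>^3" by (simp add: C_def algebra_simps)
    finally have 2: "real (N j) * (\<Gamma> * (\<bar>a j\<bar>^3 + \<sigma>^2 / 2 * (\<bar>a j\<bar>^3 + a j^4 * lim_var / 2))) \<le> q * T j * (C * \<bar>a j\<bar>^3)"
    proof (rule mult_mono[OF N_le])
      show "0 \<le> q * T j" using q T_pos[of j] by simp
      show "0 \<le> \<Gamma> * (\<bar>a j\<bar>^3 + \<sigma>^2 / 2 * (\<bar>a j\<bar>^3 + a j^4 * lim_var / 2))"
        using \<Gamma>_nonneg lim_var_nonneg by (intro mult_nonneg_nonneg add_nonneg_nonneg) auto
    qed
    have "prob (Ev j) \<le> (exp (a j^2 * lim_var / 2 * real (N j) - c j)
      + real (N j) * (\<Gamma> * (\<bar>a j\<bar>^3 + \<sigma>^2 / 2 * (\<bar>a j\<bar>^3 + a j^4 * lim_var / 2))) + \<sigma>^2 / 2 * \<Gamma> * (a j)^2) / ln 2"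
      unfolding Ev_def by (rule maximal_tail[OF N])
    also have "\<dots> \<le> B j" unfolding B_def using 1 2 by (intro divide_right_mono) auto
    finally show ?case .
  qed
  have "summable B"
  proof -
    have 1: "summable (\<lambda>j. (\<kappa> * real j) powr (-q))"
    proof (rule summable_comparison_test_bigo)
      show "summable (\<lambda>j. norm (real j powr (-q)))" using q by (simp add: summable_real_powr_iff)
      show "(\<lambda>j. (\<kappa> * real j) powr (-q)) \<in> O(\<lambda>j. real j powr (-q))"
        using \<kappa> by (intro bigoI[of _ "\<kappa> powr (-q)"]) (simp add: powr_mult)
    qed
    have aa: "\<bar>a j\<bar> = sqrt (2 * ln (\<kappa> * real j) / (lim_var * exp (\<kappa> * real j)))" if "lam j > 0" for j
      using that sgn lim_var T_pos[of j] by (simp add: a_def abs_mult lam_eq T_def)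
    have 2: "summable (\<lambda>j. q * T j * (C * \<bar>a j\<bar>^3) + \<sigma>^2 / 2 * \<Gamma> * \<bar>a j\<bar>^2)"
    proof (rule summable_comparison_test_bigo)
      show "summable (\<lambda>j. norm (real j powr (-2)))" by (simp add: summable_real_powr_iff)
      have "(\<lambda>j. T j * (sqrt (2 * ln (\<kappa> * real j) / (lim_var * exp (\<kappa> * real j))))^3) \<in> O(\<lambda>j. real j powr (-2))"
        unfolding T_def by (rule geometric_asymptotics(2)[OF \<kappa> lim_var])
      moreover have "(\<lambda>j. (sqrt (2 * ln (\<kappa> * real j) / (lim_var * exp (\<kappa> * real j))))^2) \<in> O(\<lambda>j. real j powr (-2))"
        by (rule geometric_asymptotics(3)[OF \<kappa> lim_var])
      ultimately have O: "(\<lambda>j. q * C * (T j * (sqrt (2 * ln (\<kappa> * real j) / (lim_var * exp (\<kappa> * real j))))^3)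
        + \<sigma>^2 / 2 * \<Gamma> * (sqrt (2 * ln (\<kappa> * real j) / (lim_var * exp (\<kappa> * real j))))^2) \<in> O(\<lambda>j. real j powr (-2))"
        by (intro sum_in_bigo bigo_cmult)
      have ev: "\<forall>\<^sub>F j in sequentially. q * T j * (C * \<bar>a j\<bar>^3) + \<sigma>^2 / 2 * \<Gamma> * \<bar>a j\<bar>^2
        = q * C * (T j * (sqrt (2 * ln (\<kappa> * real j) / (lim_var * exp (\<kappa> * real j))))^3)
        + \<sigma>^2 / 2 * \<Gamma> * (sqrt (2 * ln (\<kappa> * real j) / (lim_var * exp (\<kappa> * real j))))^2"
        using ev_lam
      proof eventually_elim
        case (elim j)
        have "q * T j * (C * b) = q * C * (T j * b)" for b by (simp add: mult_ac)
        from this[of "\<bar>a j\<bar>^3"] show ?case unfolding aa[OF elim] by (rule arg_cong)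
      qed
      show "(\<lambda>j. q * T j * (C * \<bar>a j\<bar>^3) + \<sigma>^2 / 2 * \<Gamma> * \<bar>a j\<bar>^2) \<in> O(\<lambda>j. real j powr (-2))"
        by (rule landau_o.big.in_cong[OF ev, THEN iffD2, OF O])
    qed
    show ?thesis unfolding B_def by (intro summable_divide summable_add 1 2)
  qed
  hence "summable (\<lambda>j. prob (Ev j))"
    by (rule summable_comparison_test_ev[rotated]) (use bound in \<open>simp add: measure_nonneg\<close>)
  from borel_cantelli_AE1[OF Ev _ this]
  have "AE \<omega> in M. \<forall>\<^sub>F j in sequentially. \<omega> \<in> space M - Ev j" by (simp add: emeasure_eq_measure)
  thus ?thesis
  proof eventually_elim
    case (elim \<omega>)
    from elim ev_lam have "\<forall>\<^sub>F j in sequentially. \<omega> \<in> space M - Ev j \<and> lam j > 0 \<and> j > 0"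
      using eventually_gt_at_top[of 0] by eventually_elim auto
    then obtain J where J: "\<And>j. j \<ge> J \<Longrightarrow> \<omega> \<in> space M - Ev j \<and> lam j > 0 \<and> j > 0"
      by (auto simp: eventually_sequentially)
    (* jn n is the index of the block [q^j, q^(j+1)) that contains n. *)
    define jn where "jn n = nat \<lfloor>ln (real n) / \<kappa>\<rfloor>" for n
    have "filterlim jn at_top sequentially" unfolding jn_def using \<kappa> by real_asymp
    hence "\<forall>\<^sub>F n in sequentially. jn n \<ge> J" by (rule filterlim_at_top[THEN iffD1, rule_format])
    thus ?case using eventually_gt_at_top[of 0]
    proof eventually_elim
      case (elim n)
      let ?j = "jn n"
      from J[OF elim(1)] have j: "\<omega> \<in> space M" "\<omega> \<notin> Ev ?j" "lam ?j > 0" "?j > 0" by auto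
      have "ln (real n) / \<kappa> \<ge> 0" using elim \<kappa> by simp
      hence fl: "real ?j \<le> ln (real n) / \<kappa>" "ln (real n) / \<kappa> < real ?j + 1"
        unfolding jn_def by linarith+
      have lo: "T ?j \<le> real n"
      proof -
        have "\<kappa> * real ?j \<le> ln (real n)" using fl(1) \<kappa> by (simp add: field_simps)
        hence "T ?j \<le> exp (ln (real n))" unfolding T_def by (simp only: exp_le_cancel_iff)
        thus ?thesis using elim by simp
      qed
      have hi: "n \<le> N ?j"
      proof -
        have "ln (real n) \<le> \<kappa> * real (Suc ?j)" using fl(2) \<kappa> by (simp add: field_simps)
        hence "exp (ln (real n)) \<le> T (Suc ?j)" unfolding T_def by (simp only: exp_le_cancel_iff)
        hence "real n \<le> T (Suc ?j)" using elim by simp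
        thus ?thesis unfolding N_def by linarith
      qed
      have "a ?j * Mart n \<omega> < c ?j" using j(1,2) hi unfolding Ev_def by (metis (mono_tags, lifting) mem_Collect_eq not_le)
      define r where "r = sqrt (2 * lam ?j / (lim_var * T ?j))"
      have r: "r > 0" using j lim_var T_pos[of ?j] by (simp add: r_def)
      have "r * u ?j = q * sqrt (2 * lam ?j / (lim_var * T ?j) * (lim_var * (2 * T ?j * lam ?j)))"
        unfolding r_def u_def real_sqrt_mult[of "2 * lam ?j / (lim_var * T ?j)"] by (simp only: mult_ac)
      also have "2 * lam ?j / (lim_var * T ?j) * (lim_var * (2 * T ?j * lam ?j)) = (2 * lam ?j)^2"
        using nz T_pos[of ?j] by (simp add: field_simps power2_eq_square)
      also have "sqrt ((2 * lam ?j)^2) = 2 * lam ?j" using j by (intro real_sqrt_unique) auto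
      also have "q * (2 * lam ?j) = c ?j" by (simp add: c_def)
      finally have "r * (\<tau> * Mart n \<omega>) < r * u ?j"
        using \<open>a ?j * Mart n \<omega> < c ?j\<close> by (simp add: a_def r_def mult_ac)
      hence "\<tau> * Mart n \<omega> \<le> u ?j" using r by simp
      also have "\<dots> \<le> q * sqrt (lim_var * (2 * real n * ln (ln (real n))))"
      proof -
        have l: "ln (T ?j) > 0" using \<kappa> j by (simp add: T_def)
        have "ln (T ?j) \<le> ln (real n)" using lo T_pos[of ?j] by (subst ln_le_cancel_iff) auto
        hence "lam ?j \<le> ln (ln (real n))" unfolding lam_def using l by (subst ln_le_cancel_iff) auto
        hence "2 * T ?j * lam ?j \<le> 2 * real n * ln (ln (real n))"
          using lo j T_pos[of ?j] by (intro mult_mono) auto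
        thus ?thesis unfolding u_def using q lim_var_nonneg
          by (intro mult_left_mono real_sqrt_le_mono) auto
      qed
      also have "\<dots> = (1 + \<epsilon>) * sqrt lim_var * sqrt (2 * real n * ln (ln (real n)))"
        by (simp add: q_def real_sqrt_mult)
      finally show ?case .
    qed
  qed
qed

lemma upper_LIL:
  assumes "\<sigma>^2 > 0"
  shows "AE \<omega> in M. \<forall>\<epsilon>>0. \<forall>\<^sub>F n in sequentially. \<bar>Mart n \<omega>\<bar> \<le> (1 + \<epsilon>) * sqrt lim_var * sqrt (2 * real n * ln (ln (real n)))"
proof -
  have "AE \<omega> in M. \<forall>m. (\<forall>\<^sub>F n in sequentially. 1 * Mart n \<omega> \<le> (1 + 1 / real (Suc m)) * sqrt lim_var * sqrt (2 * real n * ln (ln (real n))))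
     \<and> (\<forall>\<^sub>F n in sequentially. (-1) * Mart n \<omega> \<le> (1 + 1 / real (Suc m)) * sqrt lim_var * sqrt (2 * real n * ln (ln (real n))))"
    unfolding AE_all_countable AE_conj_iff
    by (intro allI conjI upper_LIL_one_sided[OF assms]) auto
  thus ?thesis
  proof (eventually_elim, intro allI impI)
    fix \<omega> and \<epsilon> :: real
    assume H: "\<forall>m. (\<forall>\<^sub>F n in sequentially. 1 * Mart n \<omega> \<le> (1 + 1 / real (Suc m)) * sqrt lim_var * sqrt (2 * real n * ln (ln (real n))))
     \<and> (\<forall>\<^sub>F n in sequentially. (-1) * Mart n \<omega> \<le> (1 + 1 / real (Suc m)) * sqrt lim_var * sqrt (2 * real n * ln (ln (real n))))"
    assume "\<epsilon> > 0"
    then obtain m where m: "1 / real (Suc m) < \<epsilon>" using nat_approx_posE by blast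
    have pos: "\<forall>\<^sub>F n in sequentially. ln (ln (real n)) > 0" by real_asymp
    from H[rule_format, of m, THEN conjunct1] H[rule_format, of m, THEN conjunct2] pos
    show "\<forall>\<^sub>F n in sequentially. \<bar>Mart n \<omega>\<bar> \<le> (1 + \<epsilon>) * sqrt lim_var * sqrt (2 * real n * ln (ln (real n)))"
    proof eventually_elim
      case (elim n)
      have "(1 + 1 / real (Suc m)) * (sqrt lim_var * sqrt (2 * real n * ln (ln (real n))))
        \<le> (1 + \<epsilon>) * (sqrt lim_var * sqrt (2 * real n * ln (ln (real n))))"
        using m elim lim_var_nonneg by (intro mult_right_mono mult_nonneg_nonneg) auto
      thus ?case using elim(1,2) by (simp add: mult.assoc abs_le_iff)
    qed
  qed
qed

end

section \<open>The heat kernel\<close>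

text \<open>A Gaussian bump of variance \<open>\<tau>\<close>, without the factor \<open>1 / sqrt (2 * pi)\<close>.  It solves the heat equation exactly, and so do its
  space derivatives \<open>hk1\<close>, ..., \<open>hk4\<close>.  In the lower half it replaces the indicator of a half line.\<close>
definition heat_kernel :: "real \<Rightarrow> real \<Rightarrow> real" where
  "heat_kernel \<tau> y = exp (- (y^2) / (2 * \<tau>)) / sqrt \<tau>"
definition hk1 :: "real \<Rightarrow> real \<Rightarrow> real" where "hk1 \<tau> y = (- y / \<tau>) * heat_kernel \<tau> y"
definition hk2 :: "real \<Rightarrow> real \<Rightarrow> real" where "hk2 \<tau> y = (y^2 / \<tau>^2 - 1 / \<tau>) * heat_kernel \<tau> y"
definition hk3 :: "real \<Rightarrow> real \<Rightarrow> real" where "hk3 \<tau> y = (3 * y / \<tau>^2 - y^3 / \<tau>^3) * heat_kernel \<tau> y"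
definition hk4 :: "real \<Rightarrow> real \<Rightarrow> real" where
  "hk4 \<tau> y = (y^4 / \<tau>^4 - 6 * y^2 / \<tau>^3 + 3 / \<tau>^2) * heat_kernel \<tau> y"

lemma heat_kernel_deriv:
  assumes t: "\<tau> > 0"
  shows "(heat_kernel \<tau> has_real_derivative hk1 \<tau> y) (at y)"
    "(hk1 \<tau> has_real_derivative hk2 \<tau> y) (at y)"
    "(hk2 \<tau> has_real_derivative hk3 \<tau> y) (at y)"
proof -
  have s: "sqrt \<tau> \<noteq> 0" using t by simp
  show 1: "(heat_kernel \<tau> has_real_derivative hk1 \<tau> y) (at y)" for y
    unfolding heat_kernel_def[abs_def] hk1_def
    using t s by (auto intro!: derivative_eq_intros simp: field_simps)
  show 2: "(hk1 \<tau> has_real_derivative hk2 \<tau> y) (at y)"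
  proof -
    have "((\<lambda>y. (- y / \<tau>) * heat_kernel \<tau> y) has_real_derivative
        (- 1 / \<tau>) * heat_kernel \<tau> y + hk1 \<tau> y * (- y / \<tau>)) (at y)"
      using t by (intro DERIV_mult 1) (auto intro!: derivative_eq_intros)
    thus ?thesis using t by (simp add: hk1_def[abs_def] hk2_def field_simps power2_eq_square)
  qed
  show 3: "(hk2 \<tau> has_real_derivative hk3 \<tau> y) (at y)"
  proof -
    have "((\<lambda>y. (y^2 / \<tau>^2 - 1 / \<tau>) * heat_kernel \<tau> y) has_real_derivative
        (2 * y / \<tau>^2) * heat_kernel \<tau> y + hk1 \<tau> y * (y^2 / \<tau>^2 - 1 / \<tau>)) (at y)"
      using t by (intro DERIV_mult 1)
        (auto intro!: derivative_eq_intros simp: field_simps power2_eq_square power4_eq_xxxx)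
    moreover have "(2 * y / \<tau>^2) * heat_kernel \<tau> y + hk1 \<tau> y * (y^2 / \<tau>^2 - 1 / \<tau>) = hk3 \<tau> y"
      using t by (simp add: hk1_def hk3_def field_simps power2_eq_square power3_eq_cube)
    ultimately show ?thesis by (simp add: hk2_def[abs_def])
  qed
qed

lemma heat_equation:
  assumes t: "\<tau> > 0"
  shows "((\<lambda>\<tau>. heat_kernel \<tau> y) has_real_derivative hk2 \<tau> y / 2) (at \<tau>)"
    "((\<lambda>\<tau>. hk2 \<tau> y) has_real_derivative hk4 \<tau> y / 2) (at \<tau>)"
proof -
  show 1: "((\<lambda>\<tau>. heat_kernel \<tau> y) has_real_derivative hk2 \<tau> y / 2) (at \<tau>)"
  proof -
    have e: "((\<lambda>\<tau>. - (y^2) / (2 * \<tau>)) has_real_derivative y^2 / (2 * \<tau>^2)) (at \<tau>)"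
      using t by (auto intro!: derivative_eq_intros simp: field_simps power2_eq_square)
    have "((\<lambda>\<tau>. exp (- (y^2) / (2 * \<tau>)) / sqrt \<tau>) has_real_derivative
       (exp (- (y^2) / (2 * \<tau>)) * (y^2 / (2 * \<tau>^2)) * sqrt \<tau> - exp (- (y^2) / (2 * \<tau>)) * (inverse (sqrt \<tau>) / 2)) / (sqrt \<tau> * sqrt \<tau>)) (at \<tau>)"
      using t by (intro DERIV_divide DERIV_fun_exp e DERIV_real_sqrt) auto
    moreover have "(exp (- (y^2) / (2 * \<tau>)) * (y^2 / (2 * \<tau>^2)) * sqrt \<tau> - exp (- (y^2) / (2 * \<tau>)) * (inverse (sqrt \<tau>) / 2)) / (sqrt \<tau> * sqrt \<tau>)
      = hk2 \<tau> y / 2"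
    proof -
      have r: "sqrt \<tau> * sqrt \<tau> = \<tau>" "sqrt \<tau> > 0" using t by auto
      define w where "w = sqrt \<tau>"
      have w: "w > 0" "\<tau> = w^2" using t by (auto simp: w_def)
      show ?thesis unfolding hk2_def heat_kernel_def w_def[symmetric] unfolding w(2) using w(1)
        by (simp add: field_simps power2_eq_square)
    qed
    ultimately show ?thesis unfolding heat_kernel_def by (rule DERIV_cong)
  qed
  show "((\<lambda>\<tau>. hk2 \<tau> y) has_real_derivative hk4 \<tau> y / 2) (at \<tau>)"
  proof -
    have c: "((\<lambda>\<tau>. y^2 / \<tau>^2 - 1 / \<tau>) has_real_derivative (- 2 * y^2 / \<tau>^3 + 1 / \<tau>^2)) (at \<tau>)"
      using t by (auto intro!: derivative_eq_intros simp: field_simps power2_eq_square power3_eq_cube)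
    have "((\<lambda>\<tau>. (y^2 / \<tau>^2 - 1 / \<tau>) * heat_kernel \<tau> y) has_real_derivative
       (- 2 * y^2 / \<tau>^3 + 1 / \<tau>^2) * heat_kernel \<tau> y + hk2 \<tau> y / 2 * (y^2 / \<tau>^2 - 1 / \<tau>)) (at \<tau>)"
      by (intro DERIV_mult c 1)
    moreover have "(- 2 * y^2 / \<tau>^3 + 1 / \<tau>^2) * heat_kernel \<tau> y + hk2 \<tau> y / 2 * (y^2 / \<tau>^2 - 1 / \<tau>) = hk4 \<tau> y / 2"
      using t by (simp add: hk2_def hk4_def field_simps power2_eq_square power3_eq_cube power4_eq_xxxx)
    ultimately show ?thesis unfolding hk2_def[of _ y] by (rule DERIV_cong)
  qed
qed

text \<open>In the variable \<open>v = \<bar>y\<bar> / sqrt \<tau>\<close> every derivative is a polynomial of degree at most 4 in \<open>v\<close> times \<open>exp (- v^2 / 2)\<close>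
  times a power of \<open>1 / sqrt \<tau>\<close>, hence bounded as long as \<open>\<tau>\<close> stays away from zero.\<close>
lemma heat_kernel_bounds:
  fixes a :: real
  assumes a: "a > 0"
  obtains C where "C \<ge> 0"
    and "\<And>\<tau> y. \<tau> \<ge> a \<Longrightarrow> \<bar>heat_kernel \<tau> y\<bar> \<le> C"
    and "\<And>\<tau> y. \<tau> \<ge> a \<Longrightarrow> \<bar>hk1 \<tau> y\<bar> \<le> C"
    and "\<And>\<tau> y. \<tau> \<ge> a \<Longrightarrow> \<bar>hk2 \<tau> y\<bar> \<le> C"
    and "\<And>\<tau> y. \<tau> \<ge> a \<Longrightarrow> \<bar>hk3 \<tau> y\<bar> \<le> C"
    and "\<And>\<tau> y. \<tau> \<ge> a \<Longrightarrow> \<bar>hk4 \<tau> y\<bar> \<le> C"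
proof -
  define b where "b = max 1 (1 / a)"
  have b: "b \<ge> 1" by (simp add: b_def)
  define C where "C = 100 * b^5"
  have key: "(1 + \<bar>y\<bar> / sqrt \<tau> + (\<bar>y\<bar> / sqrt \<tau>)^2 + (\<bar>y\<bar> / sqrt \<tau>)^3 + (\<bar>y\<bar> / sqrt \<tau>)^4) * heat_kernel \<tau> y \<le> 16 * b"
    and tau: "1 / \<tau> \<le> b" "\<tau> > 0" and pos: "heat_kernel \<tau> y > 0"
    if "\<tau> \<ge> a" for \<tau> y
  proof -
    show t: "\<tau> > 0" using that a by simp
    have "1 / \<tau> \<le> 1 / a" using that a by (simp add: frac_le)
    thus "1 / \<tau> \<le> b" by (simp add: b_def)
    have "1 / sqrt \<tau> = sqrt (1 / \<tau>)" by (simp add: real_sqrt_divide)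
    also have "\<dots> \<le> sqrt (b^2)"
    proof -
      have "1 / \<tau> \<le> b * b" using \<open>1 / \<tau> \<le> b\<close> b mult_left_mono[of 1 b b] by linarith
      hence "1 / \<tau> \<le> b^2" by (simp add: power2_eq_square)
      thus ?thesis by (rule real_sqrt_le_mono)
    qed
    also have "\<dots> = b" using b by simp
    finally have sb: "1 / sqrt \<tau> \<le> b" .
    show "heat_kernel \<tau> y > 0" using t by (simp add: heat_kernel_def)
    define v where "v = \<bar>y\<bar> / sqrt \<tau>"
    have v0: "v \<ge> 0" using t by (simp add: v_def)
    have v2: "v^2 = y^2 / \<tau>" using t by (simp add: v_def power_divide)
    have hk: "heat_kernel \<tau> y = exp (- (v^2 / 2)) * (1 / sqrt \<tau>)" by (simp add: heat_kernel_def v2)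
    have "1 + v^2/2 + (v^2/2)^2/2 \<le> exp (v^2/2)"
      by (rule exp_lower_Taylor_quadratic) simp
    hence e: "1 + v^2/2 + v^4/8 \<le> exp (v^2/2)" by (simp add: power_divide power2_eq_square power4_eq_xxxx)
    have "2 * v \<le> 1 + v^2" using zero_le_power2[of "v - 1"] by (simp add: power2_diff)
    hence "v \<le> 1 + v^2" using v0 by linarith
    moreover have "v^3 \<le> v^2 + v^4"
    proof -
      have "v * v^2 \<le> (1 + v^2) * v^2" using \<open>v \<le> 1 + v^2\<close> by (intro mult_right_mono) auto
      thus ?thesis by (simp add: power2_eq_square power3_eq_cube power4_eq_xxxx algebra_simps)
    qed
    ultimately have "1 + v + v^2 + v^3 + v^4 \<le> 2 + 3 * v^2 + 2 * v^4" by linarith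
    also have "\<dots> \<le> 16 * (1 + v^2/2 + v^4/8)" by simp
    also have "\<dots> \<le> 16 * exp (v^2/2)" using e by simp
    finally have "(1 + v + v^2 + v^3 + v^4) * exp (- (v^2/2)) \<le> 16 * exp (v^2/2) * exp (- (v^2/2))"
      by (intro mult_right_mono) auto
    also have "\<dots> = 16" by (simp flip: exp_add)
    finally have "(1 + v + v^2 + v^3 + v^4) * exp (- (v^2/2)) * (1 / sqrt \<tau>) \<le> 16 * b"
      using sb v0 t by (intro mult_mono) auto
    thus "(1 + \<bar>y\<bar> / sqrt \<tau> + (\<bar>y\<bar> / sqrt \<tau>)^2 + (\<bar>y\<bar> / sqrt \<tau>)^3 + (\<bar>y\<bar> / sqrt \<tau>)^4) * heat_kernel \<tau> y \<le> 16 * b"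
      unfolding hk v_def by (simp add: mult_ac)
  qed
  have main: "\<bar>p * heat_kernel \<tau> y\<bar> \<le> 16 * c * b"
    if t: "\<tau> \<ge> a" and c: "c \<ge> 0"
      and p: "\<bar>p\<bar> \<le> c * (1 + \<bar>y\<bar> / sqrt \<tau> + (\<bar>y\<bar> / sqrt \<tau>)^2 + (\<bar>y\<bar> / sqrt \<tau>)^3 + (\<bar>y\<bar> / sqrt \<tau>)^4)" for \<tau> y p c
  proof -
    have "\<bar>p * heat_kernel \<tau> y\<bar> = \<bar>p\<bar> * heat_kernel \<tau> y" using pos[OF t, of y] by (simp add: abs_mult)
    also have "\<dots> \<le> c * (1 + \<bar>y\<bar> / sqrt \<tau> + (\<bar>y\<bar> / sqrt \<tau>)^2 + (\<bar>y\<bar> / sqrt \<tau>)^3 + (\<bar>y\<bar> / sqrt \<tau>)^4) * heat_kernel \<tau> y"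
      using p pos[OF t, of y] by (intro mult_right_mono) auto
    also have "\<dots> \<le> c * (16 * b)" unfolding mult.assoc using key[OF t, of y] c by (intro mult_left_mono)
    finally show ?thesis by (simp add: mult_ac)
  qed
  show ?thesis
  proof (rule that[of C])
    show "C \<ge> 0" using b by (simp add: C_def)
    fix \<tau> y assume t: "\<tau> \<ge> a"
    define r v where "r = 1 / sqrt \<tau>" and "v = \<bar>y\<bar> / sqrt \<tau>"
    have t0: "\<tau> > 0" using tau[OF t] by simp
    have r0: "r > 0" and v0: "v \<ge> 0" using t0 by (auto simp: r_def v_def)
    have r2: "r^2 = 1 / \<tau>" using t0 by (simp add: r_def power_divide)
    have r2b: "r^2 \<le> b" using tau[OF t] r2 by simp
    have rb: "r \<le> b"
    proof (rule power2_le_imp_le)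
      show "r^2 \<le> b^2" using r2b b self_le_power[of b 2] by simp
    qed (use b in simp)
    have yv: "\<bar>y\<bar> / \<tau> = v * r" using t0 by (simp add: v_def r_def)
    have pw: "r^k \<le> b^4" if "k \<le> 4" for k
      using power_mono[OF rb, of k] power_increasing[OF that, of b] b r0 by auto
    have sixteen: "16 * (c * b^4) * b \<le> C" if "c \<le> 6" for c
    proof -
      have "16 * (c * b^4) * b = (16 * c) * b^5" by (simp add: power_numeral_reduce mult_ac)
      also have "\<dots> \<le> 100 * b^5" using that b by (intro mult_right_mono) auto
      finally show ?thesis by (simp add: C_def)
    qed
    have poly: "1 \<le> 1 + v + v^2 + v^3 + v^4" "v \<le> 1 + v + v^2 + v^3 + v^4" using v0 by auto
    show "\<bar>heat_kernel \<tau> y\<bar> \<le> C"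
    proof -
      have "\<bar>1 * heat_kernel \<tau> y\<bar> \<le> 16 * (1 * b^4) * b"
        by (rule main[OF t]) (use b v0 mult_mono[OF one_le_power[OF b, of 4] poly(1)] in \<open>auto simp: v_def[symmetric]\<close>)
      thus ?thesis using sixteen[of 1] by simp
    qed
    show "\<bar>hk1 \<tau> y\<bar> \<le> C"
    proof -
      have "\<bar>- y / \<tau>\<bar> = r * v" using yv t0 by simp
      also have "\<dots> \<le> b^4 * (1 + v + v^2 + v^3 + v^4)"
        using pw[of 1] poly v0 r0 b by (intro mult_mono) auto
      finally have "\<bar>(- y / \<tau>) * heat_kernel \<tau> y\<bar> \<le> 16 * (1 * b^4) * b"
        by (intro main[OF t]) (use b in \<open>auto simp: v_def\<close>)
      thus ?thesis unfolding hk1_def using sixteen[of 1] by simp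
    qed
    show "\<bar>hk2 \<tau> y\<bar> \<le> C"
    proof -
      have "y^2 / \<tau>^2 - 1 / \<tau> = r^2 * (v^2 - 1)"
      proof -
        have v2: "v^2 = y^2 / \<tau>" using t0 by (simp add: v_def power_divide)
        show ?thesis unfolding r2 v2 using t0 by (simp add: power2_eq_square field_simps)
      qed
      also have "\<bar>\<dots>\<bar> \<le> r^2 * (v^2 + 1)"
        using abs_triangle_ineq4[of "v^2" 1] by (auto simp: abs_mult intro!: mult_left_mono)
      also have "\<dots> \<le> b^4 * (1 + v + v^2 + v^3 + v^4)"
        using pw[of 2] v0 r0 b by (intro mult_mono) auto
      finally have "\<bar>(y^2 / \<tau>^2 - 1 / \<tau>) * heat_kernel \<tau> y\<bar> \<le> 16 * (1 * b^4) * b"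
        by (intro main[OF t]) (use b in \<open>auto simp: v_def\<close>)
      thus ?thesis unfolding hk2_def using sixteen[of 1] by simp
    qed
    show "\<bar>hk3 \<tau> y\<bar> \<le> C"
    proof -
      have "\<bar>3 * y / \<tau>^2 - y^3 / \<tau>^3\<bar> \<le> \<bar>3 * y / \<tau>^2\<bar> + \<bar>y^3 / \<tau>^3\<bar>" by (rule abs_triangle_ineq4)
      also have "\<bar>3 * y / \<tau>^2\<bar> = 3 * r^3 * v"
      proof -
        have "\<bar>3 * y / \<tau>^2\<bar> = 3 * (\<bar>y\<bar> / \<tau>) * (1 / \<tau>)" using t0 by (simp add: abs_mult power2_eq_square)
        thus ?thesis unfolding yv r2[symmetric] by (simp add: power3_eq_cube power2_eq_square)
      qed
      also have "\<bar>y^3 / \<tau>^3\<bar> = r^3 * v^3"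
      proof -
        have "\<bar>y^3 / \<tau>^3\<bar> = (\<bar>y\<bar> / \<tau>)^3" using t0 by (simp add: power_divide power_abs)
        thus ?thesis unfolding yv by (simp add: power_mult_distrib)
      qed
      also have "3 * r^3 * v + r^3 * v^3 = r^3 * (3 * v + v^3)" by (simp add: algebra_simps)
      also have "\<dots> \<le> b^4 * (3 * (1 + v + v^2 + v^3 + v^4))"
        using pw[of 3] v0 r0 b by (intro mult_mono) auto
      also have "\<dots> = 3 * b^4 * (1 + v + v^2 + v^3 + v^4)" by (simp only: mult_ac)
      finally have P: "\<bar>3 * y / \<tau>^2 - y^3 / \<tau>^3\<bar> \<le> 3 * b^4 * (1 + v + v^2 + v^3 + v^4)" .
      have "\<bar>(3 * y / \<tau>^2 - y^3 / \<tau>^3) * heat_kernel \<tau> y\<bar> \<le> 16 * (3 * b^4) * b"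
        by (rule main[OF t _ P[unfolded v_def]]) (use b in simp)
      thus ?thesis unfolding hk3_def using sixteen[of 3] by simp
    qed
    show "\<bar>hk4 \<tau> y\<bar> \<le> C"
    proof -
      have e: "y^4 / \<tau>^4 - 6 * y^2 / \<tau>^3 + 3 / \<tau>^2 = r^4 * (v^4 - 6 * v^2 + 3)"
      proof -
        have r4: "r^4 = (1 / \<tau>)^2" by (simp flip: r2 power_mult)
        have v2: "v^2 = y^2 / \<tau>" using t0 by (simp add: v_def power_divide)
        have v4: "v^4 = (y^2 / \<tau>)^2" by (simp flip: v2 power_mult)
        show ?thesis unfolding r4 v4 v2 using t0
          by (simp add: power_divide power2_eq_square power3_eq_cube power4_eq_xxxx field_simps)
      qed
      have "\<bar>v^4 - 6 * v^2 + 3\<bar> \<le> 6 * (1 + v + v^2 + v^3 + v^4)"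
        using v0 by (auto simp: abs_le_iff)
      hence "\<bar>r^4 * (v^4 - 6 * v^2 + 3)\<bar> \<le> r^4 * (6 * (1 + v + v^2 + v^3 + v^4))"
        by (auto simp: abs_mult intro!: mult_left_mono)
      also have "\<dots> \<le> b^4 * (6 * (1 + v + v^2 + v^3 + v^4))"
        using pw[of 4] v0 by (intro mult_right_mono) auto
      also have "\<dots> = 6 * b^4 * (1 + v + v^2 + v^3 + v^4)" by (simp only: mult_ac)
      finally have P: "\<bar>y^4 / \<tau>^4 - 6 * y^2 / \<tau>^3 + 3 / \<tau>^2\<bar> \<le> 6 * b^4 * (1 + v + v^2 + v^3 + v^4)"
        unfolding e .
      have "\<bar>(y^4 / \<tau>^4 - 6 * y^2 / \<tau>^3 + 3 / \<tau>^2) * heat_kernel \<tau> y\<bar> \<le> 16 * (6 * b^4) * b"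
        by (rule main[OF t _ P[unfolded v_def]]) (use b in simp)
      thus ?thesis unfolding hk4_def using sixteen[of 6] by simp
    qed
  qed
qed

lemma heat_kernel_measurable [measurable]:
  "heat_kernel \<tau> \<in> borel_measurable borel" "hk1 \<tau> \<in> borel_measurable borel" "hk2 \<tau> \<in> borel_measurable borel"
  unfolding heat_kernel_def[abs_def] hk1_def[abs_def] hk2_def[abs_def] by measurable

section \<open>Large sums over independent blocks\<close>

text \<open>The probability that none of the independent events with index in a finite range occurs is at most the
  exponential of minus the sum of their probabilities.\<close>
lemma borel_cantelli2:
  assumes "prob_space M" and ind: "prob_space.indep_sets M F (UNIV :: nat set)"
    and A: "\<And>n. A n \<in> F n" "\<And>n. space M - A n \<in> F n"
    and F: "\<And>n. F n \<subseteq> sets M"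
    and div: "\<not> summable (\<lambda>n. measure M (A n))"
  shows "AE \<omega> in M. \<exists>\<^sub>F n in sequentially. \<omega> \<in> A n"
proof -
  interpret prob_space M by fact
  have A_ev [measurable]: "A n \<in> events" for n using A F by blast
  define B where "B m = (\<Inter>n\<in>{m..}. space M - A n)" for m
  have B_ev: "B m \<in> events" for m unfolding B_def by (intro sets.countable_INT') auto
  have "prob (B m) = 0" for m
  proof -
    have le: "prob (B m) \<le> exp (- (\<Sum>n\<in>{m..<m+Suc k}. prob (A n)))" for k
    proof -
      have "prob (B m) \<le> prob (\<Inter>n\<in>{m..<m+Suc k}. space M - A n)"
        by (intro finite_measure_mono sets.finite_INT) (auto simp: B_def)
      also have "\<dots> = (\<Prod>n\<in>{m..<m+Suc k}. prob (space M - A n))"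
        by (rule indep_setsD[OF ind]) (use A in auto)
      also have "\<dots> = (\<Prod>n\<in>{m..<m+Suc k}. 1 - prob (A n))" by (simp add: prob_compl)
      also have "\<dots> \<le> (\<Prod>n\<in>{m..<m+Suc k}. exp (- prob (A n)))"
        using exp_ge_add_one_self[of "- prob (A n)" for n] by (intro prod_mono) auto
      also have "\<dots> = exp (- (\<Sum>n\<in>{m..<m+Suc k}. prob (A n)))" by (simp only: exp_sum[symmetric] finite_atLeastLessThan sum_negf)
      finally show ?thesis .
    qed
    have shift: "(\<Sum>n\<in>{m..<m+Suc k}. prob (A n)) = (\<Sum>n<Suc k. prob (A (n + m)))" for k
      using sum.shift_bounds_nat_ivl[of "\<lambda>n. prob (A n)" 0 m "Suc k"] by (simp add: atLeast0LessThan add.commute)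
    have "\<not> summable (\<lambda>n. prob (A (n + m)))" using div by (simp only: summable_iff_shift[of "\<lambda>n. prob (A n)"]) simp
    hence unb: "\<exists>k. (\<Sum>n<k. prob (A (n + m))) > c" for c
      by (metis bounded_imp_summable measure_nonneg lessThan_Suc_atMost not_le)
    have "prob (B m) \<le> e" if "e > 0" for e
    proof -
      obtain k where k: "(\<Sum>n<k. prob (A (n + m))) > max 0 (- ln e)" using unb by blast
      then obtain k' where k': "k = Suc k'" by (cases k) auto
      have "prob (B m) \<le> exp (- (\<Sum>n<k. prob (A (n + m))))" unfolding k' using le[of k'] unfolding shift .
      also have "\<dots> \<le> exp (ln e)" using k by simp
      finally show ?thesis using that by simp
    qed
    thus ?thesis using measure_nonneg[of M "B m"] by (metis field_le_epsilon add_0 antisym)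
  qed
  hence "AE \<omega> in M. \<omega> \<notin> B m" for m
    using B_ev by (intro AE_not_in) (auto simp: null_sets_def emeasure_eq_measure)
  hence "AE \<omega> in M. \<forall>m. \<omega> \<notin> B m" by (simp add: AE_all_countable)
  thus ?thesis using AE_space
  proof eventually_elim
    case (elim \<omega>)
    thus ?case by (auto simp: frequently_sequentially B_def)
  qed
qed

context ar_noise
begin

text \<open>Depends on the noise only through \<open>\<sigma>\<close> and \<open>K\<close>, hence is the same for all blocks.\<close>
definition heat_error :: "real \<Rightarrow> real" where
  "heat_error C = lim_var^2 * C + \<Gamma> * (C + \<sigma>^2 / 2 * (C + C * lim_var)) + \<sigma>^2 / 2 * \<Gamma> * C"

text \<open>The comparison lemma applied to minus the kernel with variance \<open>a + \<sigma>^4 * A * (1 - k / N)\<close> at step \<open>k\<close>.  The kernel solves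
  the heat equation in continuous time; one discrete step costs the square of the step length.\<close>
lemma heat_kernel_expectation:
  assumes N: "N > 0" and a: "a > 0" and C: "C \<ge> 0"
    and "\<And>\<tau> y. \<tau> \<ge> a \<Longrightarrow> \<bar>heat_kernel \<tau> y\<bar> \<le> C"
    and "\<And>\<tau> y. \<tau> \<ge> a \<Longrightarrow> \<bar>hk1 \<tau> y\<bar> \<le> C"
    and "\<And>\<tau> y. \<tau> \<ge> a \<Longrightarrow> \<bar>hk2 \<tau> y\<bar> \<le> C"
    and "\<And>\<tau> y. \<tau> \<ge> a \<Longrightarrow> \<bar>hk3 \<tau> y\<bar> \<le> C"
    and "\<And>\<tau> y. \<tau> \<ge> a \<Longrightarrow> \<bar>hk4 \<tau> y\<bar> \<le> C"
  shows "expectation (\<lambda>\<omega>. heat_kernel a (Mart N \<omega> / sqrt (real N) - b))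
    \<ge> heat_kernel (a + lim_var) b - heat_error C / sqrt (real N)"
proof -
  note bd = assms(4-8)
  define r where "r = 1 / sqrt (real N)"
  have r: "r > 0" "r \<le> 1" using N by (auto simp: r_def)
  have r2: "r^2 = 1 / real N" using N by (simp add: r_def power_divide)
  define h where "h = lim_var * r^2"
  have h: "h \<ge> 0" using lim_var_nonneg by (simp add: h_def)
  define t where "t k = a + h * real (N - k)" for k
  have t: "t k \<ge> a" for k using h by (simp add: t_def)
  have t0: "t k > 0" for k using t[of k] a by linarith
  have t_step: "t k = t (Suc k) + h" if "k < N" for k
  proof -
    have "N - k = Suc (N - Suc k)" using that by simp
    thus ?thesis by (simp add: t_def algebra_simps)
  qed
  define z where "z x = r * x - b" for x
  have z_add: "z (x + d) = z x + r * d" for x d by (simp add: z_def algebra_simps)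
  define g where "g k x = - heat_kernel (t k) (z x)" for k x
  define g1 where "g1 k x = - (r * hk1 (t (Suc k)) (z x))" for k x
  define g2 where "g2 k x = - (r^2 * hk2 (t (Suc k)) (z x))" for k x
  have time: "\<bar>hk2 (\<tau> + h) y - hk2 \<tau> y\<bar> \<le> C * h" and
    time2: "heat_kernel (\<tau> + h) y \<le> heat_kernel \<tau> y + h * (hk2 \<tau> y / 2) + C * h^2" if ta: "\<tau> \<ge> a" for \<tau> y
  proof -
    have pos: "u > 0" if "u \<ge> \<tau>" for u using that ta a by linarith
    have 1: "\<bar>hk2 (\<tau> + h') y - hk2 \<tau> y\<bar> \<le> C * h'" if "h' \<ge> 0" for h'
    proof (cases "h' = 0")
      case False
      hence "\<exists>u. u > \<tau> \<and> u < \<tau> + h' \<and> hk2 (\<tau> + h') y - hk2 \<tau> y = (\<tau> + h' - \<tau>) * (hk4 u y / 2)"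
        using that pos by (intro MVT2 heat_equation(2)) auto
      then obtain u where u: "u > \<tau>" "hk2 (\<tau> + h') y - hk2 \<tau> y = h' * (hk4 u y / 2)" by auto
      have "\<bar>hk4 u y\<bar> \<le> C" using u ta by (intro bd) simp
      hence "h' * \<bar>hk4 u y\<bar> / 2 \<le> h' * C / 2" using that by (intro divide_right_mono mult_left_mono) auto
      moreover have "0 \<le> h' * C" using that C by simp
      moreover have "\<bar>hk2 (\<tau> + h') y - hk2 \<tau> y\<bar> = h' * \<bar>hk4 u y\<bar> / 2"
        unfolding u(2) using that by (simp add: abs_mult)
      ultimately show ?thesis by (simp add: mult.commute)
    qed simp
    show "\<bar>hk2 (\<tau> + h) y - hk2 \<tau> y\<bar> \<le> C * h" by (rule 1[OF h])
    show "heat_kernel (\<tau> + h) y \<le> heat_kernel \<tau> y + h * (hk2 \<tau> y / 2) + C * h^2"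
    proof (cases "h = 0")
      case False
      hence "\<exists>u. u > \<tau> \<and> u < \<tau> + h \<and> heat_kernel (\<tau> + h) y - heat_kernel \<tau> y = (\<tau> + h - \<tau>) * (hk2 u y / 2)"
        using h pos by (intro MVT2 heat_equation(1)) auto
      then obtain u where u: "u > \<tau>" "u < \<tau> + h" "heat_kernel (\<tau> + h) y - heat_kernel \<tau> y = h * (hk2 u y / 2)" by auto
      have "hk2 u y \<le> hk2 \<tau> y + C * (u - \<tau>)" using 1[of "u - \<tau>"] u by (auto simp: abs_le_iff)
      also have "\<dots> \<le> hk2 \<tau> y + C * h" using u C by (intro add_left_mono mult_left_mono) auto
      finally have "h * (hk2 u y / 2) \<le> h * ((hk2 \<tau> y + C * h) / 2)" using h by (intro mult_left_mono) auto
      also have "\<dots> = h * (hk2 \<tau> y / 2) + C * h^2 / 2" by (simp add: algebra_simps power2_eq_square add_divide_distrib)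
      also have "\<dots> \<le> h * (hk2 \<tau> y / 2) + C * h^2" using C by simp
      finally show ?thesis using u by simp
    qed simp
  qed
  have "expectation (\<lambda>\<omega>. g N (Mart N \<omega>))
    \<le> g 0 0 + real N * (C * h^2 + \<Gamma> * (C * r^3 + \<sigma>^2 / 2 * (C * r^3 + r^2 * (C * h)))) + \<sigma>^2 / 2 * \<Gamma> * (C * r^2)"
  proof (rule heat_comparison[where ?g1.0=g1 and ?g2.0=g2 and ?B0.0=C and ?B1.0="C * r"])
    fix k x d
    show "g k \<in> borel_measurable borel" "g1 k \<in> borel_measurable borel" "g2 k \<in> borel_measurable borel"
      unfolding g_def g1_def g2_def z_def by measurable
    have "\<bar>g k x\<bar> \<le> C" using bd(1)[OF t, of k "z x"] by (simp add: g_def)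
    also have "\<dots> \<le> C * (1 + \<bar>x\<bar>)" using C by (simp add: algebra_simps)
    finally show "\<bar>g k x\<bar> \<le> C * (1 + \<bar>x\<bar>)" .
    show "\<bar>g1 k x\<bar> \<le> C * r"
      using bd(2)[OF t, of "Suc k" "z x"] r by (simp add: g1_def abs_mult mult.commute mult_left_mono)
    show "\<bar>g2 k x\<bar> \<le> C * r^2"
      using bd(3)[OF t, of "Suc k" "z x"] r by (simp add: g2_def abs_mult mult.commute mult_left_mono)
    show "g (Suc k) (x + d) \<le> g (Suc k) x + g1 k x * d + g2 k x * d^2 / 2 + C * r^3 * \<bar>d\<bar>^3"
    proof -
      obtain u where u: "heat_kernel (t (Suc k)) (z x + r * d) = heat_kernel (t (Suc k)) (z x)
        + hk1 (t (Suc k)) (z x) * (r * d) + hk2 (t (Suc k)) (z x) * (r * d)^2 / 2 + hk3 (t (Suc k)) u * (r * d)^3 / 6"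
        using taylor3[OF heat_kernel_deriv(1)[OF t0] heat_kernel_deriv(2)[OF t0] heat_kernel_deriv(3)[OF t0]] by blast
      have "- (hk3 (t (Suc k)) u * (r * d)^3) \<le> \<bar>hk3 (t (Suc k)) u\<bar> * \<bar>r * d\<bar>^3"
        by (metis abs_ge_minus_self abs_mult power_abs)
      also have "\<dots> \<le> C * \<bar>r * d\<bar>^3" by (intro mult_right_mono bd t) auto
      finally have "- (hk3 (t (Suc k)) u * (r * d)^3 / 6) \<le> C * \<bar>r * d\<bar>^3 / 6" by simp
      also have "\<dots> \<le> C * \<bar>r * d\<bar>^3" using C by simp
      also have "\<dots> = C * r^3 * \<bar>d\<bar>^3" using r by (simp add: abs_mult power_mult_distrib)
      finally show ?thesis unfolding g_def g1_def g2_def z_add u by (simp add: power_mult_distrib algebra_simps)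
    qed
    show "g (Suc k) x + \<sigma>^4 * A / 2 * g2 k x \<le> g k x + C * h^2" if "k < N"
      using time2[OF t, of "Suc k" "z x"] by (simp add: g_def g2_def t_step[OF that] h_def algebra_simps)
    show "\<bar>g2 (Suc k) (x + d) - g2 k x\<bar> \<le> C * r^3 * \<bar>d\<bar> + r^2 * (C * h)" if "Suc k < N"
    proof -
      let ?t = "t (Suc (Suc k))"
      have ts: "t (Suc k) = ?t + h" using t_step[OF that] .
      obtain u where u: "hk2 ?t (z x + r * d) = hk2 ?t (z x) + hk3 ?t u * (r * d)"
        using taylor1[OF heat_kernel_deriv(3)[OF t0]] by blast
      have "\<bar>hk2 ?t (z x + r * d) - hk2 ?t (z x)\<bar> \<le> C * (r * \<bar>d\<bar>)"
        unfolding u using bd(4)[OF t, of "Suc (Suc k)" u] r by (auto simp: abs_mult intro!: mult_right_mono)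
      moreover have "\<bar>hk2 (?t + h) (z x) - hk2 ?t (z x)\<bar> \<le> C * h" by (rule time[OF t])
      ultimately have "\<bar>hk2 ?t (z x + r * d) - hk2 (?t + h) (z x)\<bar> \<le> C * (r * \<bar>d\<bar>) + C * h" by linarith
      hence "r^2 * \<bar>hk2 ?t (z x + r * d) - hk2 (?t + h) (z x)\<bar> \<le> r^2 * (C * (r * \<bar>d\<bar>) + C * h)"
        by (intro mult_left_mono) auto
      moreover have "\<bar>g2 (Suc k) (x + d) - g2 k x\<bar> = r^2 * \<bar>hk2 ?t (z x + r * d) - hk2 (?t + h) (z x)\<bar>"
      proof -
        have "g2 (Suc k) (x + d) - g2 k x = - (r^2 * (hk2 ?t (z x + r * d) - hk2 (?t + h) (z x)))"
          unfolding g2_def z_add ts by (simp add: algebra_simps)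
        thus ?thesis by (simp add: abs_mult)
      qed
      moreover have "r^2 * (C * (r * \<bar>d\<bar>) + C * h) = C * r^3 * \<bar>d\<bar> + r^2 * (C * h)"
        by (simp add: algebra_simps power2_eq_square power3_eq_cube)
      ultimately show ?thesis by simp
    qed
  qed (use h N C r in auto)
  moreover have "g 0 0 = - heat_kernel (a + lim_var) b"
  proof -
    have "t 0 = a + lim_var" using N by (simp add: t_def h_def r2)
    thus ?thesis by (simp add: g_def z_def heat_kernel_def)
  qed
  moreover have "g N x = - heat_kernel a (x / sqrt (real N) - b)" for x
    by (simp add: g_def z_def t_def r_def)
  moreover have "real N * (C * h^2 + \<Gamma> * (C * r^3 + \<sigma>^2 / 2 * (C * r^3 + r^2 * (C * h)))) + \<sigma>^2 / 2 * \<Gamma> * (C * r^2)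
      \<le> heat_error C / sqrt (real N)"
  proof -
    have Nr: "real N = 1 / r^2" using r2 r by simp
    have p: "r^2 \<le> r" using r by (simp add: power2_eq_square mult_left_le)
    have "real N * (C * h^2 + \<Gamma> * (C * r^3 + \<sigma>^2 / 2 * (C * r^3 + r^2 * (C * h)))) + \<sigma>^2 / 2 * \<Gamma> * (C * r^2)
      = (C * lim_var^2) * r^2 + \<Gamma> * (C * r + \<sigma>^2 / 2 * (C * r + (C * lim_var) * r^2)) + (\<sigma>^2 / 2 * \<Gamma> * C) * r^2"
      unfolding Nr h_def using r by (simp add: field_simps power2_eq_square power3_eq_cube)
    also have "\<dots> \<le> (C * lim_var^2) * r + \<Gamma> * (C * r + \<sigma>^2 / 2 * (C * r + (C * lim_var) * r)) + (\<sigma>^2 / 2 * \<Gamma> * C) * r"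
      using p C lim_var_nonneg \<Gamma>_nonneg less_imp_le[OF var_ratio_pos[OF \<theta> \<rho>]] by (intro add_mono mult_left_mono order_refl mult_nonneg_nonneg) auto
    also have "\<dots> = heat_error C * r" by (simp add: heat_error_def algebra_simps)
    finally show ?thesis by (simp add: r_def)
  qed
  ultimately show ?thesis by simp
qed

text \<open>A bump of height one centred at \<open>b \<ge> x\<close> is at most the indicator of the half line above \<open>x\<close> plus its value at distance \<open>b - x\<close> from the
  centre, which is subtracted on the right.\<close>
lemma lower_tail:
  assumes N: "N > 0" and a: "a > 0" and C: "C \<ge> 0"
    and bd: "\<And>\<tau> y. \<tau> \<ge> a \<Longrightarrow> \<bar>heat_kernel \<tau> y\<bar> \<le> C"
      "\<And>\<tau> y. \<tau> \<ge> a \<Longrightarrow> \<bar>hk1 \<tau> y\<bar> \<le> C"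
      "\<And>\<tau> y. \<tau> \<ge> a \<Longrightarrow> \<bar>hk2 \<tau> y\<bar> \<le> C"
      "\<And>\<tau> y. \<tau> \<ge> a \<Longrightarrow> \<bar>hk3 \<tau> y\<bar> \<le> C"
      "\<And>\<tau> y. \<tau> \<ge> a \<Longrightarrow> \<bar>hk4 \<tau> y\<bar> \<le> C"
    and sgn: "\<bar>\<upsilon>\<bar> = 1" and x: "0 \<le> x" "x \<le> b"
  shows "prob {\<omega>\<in>space M. \<upsilon> * Mart N \<omega> \<ge> x * sqrt (real N)}
    \<ge> sqrt a * (heat_kernel (a + lim_var) b - heat_error C / sqrt (real N)) - exp (- ((b - x)^2) / (2 * a))"
proof -
  define Ev where "Ev = {\<omega>\<in>space M. \<upsilon> * Mart N \<omega> \<ge> x * sqrt (real N)}"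
  have Ev [measurable]: "Ev \<in> events" unfolding Ev_def by measurable
  have v: "\<upsilon> = 1 \<or> \<upsilon> = -1" using sgn by (auto simp: abs_if split: if_splits)
  have sN: "sqrt (real N) > 0" and sa: "sqrt a > 0" using N a by auto
  define e where "e = exp (- ((b - x)^2) / (2 * a))"
  have pt: "heat_kernel a (Mart N \<omega> / sqrt (real N) - \<upsilon> * b) \<le> (1 / sqrt a) * indicator Ev \<omega> + (1 / sqrt a) * e"
    if \<omega>: "\<omega> \<in> space M" for \<omega>
  proof (cases "\<omega> \<in> Ev")
    case True
    have "exp (- ((Mart N \<omega> / sqrt (real N) - \<upsilon> * b)^2) / (2 * a)) \<le> 1" using a by simp
    hence "heat_kernel a (Mart N \<omega> / sqrt (real N) - \<upsilon> * b) \<le> 1 / sqrt a"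
      unfolding heat_kernel_def using sa by (intro divide_right_mono) auto
    moreover have "0 \<le> (1 / sqrt a) * e" using sa by (simp add: e_def)
    ultimately show ?thesis using True by simp
  next
    case False
    hence "\<upsilon> * Mart N \<omega> < x * sqrt (real N)" using \<omega> by (auto simp: Ev_def)
    hence "\<upsilon> * Mart N \<omega> / sqrt (real N) < x" using sN by (simp add: field_simps)
    hence "b - x \<le> b - \<upsilon> * Mart N \<omega> / sqrt (real N)" by simp
    hence "(b - x)^2 \<le> (b - \<upsilon> * Mart N \<omega> / sqrt (real N))^2" using x by (intro power_mono) auto
    also have "\<dots> = (Mart N \<omega> / sqrt (real N) - \<upsilon> * b)^2" using v by (auto simp: power2_eq_square algebra_simps)
    finally have "exp (- ((Mart N \<omega> / sqrt (real N) - \<upsilon> * b)^2) / (2 * a)) \<le> e"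
      using a by (simp add: e_def divide_right_mono)
    hence "heat_kernel a (Mart N \<omega> / sqrt (real N) - \<upsilon> * b) \<le> e / sqrt a"
      unfolding heat_kernel_def using sa by (intro divide_right_mono) auto
    thus ?thesis using False by simp
  qed
  have "heat_kernel (a + lim_var) (\<upsilon> * b) - heat_error C / sqrt (real N)
      \<le> expectation (\<lambda>\<omega>. heat_kernel a (Mart N \<omega> / sqrt (real N) - \<upsilon> * b))"
    by (rule heat_kernel_expectation[OF N a C bd])
  also have "\<dots> \<le> expectation (\<lambda>\<omega>. (1 / sqrt a) * indicator Ev \<omega> + (1 / sqrt a) * e)"
  proof (rule integral_mono[OF _ _ pt])
    show "integrable M (\<lambda>\<omega>. heat_kernel a (Mart N \<omega> / sqrt (real N) - \<upsilon> * b))"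
      by (rule integrable_const_bound[where B=C]) (use bd(1) in auto)
    show "integrable M (\<lambda>\<omega>. (1 / sqrt a) * indicator Ev \<omega> + (1 / sqrt a) * e)"
      using Ev by (intro Bochner_Integration.integrable_add integrable_mult_right integrable_real_indicator)
        (auto simp: emeasure_eq_measure)
  qed
  also have "\<dots> = (1 / sqrt a) * prob Ev + (1 / sqrt a) * e"
    using Ev by (simp add: prob_space emeasure_eq_measure)
  finally have "sqrt a * (heat_kernel (a + lim_var) (\<upsilon> * b) - heat_error C / sqrt (real N))
     \<le> sqrt a * ((1 / sqrt a) * prob Ev + (1 / sqrt a) * e)" using sa by (intro mult_left_mono) auto
  also have "\<dots> = prob Ev + e" using a by (simp add: field_simps)
  also have "heat_kernel (a + lim_var) (\<upsilon> * b) = heat_kernel (a + lim_var) b" using v by (auto simp: heat_kernel_def)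
  finally show ?thesis unfolding e_def Ev_def by linarith
qed

lemma ar_noise_shift: "ar_noise M (\<lambda>i. V (m + i)) \<sigma> K \<theta> \<rho>"
proof
  have "indep_vars (\<lambda>j. PiM {m + j} (\<lambda>_. borel)) (\<lambda>j \<omega>. restrict (\<lambda>i. V i \<omega>) {m + j}) {1..}"
    by (rule indep_vars_restrict[OF V_indep]) (auto simp: disjoint_family_on_def)
  hence "indep_vars (\<lambda>_. borel) (\<lambda>j. (\<lambda>f. f (m + j)) \<circ> (\<lambda>\<omega>. restrict (\<lambda>i. V i \<omega>) {m + j})) {1..}"
    by (rule indep_vars_compose) (auto intro!: measurable_component_singleton)
  thus "indep_vars (\<lambda>_. borel) (\<lambda>i. V (m + i)) {1..}" by (simp add: comp_def)
qed (use \<theta> \<rho> V_mean V_var V_int4 V_mom4 in auto)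

lemma shift_sig_subset:
  "sets (centred_noise.sig M (\<lambda>i. V (m + i)) {1..N}) \<subseteq> sets (sig {m<..m+N})"
proof -
  interpret S: ar_noise M "\<lambda>i. V (m + i)" \<sigma> K \<theta> \<rho> by (rule ar_noise_shift)
  have "(\<lambda>\<omega>. \<lambda>i\<in>{1..N}. V (m + i) \<omega>) \<in> measurable (sig {m<..m+N}) (PiM {1..N} (\<lambda>_. borel))"
    by (intro measurable_restrict V_sig) auto
  from measurable_sets[OF this] show ?thesis by (auto simp: S.sets_sig)
qed

text \<open>The martingale at time \<open>N\<close> of the process that is restarted from zero at time \<open>m\<close>.  It is a function of the noise with
  index in \<open>{m<..m+N}\<close>, so that blocks over disjoint ranges are independent.\<close>
definition block_sum :: "nat \<Rightarrow> nat \<Rightarrow> 'a \<Rightarrow> real" where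
  "block_sum m N = ar_noise.Mart (\<lambda>i. V (m + i)) \<theta> \<rho> N"

text \<open>The lower tail bound for the blocks between \<open>Q^j\<close> and \<open>Q^(j+1)\<close> together with the second Borel-Cantelli lemma.  The
  probabilities are at least of order \<open>j powr (-\<alpha>)\<close> with \<open>\<alpha> \<le> 1\<close>, up to summable errors.\<close>
lemma block_sums_large:
  assumes \<sigma>: "\<sigma>^2 > 0" and Q: "Q \<ge> (2::nat)" and \<epsilon>: "0 < \<epsilon>" "\<epsilon> \<le> 1/4" and sgn: "\<bar>\<upsilon>\<bar> = 1"
  shows "AE \<omega> in M. \<exists>\<^sub>F j in sequentially. \<upsilon> * block_sum (Q^j) (Q^j * (Q-1)) \<omega>
     \<ge> (1 - \<epsilon>) * sqrt lim_var * sqrt (2 * ln (real j)) * sqrt (real (Q^j * (Q-1)))"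
proof -
  have lim_var: "lim_var > 0" using \<sigma> var_ratio_pos[OF \<theta> \<rho>] by simp
  hence nz: "\<sigma> \<noteq> 0" "A \<noteq> 0" by auto
  define N where "N j = Q^j * (Q-1)" for j
  have N: "N j > 0" "Q^j \<le> N j" for j using Q by (auto simp: N_def)
  define x where "x j = (1 - \<epsilon>) * sqrt lim_var * sqrt (2 * ln (real j))" for j
  define Ev where "Ev j = {\<omega>\<in>space M. \<upsilon> * block_sum (Q^j) (N j) \<omega> \<ge> x j * sqrt (real (N j))}" for j
  define F where "F j = sets (sig {Q^j<..Q^j + N j})" for j
  have QN: "Q^j + N j = Q^Suc j" for j
  proof -
    obtain Q' where "Q = Suc Q'" using Q by (cases Q) auto
    thus ?thesis by (simp add: N_def algebra_simps)
  qed
  have ind: "indep_sets F UNIV"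
    unfolding F_def
  proof (rule indep_sets_sig)
    have "{Q^i<..Q^Suc i} \<inter> {Q^j<..Q^Suc j} = {}" if "i < j" for i j
    proof -
      have "Q^Suc i \<le> Q^j" using that Q by (intro power_increasing) auto
      thus ?thesis by auto
    qed
    thus "disjoint_family_on (\<lambda>j. {Q^j<..Q^j + N j}) UNIV"
      unfolding disjoint_family_on_def QN by (metis Int_commute linorder_neqE_nat)
  qed auto
  have EvF: "Ev j \<in> F j" "space M - Ev j \<in> F j" for j
  proof -
    interpret S: ar_noise M "\<lambda>i. V (Q^j + i)" \<sigma> K \<theta> \<rho> by (rule ar_noise_shift)
    have "{\<omega>\<in>space (S.Past (N j)). \<upsilon> * S.Mart (N j) \<omega> \<ge> x j * sqrt (real (N j))} \<in> sets (S.Past (N j))"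
      by measurable
    hence "Ev j \<in> sets (S.Past (N j))" by (simp add: Ev_def block_sum_def)
    thus "Ev j \<in> F j" using shift_sig_subset[of "Q^j" "N j"] by (auto simp: F_def)
    thus "space M - Ev j \<in> F j" unfolding F_def using sets.compl_sets[of "Ev j" "sig {Q^j<..Q^j + N j}"] by simp
  qed
  have "\<not> summable (\<lambda>j. prob (Ev j))"
  proof
    assume sum: "summable (\<lambda>j. prob (Ev j))"
    (* This width makes the leak of the bump below x equal to j powr (-beta) with beta > 1, while the variance a
       added to the limiting one costs only a constant factor. *)
    define a where "a = \<epsilon>^2 * lim_var / 2"
    have a: "a > 0" using \<epsilon> lim_var by (simp add: a_def)
    obtain C where C: "C \<ge> 0" and bd: "\<And>\<tau> y. \<tau> \<ge> a \<Longrightarrow> \<bar>heat_kernel \<tau> y\<bar> \<le> C"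
      "\<And>\<tau> y. \<tau> \<ge> a \<Longrightarrow> \<bar>hk1 \<tau> y\<bar> \<le> C" "\<And>\<tau> y. \<tau> \<ge> a \<Longrightarrow> \<bar>hk2 \<tau> y\<bar> \<le> C"
      "\<And>\<tau> y. \<tau> \<ge> a \<Longrightarrow> \<bar>hk3 \<tau> y\<bar> \<le> C" "\<And>\<tau> y. \<tau> \<ge> a \<Longrightarrow> \<bar>hk4 \<tau> y\<bar> \<le> C"
      using heat_kernel_bounds[OF a] by blast
    define \<alpha> \<beta> where "\<alpha> = (1 - \<epsilon>^2)^2" and "\<beta> = 2 * (1 - \<epsilon>)^2"
    define c where "c = sqrt a / sqrt (a + lim_var)"
    have c: "c > 0" using a lim_var by (simp add: c_def)
    have main: "c * real j powr (-\<alpha>) \<le> prob (Ev j) + sqrt a * heat_error C * (1 / sqrt (real Q))^j + real j powr (-\<beta>)"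
      if j: "j \<ge> 1" for j
    proof -
      interpret S: ar_noise M "\<lambda>i. V (Q^j + i)" \<sigma> K \<theta> \<rho> by (rule ar_noise_shift)
      have lnj: "ln (real j) \<ge> 0" using j by simp
      have x0: "x j \<ge> 0" using \<epsilon> lim_var lnj by (simp add: x_def)
      have x2: "(x j)^2 = (1 - \<epsilon>)^2 * lim_var * (2 * ln (real j))"
        using lim_var lnj by (simp add: x_def power_mult_distrib)
      have tail: "prob (Ev j) \<ge> sqrt a * (heat_kernel (a + lim_var) ((1+\<epsilon>) * x j) - S.heat_error C / sqrt (real (N j)))
          - exp (- (((1+\<epsilon>) * x j - x j)^2) / (2 * a))"
        unfolding Ev_def block_sum_def
        by (rule S.lower_tail[OF N(1) a C bd sgn x0]) (use \<epsilon> x0 in \<open>simp_all add: mult_right_mono algebra_simps\<close>)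
      have "((1+\<epsilon>) * x j - x j)^2 = \<epsilon>^2 * (x j)^2" by (simp add: power2_eq_square algebra_simps)
      hence "- (((1+\<epsilon>) * x j - x j)^2) / (2 * a) = - ((x j)^2) / lim_var"
        using \<epsilon> lim_var by (simp add: a_def field_simps)
      also have "\<dots> = - \<beta> * ln (real j)" using nz by (simp add: x2 \<beta>_def)
      finally have e1: "exp (- (((1+\<epsilon>) * x j - x j)^2) / (2 * a)) = real j powr (-\<beta>)"
        using j by (simp add: powr_def)
      have "((1+\<epsilon>) * x j)^2 = \<alpha> * lim_var * (2 * ln (real j))"
      proof -
        have "((1+\<epsilon>) * x j)^2 = ((1+\<epsilon>) * (1-\<epsilon>))^2 * lim_var * (2 * ln (real j))"
          by (simp add: power_mult_distrib x2)
        also have "(1+\<epsilon>) * (1-\<epsilon>) = 1 - \<epsilon>^2" by (simp add: power2_eq_square algebra_simps)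
        finally show ?thesis by (simp add: \<alpha>_def)
      qed
      moreover have "\<alpha> * lim_var * (2 * ln (real j)) / (2 * (a + lim_var)) \<le> \<alpha> * lim_var * (2 * ln (real j)) / (2 * lim_var)"
        using a lim_var lnj less_imp_le[OF var_ratio_pos[OF \<theta> \<rho>]]
        by (intro divide_left_mono mult_nonneg_nonneg) (auto simp: \<alpha>_def)
      moreover have "\<alpha> * lim_var * (2 * ln (real j)) / (2 * lim_var) = \<alpha> * ln (real j)" using nz by simp
      ultimately have "- (\<alpha> * ln (real j)) \<le> - (((1+\<epsilon>) * x j)^2) / (2 * (a + lim_var))" by simp
      hence "real j powr (-\<alpha>) \<le> exp (- (((1+\<epsilon>) * x j)^2) / (2 * (a + lim_var)))"
        using j by (simp add: powr_def)
      hence "real j powr (-\<alpha>) / sqrt (a + lim_var) \<le> heat_kernel (a + lim_var) ((1+\<epsilon>) * x j)"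
        unfolding heat_kernel_def using a lim_var by (intro divide_right_mono) auto
      hence "sqrt a * (real j powr (-\<alpha>) / sqrt (a + lim_var)) \<le> sqrt a * heat_kernel (a + lim_var) ((1+\<epsilon>) * x j)"
        using a by (intro mult_left_mono) auto
      hence e2: "c * real j powr (-\<alpha>) \<le> sqrt a * heat_kernel (a + lim_var) ((1+\<epsilon>) * x j)"
        by (simp add: c_def)
      have hk0: "heat_error C \<ge> 0" unfolding heat_error_def using C lim_var \<Gamma>_nonneg less_imp_le[OF var_ratio_pos[OF \<theta> \<rho>]]
        by (intro add_nonneg_nonneg mult_nonneg_nonneg) auto
      have "1 / sqrt (real (N j)) \<le> 1 / sqrt (real (Q^j))"
        using N[of j] Q by (intro divide_left_mono) auto
      also have "\<dots> = (1 / sqrt (real Q))^j" by (simp add: power_divide real_sqrt_power)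
      finally have "heat_error C * (1 / sqrt (real (N j))) \<le> heat_error C * (1 / sqrt (real Q))^j"
        using hk0 by (rule mult_left_mono)
      hence "sqrt a * (heat_error C * (1 / sqrt (real (N j)))) \<le> sqrt a * (heat_error C * (1 / sqrt (real Q))^j)"
        by (rule mult_left_mono) (use a in simp)
      hence e3: "sqrt a * (heat_error C / sqrt (real (N j))) \<le> sqrt a * heat_error C * (1 / sqrt (real Q))^j"
        by (simp add: mult.assoc)
      have "sqrt a * (heat_kernel (a + lim_var) ((1+\<epsilon>) * x j) - heat_error C / sqrt (real (N j)))
        = sqrt a * heat_kernel (a + lim_var) ((1+\<epsilon>) * x j) - sqrt a * (heat_error C / sqrt (real (N j)))"
        by (rule right_diff_distrib)
      thus ?thesis using tail e1 e2 e3 by linarith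
    qed
    have "summable (\<lambda>j. prob (Ev j) + sqrt a * heat_error C * (1 / sqrt (real Q))^j + real j powr (-\<beta>))"
    proof (intro summable_add sum summable_mult summable_geometric)
      show "norm (1 / sqrt (real Q)) < 1" using Q by (simp add: real_less_rsqrt)
      have "(3/4)^2 \<le> (1 - \<epsilon>)^2" using \<epsilon> by (intro power_mono) auto
      hence "\<beta> > 1" by (simp add: \<beta>_def power2_eq_square)
      thus "summable (\<lambda>j. real j powr (-\<beta>))" by (simp add: summable_real_powr_iff)
    qed
    hence "summable (\<lambda>j. c * real j powr (-\<alpha>))"
      by (rule summable_comparison_test_ev[rotated])
         (use main c in \<open>auto simp: eventually_sequentially abs_mult intro!: exI[of _ 1]\<close>)
    hence "summable (\<lambda>j. real j powr (-\<alpha>))" using c by (simp add: summable_cmult_iff)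
    moreover have "\<alpha> \<le> 1"
    proof -
      have "\<epsilon>^2 \<le> 1" using \<epsilon> by (simp add: power_le_one)
      thus ?thesis unfolding \<alpha>_def by (intro power_le_one) auto
    qed
    ultimately show False by (simp add: summable_real_powr_iff)
  qed
  moreover have "F j \<subseteq> events" for j unfolding F_def by (rule sets_sig_events) auto
  ultimately have "AE \<omega> in M. \<exists>\<^sub>F j in sequentially. \<omega> \<in> Ev j"
    by (intro borel_cantelli2[OF prob_space_axioms ind EvF])
  thus ?thesis
  proof eventually_elim
    case (elim \<omega>)
    thus ?case by (rule frequently_elim1) (auto simp: Ev_def x_def N_def)
  qed
qed

end

section \<open>Strong laws for martingales\<close>

lemma (in prob_space) integrable_mult_L2:
  fixes f g :: "'a \<Rightarrow> real"
  assumes [measurable]: "f \<in> borel_measurable M" "g \<in> borel_measurable M"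
    and "integrable M (\<lambda>\<omega>. (f \<omega>)^2)" "integrable M (\<lambda>\<omega>. (g \<omega>)^2)"
  shows "integrable M (\<lambda>\<omega>. f \<omega> * g \<omega>)"
proof (rule Bochner_Integration.integrable_bound)
  show "integrable M (\<lambda>\<omega>. (f \<omega>)^2 + (g \<omega>)^2)" using assms by simp
  show "AE \<omega> in M. norm (f \<omega> * g \<omega>) \<le> norm ((f \<omega>)^2 + (g \<omega>)^2)"
  proof (rule AE_I2)
    fix \<omega>
    have "2 * \<bar>f \<omega> * g \<omega>\<bar> \<le> (f \<omega>)^2 + (g \<omega>)^2"
      using zero_le_power2[of "\<bar>f \<omega>\<bar> - \<bar>g \<omega>\<bar>"] by (simp add: power2_diff abs_mult)
    moreover have "0 \<le> \<bar>f \<omega> * g \<omega>\<bar>" by simp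
    ultimately have "\<bar>f \<omega> * g \<omega>\<bar> \<le> (f \<omega>)^2 + (g \<omega>)^2" by linarith
    thus "norm (f \<omega> * g \<omega>) \<le> norm ((f \<omega>)^2 + (g \<omega>)^2)" by simp
  qed
qed measurable

context centred_noise
begin

text \<open>Orthogonality to the square integrable past is what the second moment arguments use of the
  martingale property.\<close>
definition mart_diff :: "(nat \<Rightarrow> 'a \<Rightarrow> real) \<Rightarrow> bool" where
  "mart_diff X \<longleftrightarrow> (\<forall>n. X n \<in> borel_measurable (Past (Suc n)) \<and> integrable M (\<lambda>\<omega>. (X n \<omega>)^2) \<and>
     (\<forall>Z. Z \<in> borel_measurable (Past n) \<longrightarrow> integrable M (\<lambda>\<omega>. (Z \<omega>)^2) \<longrightarrow> expectation (\<lambda>\<omega>. Z \<omega> * X n \<omega>) = 0))"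

lemma mart_diff_linear:
  assumes H: "\<And>n. H n \<in> borel_measurable (Past n)" "\<And>n. integrable M (\<lambda>\<omega>. (H n \<omega>)^2)"
  shows "mart_diff (\<lambda>n \<omega>. H n \<omega> * V (Suc n) \<omega>)"
    and "expectation (\<lambda>\<omega>. (H n \<omega> * V (Suc n) \<omega>)^2) = \<sigma>^2 * expectation (\<lambda>\<omega>. (H n \<omega>)^2)"
proof -
  have H2: "(\<lambda>\<omega>. (H n \<omega>)^2) \<in> borel_measurable (Past n)" for n using H(1)[of n] by measurable
  show "expectation (\<lambda>\<omega>. (H n \<omega> * V (Suc n) \<omega>)^2) = \<sigma>^2 * expectation (\<lambda>\<omega>. (H n \<omega>)^2)"
    using past_square(2)[OF H2 H(2)] by (simp add: power_mult_distrib)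
  show "mart_diff (\<lambda>n \<omega>. H n \<omega> * V (Suc n) \<omega>)"
    unfolding mart_diff_def
  proof (intro allI conjI impI)
    fix n
    have "H n \<in> borel_measurable (Past (Suc n))" by (rule Past_mono[OF _ H(1)]) simp
    moreover have "V (Suc n) \<in> borel_measurable (Past (Suc n))" by (rule V_sig) auto
    ultimately show "(\<lambda>\<omega>. H n \<omega> * V (Suc n) \<omega>) \<in> borel_measurable (Past (Suc n))" by measurable
    show "integrable M (\<lambda>\<omega>. (H n \<omega> * V (Suc n) \<omega>)^2)"
      using past_square(1)[OF H2 H(2)] by (simp add: power_mult_distrib)
    fix Z :: "'a \<Rightarrow> real" assume Z: "Z \<in> borel_measurable (Past n)" "integrable M (\<lambda>\<omega>. (Z \<omega>)^2)"
    have m: "(\<lambda>\<omega>. Z \<omega> * H n \<omega>) \<in> borel_measurable (Past n)" using Z H(1) by measurable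
    have "integrable M (\<lambda>\<omega>. Z \<omega> * H n \<omega>)"
      by (rule integrable_mult_L2[OF Past_M[OF Z(1)] Past_M[OF H(1)] Z(2) H(2)])
    from past_orthogonal(2)[OF m this]
    show "expectation (\<lambda>\<omega>. Z \<omega> * (H n \<omega> * V (Suc n) \<omega>)) = 0" by (simp add: mult.assoc)
  qed
qed

lemma mart_diff_square:
  assumes H: "\<And>n. H n \<in> borel_measurable (Past n)" "\<And>n. integrable M (\<lambda>\<omega>. (H n \<omega>)^2)"
  shows "mart_diff (\<lambda>n \<omega>. H n \<omega> * ((V (Suc n) \<omega>)^2 - \<sigma>^2))"
    and "expectation (\<lambda>\<omega>. (H n \<omega> * ((V (Suc n) \<omega>)^2 - \<sigma>^2))^2) \<le> K * expectation (\<lambda>\<omega>. (H n \<omega>)^2)"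
proof -
  have H2: "(\<lambda>\<omega>. (H n \<omega>)^2) \<in> borel_measurable (Past n)" for n using H(1)[of n] by measurable
  have eq: "(H n \<omega> * ((V (Suc n) \<omega>)^2 - \<sigma>^2))^2
      = (H n \<omega>)^2 * V (Suc n) \<omega>^4 - 2 * \<sigma>^2 * ((H n \<omega>)^2 * (V (Suc n) \<omega>)^2) + \<sigma>^4 * (H n \<omega>)^2" for n \<omega>
    by (simp add: power2_eq_square power4_eq_xxxx algebra_simps)
  note p4 = past_fourth[OF H2 H(2) zero_le_power2] and p2 = past_square[OF H2 H(2)]
  have i: "integrable M (\<lambda>\<omega>. (H n \<omega> * ((V (Suc n) \<omega>)^2 - \<sigma>^2))^2)" for n
    unfolding eq using p4(1) p2(1) H(2) by (intro Bochner_Integration.integrable_add Bochner_Integration.integrable_diff) auto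
  have "expectation (\<lambda>\<omega>. (H n \<omega> * ((V (Suc n) \<omega>)^2 - \<sigma>^2))^2)
      = expectation (\<lambda>\<omega>. (H n \<omega>)^2 * V (Suc n) \<omega>^4) - \<sigma>^4 * expectation (\<lambda>\<omega>. (H n \<omega>)^2)"
    unfolding eq using p4(1) p2 H(2) by (simp add: power2_eq_square power4_eq_xxxx)
  also have "\<dots> \<le> K * expectation (\<lambda>\<omega>. (H n \<omega>)^2)"
  proof -
    have "0 \<le> \<sigma>^4 * expectation (\<lambda>\<omega>. (H n \<omega>)^2)" by (intro mult_nonneg_nonneg) auto
    thus ?thesis using p4(2)[of n] by linarith
  qed
  finally show "expectation (\<lambda>\<omega>. (H n \<omega> * ((V (Suc n) \<omega>)^2 - \<sigma>^2))^2) \<le> K * expectation (\<lambda>\<omega>. (H n \<omega>)^2)" .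
  show "mart_diff (\<lambda>n \<omega>. H n \<omega> * ((V (Suc n) \<omega>)^2 - \<sigma>^2))"
    unfolding mart_diff_def
  proof (intro allI conjI impI i)
    fix n
    have "H n \<in> borel_measurable (Past (Suc n))" by (rule Past_mono[OF _ H(1)]) simp
    moreover have "V (Suc n) \<in> borel_measurable (Past (Suc n))" by (rule V_sig) auto
    ultimately show "(\<lambda>\<omega>. H n \<omega> * ((V (Suc n) \<omega>)^2 - \<sigma>^2)) \<in> borel_measurable (Past (Suc n))" by measurable
    fix Z :: "'a \<Rightarrow> real" assume Z: "Z \<in> borel_measurable (Past n)" "integrable M (\<lambda>\<omega>. (Z \<omega>)^2)"
    have m: "(\<lambda>\<omega>. Z \<omega> * H n \<omega>) \<in> borel_measurable (Past n)" using Z H(1) by measurable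
    have ZH: "integrable M (\<lambda>\<omega>. Z \<omega> * H n \<omega>)"
      by (rule integrable_mult_L2[OF Past_M[OF Z(1)] Past_M[OF H(1)] Z(2) H(2)])
    have "Z \<omega> * (H n \<omega> * ((V (Suc n) \<omega>)^2 - \<sigma>^2)) = Z \<omega> * H n \<omega> * (V (Suc n) \<omega>)^2 - \<sigma>^2 * (Z \<omega> * H n \<omega>)" for \<omega>
      by (simp add: algebra_simps)
    thus "expectation (\<lambda>\<omega>. Z \<omega> * (H n \<omega> * ((V (Suc n) \<omega>)^2 - \<sigma>^2))) = 0"
      using past_square[OF m ZH] ZH by simp
  qed
qed

lemma kolmogorov_inequality:
  assumes X: "mart_diff X" and v: "\<And>k. expectation (\<lambda>\<omega>. (X k \<omega>)^2) \<le> v k" and c: "c > 0"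
  shows "{\<omega>\<in>space M. \<exists>n\<le>N. \<bar>\<Sum>k<n. X k \<omega>\<bar> \<ge> c} \<in> events"
    and "prob {\<omega>\<in>space M. \<exists>n\<le>N. \<bar>\<Sum>k<n. X k \<omega>\<bar> \<ge> c} \<le> (\<Sum>k<N. v k) / c^2"
proof -
  define S where "S n \<omega> = (\<Sum>k<n. X k \<omega>)" for n \<omega>
  have XP: "X n \<in> borel_measurable (Past (Suc n))" and X2: "integrable M (\<lambda>\<omega>. (X n \<omega>)^2)"
    and orth: "Z \<in> borel_measurable (Past n) \<Longrightarrow> integrable M (\<lambda>\<omega>. (Z \<omega>)^2) \<Longrightarrow> expectation (\<lambda>\<omega>. Z \<omega> * X n \<omega>) = 0" for n Z
    using X by (auto simp: mart_diff_def)
  have SP: "S n \<in> borel_measurable (Past n)" for n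
    unfolding S_def
  proof (rule borel_measurable_sum)
    fix k assume "k \<in> {..<n}"
    thus "X k \<in> borel_measurable (Past n)" by (intro Past_mono[OF _ XP]) auto
  qed
  have XM [measurable]: "X n \<in> borel_measurable M" and SM [measurable]: "S n \<in> borel_measurable M" for n
    using XP SP Past_M by blast+
  have S_Suc: "S (Suc n) \<omega> = S n \<omega> + X n \<omega>" for n \<omega> by (simp add: S_def)
  have S2: "integrable M (\<lambda>\<omega>. (S n \<omega>)^2)" for n
  proof (induction n)
    case (Suc n)
    have "(S (Suc n) \<omega>)^2 = (S n \<omega>)^2 + 2 * (S n \<omega> * X n \<omega>) + (X n \<omega>)^2" for \<omega>
      by (simp add: S_Suc power2_eq_square algebra_simps)
    thus ?case using Suc X2 integrable_mult_L2[OF SM XM Suc X2] by simp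
  qed (simp add: S_def)
  have step: "expectation (\<lambda>\<omega>. indicator B \<omega> * (S (Suc n) \<omega>)^2)
     = expectation (\<lambda>\<omega>. indicator B \<omega> * (S n \<omega>)^2) + expectation (\<lambda>\<omega>. indicator B \<omega> * (X n \<omega>)^2)"
    if B: "B \<in> sets (Past n)" for B n
  proof -
    have BM: "B \<in> events" using B sets_sig_events[of "{1..n}"] by auto
    define Z where "Z \<omega> = indicator B \<omega> * S n \<omega>" for \<omega>
    have Z: "Z \<in> borel_measurable (Past n)" unfolding Z_def using B SP by measurable
    have Z2: "integrable M (\<lambda>\<omega>. (Z \<omega>)^2)"
    proof -
      have "(Z \<omega>)^2 = indicator B \<omega> * (S n \<omega>)^2" for \<omega> by (simp add: Z_def indicator_def)
      thus ?thesis using integrable_mult_indicator[OF BM S2[of n]] by simp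
    qed
    have eq: "indicator B \<omega> * (S (Suc n) \<omega>)^2 = indicator B \<omega> * (S n \<omega>)^2 + 2 * (Z \<omega> * X n \<omega>) + indicator B \<omega> * (X n \<omega>)^2" for \<omega>
      by (simp add: S_Suc Z_def power2_eq_square algebra_simps)
    show ?thesis unfolding eq
      using orth[OF Z Z2] integrable_mult_L2[OF Past_M[OF Z] XM Z2 X2]
        integrable_mult_indicator[OF BM S2[of n]] integrable_mult_indicator[OF BM X2[of n]] by simp
  qed
  have ES: "expectation (\<lambda>\<omega>. (S n \<omega>)^2) \<le> (\<Sum>k<n. v k)" for n
  proof (induction n)
    case (Suc n)
    have "expectation (\<lambda>\<omega>. indicator (space M) \<omega> * (f \<omega>)) = expectation f" for f :: "'a \<Rightarrow> real"
      by (intro Bochner_Integration.integral_cong) auto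
    moreover have "space M \<in> sets (Past n)" using sets.top[of "Past n"] by simp
    ultimately show ?case using step[of "space M" n] Suc v[of n] by simp
  qed (simp add: S_def)
  have eqv: "\<bar>S n \<omega>\<bar> \<ge> c \<longleftrightarrow> (S n \<omega>)^2 \<ge> c^2" for n \<omega>
    using c by (metis abs_le_square_iff abs_of_pos)
  have "prob {\<omega>\<in>space M. \<exists>n\<le>N. (S n \<omega>)^2 \<ge> c^2} \<le> expectation (\<lambda>\<omega>. (S N \<omega>)^2) / c^2"
  proof (rule maximal_inequality)
    fix n
    show "(\<lambda>\<omega>. (S n \<omega>)^2) \<in> borel_measurable (Past n)" using SP by measurable
    show "integrable M (\<lambda>\<omega>. (S n \<omega>)^2)" by (rule S2)
    show "expectation (\<lambda>\<omega>. indicator A \<omega> * (S n \<omega>)^2) \<le> expectation (\<lambda>\<omega>. indicator A \<omega> * (S (Suc n) \<omega>)^2)"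
      if "A \<in> sets (Past n)" for A
    proof -
      have "0 \<le> expectation (\<lambda>\<omega>. indicator A \<omega> * (X n \<omega>)^2)" by (intro Bochner_Integration.integral_nonneg) auto
      thus ?thesis using step[OF that] by simp
    qed
  qed (use c in auto)
  also have "\<dots> \<le> (\<Sum>k<N. v k) / c^2" by (intro divide_right_mono ES) auto
  finally show "prob {\<omega>\<in>space M. \<exists>n\<le>N. \<bar>\<Sum>k<n. X k \<omega>\<bar> \<ge> c} \<le> (\<Sum>k<N. v k) / c^2"
    unfolding S_def[symmetric] eqv .
  show "{\<omega>\<in>space M. \<exists>n\<le>N. \<bar>\<Sum>k<n. X k \<omega>\<bar> \<ge> c} \<in> events"
    unfolding S_def[symmetric] by measurable
qed

text \<open>Kolmogorov's inequality on the blocks ending at \<open>N (Suc j)\<close>, against the normalisation at the start of the block.  The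
  normalisation \<open>w\<close> will be \<open>n\<close> along powers of two, and \<open>ln n\<close> along a faster sequence.\<close>
lemma strong_law:
  fixes w :: "nat \<Rightarrow> real" and N :: "nat \<Rightarrow> nat"
  assumes X: "mart_diff X" and v: "\<And>k. expectation (\<lambda>\<omega>. (X k \<omega>)^2) \<le> v k"
    and w: "\<And>j. w (N j) > 0" "mono w"
    and N: "mono N" "filterlim N at_top sequentially"
    and sum: "summable (\<lambda>j. (\<Sum>k<N (Suc j). v k) / (w (N j))^2)"
  shows "AE \<omega> in M. (\<lambda>n. (\<Sum>k<n. X k \<omega>) / w n) \<longlonglongrightarrow> 0"
proof -
  define Ev where "Ev m j = {\<omega>\<in>space M. \<exists>n\<le>N (Suc j). \<bar>\<Sum>k<n. X k \<omega>\<bar> \<ge> w (N j) / real (Suc m)}" for m j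
  have pos: "w (N j) / real (Suc m) > 0" for j m using w(1)[of j] by simp
  have "AE \<omega> in M. \<forall>\<^sub>F j in sequentially. \<omega> \<in> space M - Ev m j" for m
  proof (rule borel_cantelli_AE1)
    show "Ev m j \<in> events" for j unfolding Ev_def by (rule kolmogorov_inequality[OF X v pos])
    show "summable (\<lambda>j. prob (Ev m j))"
    proof (rule summable_comparison_test)
      show "summable (\<lambda>j. (real (Suc m))^2 * ((\<Sum>k<N (Suc j). v k) / (w (N j))^2))"
        by (intro summable_mult sum)
      have "prob (Ev m j) \<le> (real (Suc m))^2 * ((\<Sum>k<N (Suc j). v k) / (w (N j))^2)" for j
        using kolmogorov_inequality(2)[OF X v pos[of j m], of "N (Suc j)"]
        by (simp add: Ev_def power_divide mult.commute)
      thus "\<exists>j0. \<forall>j\<ge>j0. norm (prob (Ev m j)) \<le> (real (Suc m))^2 * ((\<Sum>k<N (Suc j). v k) / (w (N j))^2)"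
        by (auto simp: measure_nonneg)
    qed
  qed (simp add: emeasure_eq_measure)
  hence "AE \<omega> in M. \<forall>m. \<forall>\<^sub>F j in sequentially. \<omega> \<in> space M - Ev m j" by (simp add: AE_all_countable)
  thus ?thesis
  proof eventually_elim
    case (elim \<omega>)
    show ?case
    proof (rule LIMSEQ_I)
      fix r :: real assume "r > 0"
      then obtain m where m: "1 / real (Suc m) < r" using nat_approx_posE by blast
      obtain J where J: "\<And>j. j \<ge> J \<Longrightarrow> \<omega> \<in> space M - Ev m j"
        using elim[rule_format, of m] by (auto simp: eventually_sequentially)
      have "norm ((\<Sum>k<n. X k \<omega>) / w n - 0) < r" if n: "n \<ge> N J" for n
      proof -
        obtain j1 where j1: "N j1 > n"
          using N(2)[unfolded filterlim_at_top, rule_format, of "Suc n"]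
          unfolding eventually_sequentially by (auto simp: Suc_le_eq)
        define j where "j = (GREATEST j. N j \<le> n)"
        have fin: "\<forall>j. N j \<le> n \<longrightarrow> j \<le> j1"
          using j1 N(1) by (metis leD le_cases monoD order_trans)
        have j: "N j \<le> n" "j \<ge> J"
          unfolding j_def using GreatestI_nat[of "\<lambda>j. N j \<le> n" J j1] Greatest_le_nat[of "\<lambda>j. N j \<le> n" J j1] n fin by auto
        have "\<not> N (Suc j) \<le> n"
          using Greatest_le_nat[of "\<lambda>j. N j \<le> n" "Suc j" j1] fin unfolding j_def by auto
        hence "n \<le> N (Suc j)" by simp
        hence "\<bar>\<Sum>k<n. X k \<omega>\<bar> < w (N j) / real (Suc m)"
          using J[OF j(2)] unfolding Ev_def by (metis (mono_tags, lifting) DiffE mem_Collect_eq not_le)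
        also have "\<dots> \<le> w n / real (Suc m)" using j w(2) by (intro divide_right_mono) (auto dest: monoD)
        finally have *: "\<bar>\<Sum>k<n. X k \<omega>\<bar> < w n / real (Suc m)" .
        have wn: "w n > 0" using w(1)[of j] monoD[OF w(2) j(1)] by linarith
        have "\<bar>\<Sum>k<n. X k \<omega>\<bar> / w n < 1 / real (Suc m)" using * wn by (simp add: field_simps)
        thus ?thesis using m wn by simp
      qed
      thus "\<exists>n0. \<forall>n\<ge>n0. norm ((\<Sum>k<n. X k \<omega>) / w n - 0) < r" by blast
    qed
  qed
qed

lemma strong_law_bounded:
  assumes X: "mart_diff X" and v: "\<And>k. expectation (\<lambda>\<omega>. (X k \<omega>)^2) \<le> c"
  shows "AE \<omega> in M. (\<lambda>n. (\<Sum>k<n. X k \<omega>) / real n) \<longlonglongrightarrow> 0"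
proof (rule strong_law[OF X v, where N="\<lambda>j. 2^j"])
  show "mono (\<lambda>j. 2 ^ j :: nat)" by (intro monoI power_increasing) auto
  show "filterlim (\<lambda>j. 2 ^ j :: nat) at_top sequentially" by real_asymp
  have "(\<Sum>k<(2::nat)^Suc j. c) / (real (2^j))^2 = 2 * c * (1/2)^j" for j
    by (simp add: field_simps power2_eq_square)
  thus "summable (\<lambda>j. (\<Sum>k<(2::nat)^Suc j. c) / (real (2^j))^2)" by (simp add: summable_geometric)
qed (auto simp: mono_def)

end

context ar_noise
begin

text \<open>Expand the fourth power of the next value.  The odd term \<open>M^3 D\<close> vanishes, \<open>M D^3\<close> is absorbed by \<open>M^2 D^2\<close> and \<open>D^4\<close>, and
  \<open>M^2 Y^2\<close> is split with weight \<open>n + 1\<close> so that the recursion closes on a quadratic bound.\<close>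
lemma Mart_fourth_moment: "expectation (\<lambda>\<omega>. Mart n \<omega>^4) \<le> (16 * \<sigma>^4 * KY + 3 * \<Gamma>D) * (real n)^2"
proof (induction n)
  case (Suc n)
  define C where "C = 16 * \<sigma>^4 * KY + 3 * \<Gamma>D"
  define s where "s = real n + 1"
  have s: "s > 0" by (simp add: s_def)
  have KY0: "0 \<le> KY" by (rule KY_nonneg)
  have C0: "C \<ge> 0" unfolding C_def using KY0 \<Gamma>D_nonneg by (intro add_nonneg_nonneg mult_nonneg_nonneg) auto
  have m: "(\<lambda>\<omega>. Mart n \<omega>^3 * Y n \<omega>) \<in> borel_measurable (Past n)"
    "(\<lambda>\<omega>. (Mart n \<omega>)^2 * (Y n \<omega>)^2) \<in> borel_measurable (Past n)" by measurable
  have i1: "integrable M (\<lambda>\<omega>. Mart n \<omega>^3 * Y n \<omega>)"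
  proof (rule L4_bound[OF L4_Mart L4_Y, of _ 1])
    fix \<omega>
    have "\<bar>x\<bar>^3 * \<bar>y\<bar> \<le> x^4 + y^4" for x y :: real
    proof (cases "\<bar>y\<bar> \<le> \<bar>x\<bar>")
      case True
      hence "\<bar>x\<bar>^3 * \<bar>y\<bar> \<le> \<bar>x\<bar>^3 * \<bar>x\<bar>" by (intro mult_left_mono) auto
      also have "\<dots> = x^4" by (simp add: power_numeral_reduce abs_mult[symmetric])
      finally show ?thesis by (simp add: add_increasing2)
    next
      case False
      hence "\<bar>x\<bar>^3 * \<bar>y\<bar> \<le> \<bar>y\<bar>^3 * \<bar>y\<bar>" by (intro mult_right_mono power_mono) auto
      also have "\<dots> = y^4" by (simp add: power_numeral_reduce abs_mult[symmetric])
      finally show ?thesis by (simp add: add_increasing)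
    qed
    thus "\<bar>Mart n \<omega>^3 * Y n \<omega>\<bar> \<le> 1 * (1 + Mart n \<omega>^4 + Y n \<omega>^4)"
      by (simp add: abs_mult power_abs add.assoc add_increasing)
  qed measurable
  have i2: "integrable M (\<lambda>\<omega>. (Mart n \<omega>)^2 * (Y n \<omega>)^2)" by (rule L4_mult2[OF L4_Mart L4_Y])
  note o = past_orthogonal[OF m(1) i1] and q = past_square[OF m(2) i2]
  have iM: "integrable M (\<lambda>\<omega>. Mart k \<omega>^4)" for k by (rule L4_int4[OF L4_Mart])
  have iD: "integrable M (\<lambda>\<omega>. D n \<omega>^4)" by (rule L4_int4[OF L4_D])
  have iY: "integrable M (\<lambda>\<omega>. Y n \<omega>^4)" by (rule L4_int4[OF L4_Y])
  have pt: "Mart (Suc n) \<omega>^4 \<le> Mart n \<omega>^4 + 4 * (Mart n \<omega>^3 * Y n \<omega> * V (Suc n) \<omega>)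
      + 8 * ((Mart n \<omega>)^2 * (Y n \<omega>)^2 * (V (Suc n) \<omega>)^2) + 3 * D n \<omega>^4" for \<omega>
  proof -
    have "2 * (m * d^3) \<le> m^2 * d^2 + d^4" for m d :: real
    proof -
      have "0 \<le> (m * d - d^2)^2" by simp
      also have "\<dots> = m^2 * d^2 + d^4 - 2 * (m * d^3)"
        by (simp add: power2_eq_square power3_eq_cube power4_eq_xxxx algebra_simps)
      finally show ?thesis by simp
    qed
    from this[of "Mart n \<omega>" "D n \<omega>"]
    have "(Mart n \<omega> + D n \<omega>)^4 \<le> Mart n \<omega>^4 + 4 * (Mart n \<omega>^3 * D n \<omega>) + 8 * ((Mart n \<omega>)^2 * (D n \<omega>)^2) + 3 * D n \<omega>^4"
      by (simp add: power2_eq_square power3_eq_cube power4_eq_xxxx algebra_simps)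
    thus ?thesis by (simp add: Mart_Suc D_def power_mult_distrib mult_ac)
  qed
  have "expectation (\<lambda>\<omega>. Mart (Suc n) \<omega>^4) \<le> expectation (\<lambda>\<omega>. Mart n \<omega>^4 + 4 * (Mart n \<omega>^3 * Y n \<omega> * V (Suc n) \<omega>)
      + 8 * ((Mart n \<omega>)^2 * (Y n \<omega>)^2 * (V (Suc n) \<omega>)^2) + 3 * D n \<omega>^4)"
    using pt by (intro integral_mono) (use iM iD o q in auto)
  also have "\<dots> = expectation (\<lambda>\<omega>. Mart n \<omega>^4) + 8 * (\<sigma>^2 * expectation (\<lambda>\<omega>. (Mart n \<omega>)^2 * (Y n \<omega>)^2))
      + 3 * expectation (\<lambda>\<omega>. D n \<omega>^4)"
    using iM iD o q by simp
  also have "8 * (\<sigma>^2 * expectation (\<lambda>\<omega>. (Mart n \<omega>)^2 * (Y n \<omega>)^2))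
      \<le> expectation (\<lambda>\<omega>. Mart n \<omega>^4) / s + 16 * \<sigma>^4 * s * expectation (\<lambda>\<omega>. Y n \<omega>^4)"
  proof -
    have p: "8 * \<sigma>^2 * ((Mart n \<omega>)^2 * (Y n \<omega>)^2) \<le> Mart n \<omega>^4 / s + 16 * \<sigma>^4 * s * Y n \<omega>^4" for \<omega>
    proof -
      have "0 \<le> ((Mart n \<omega>)^2 - 4 * \<sigma>^2 * s * (Y n \<omega>)^2)^2 / s" using s by simp
      also have "\<dots> = Mart n \<omega>^4 / s + 16 * \<sigma>^4 * s * Y n \<omega>^4 - 8 * \<sigma>^2 * ((Mart n \<omega>)^2 * (Y n \<omega>)^2)"
        using s by (simp add: power2_eq_square power4_eq_xxxx field_simps)
      finally show ?thesis by simp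
    qed
    have "8 * (\<sigma>^2 * expectation (\<lambda>\<omega>. (Mart n \<omega>)^2 * (Y n \<omega>)^2))
      = expectation (\<lambda>\<omega>. 8 * \<sigma>^2 * ((Mart n \<omega>)^2 * (Y n \<omega>)^2))" by simp
    also have "\<dots> \<le> expectation (\<lambda>\<omega>. Mart n \<omega>^4 / s + 16 * \<sigma>^4 * s * Y n \<omega>^4)"
      using p by (intro integral_mono) (use i2 iM iY in auto)
    also have "\<dots> = expectation (\<lambda>\<omega>. Mart n \<omega>^4) / s + 16 * \<sigma>^4 * s * expectation (\<lambda>\<omega>. Y n \<omega>^4)"
      using iM iY by simp
    finally show ?thesis .
  qed
  also have "expectation (\<lambda>\<omega>. Mart n \<omega>^4) / s \<le> C * (real n)^2 / s"
    using Suc.IH s by (intro divide_right_mono) (auto simp: C_def)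
  also have "expectation (\<lambda>\<omega>. Mart n \<omega>^4) \<le> C * (real n)^2" using Suc.IH by (simp add: C_def)
  also have "16 * \<sigma>^4 * s * expectation (\<lambda>\<omega>. Y n \<omega>^4) \<le> 16 * \<sigma>^4 * s * KY"
    using mom_Y s by (intro mult_left_mono) auto
  also have "3 * expectation (\<lambda>\<omega>. D n \<omega>^4) \<le> 3 * \<Gamma>D * s"
  proof -
    have "3 * expectation (\<lambda>\<omega>. D n \<omega>^4) \<le> 3 * \<Gamma>D * 1" using mom_D'[of n] by simp
    also have "\<dots> \<le> 3 * \<Gamma>D * s" using \<Gamma>D_nonneg by (intro mult_left_mono) (auto simp: s_def)
    finally show ?thesis .
  qed
  finally have "expectation (\<lambda>\<omega>. Mart (Suc n) \<omega>^4) \<le> C * (real n)^2 + (C * (real n)^2 / s + 16 * \<sigma>^4 * s * KY) + 3 * \<Gamma>D * s"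
    by simp
  also have "\<dots> = C * ((real n)^2 + (real n)^2 / s + s)" by (simp add: C_def algebra_simps add_divide_distrib)
  also have "\<dots> \<le> C * (real (Suc n))^2"
  proof (rule mult_left_mono[OF _ C0])
    have "(real n)^2 / s \<le> real n" using s by (simp add: s_def field_simps power2_eq_square)
    thus "(real n)^2 + (real n)^2 / s + s \<le> (real (Suc n))^2"
      by (simp add: s_def power2_eq_square algebra_simps)
  qed
  finally show ?case by (simp add: C_def)
qed simp

text \<open>The first two drive the law of large numbers for the squares, the third the quadratic variation, and the last one
  is the martingale part in the summation by parts for the quadratic strong law.\<close>
lemma strong_laws:
  shows "AE \<omega> in M. (\<lambda>n. (\<Sum>k<n. (V (Suc k) \<omega>)^2 - \<sigma>^2) / real n) \<longlonglongrightarrow> 0"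
    and "AE \<omega> in M. (\<lambda>n. (\<Sum>k<n. Lin k \<omega> * V (Suc k) \<omega>) / real n) \<longlonglongrightarrow> 0"
    and "AE \<omega> in M. (\<lambda>n. (\<Sum>k<n. (Y k \<omega>)^2 * ((V (Suc k) \<omega>)^2 - \<sigma>^2)) / real n) \<longlonglongrightarrow> 0"
    and "AE \<omega> in M. (\<lambda>n. (\<Sum>k<n. Mart k \<omega> * D k \<omega> / real (Suc k)) / ln (real n)) \<longlonglongrightarrow> 0"
proof -
  show "AE \<omega> in M. (\<lambda>n. (\<Sum>k<n. (V (Suc k) \<omega>)^2 - \<sigma>^2) / real n) \<longlonglongrightarrow> 0"
  proof -
    have 1: "mart_diff (\<lambda>n \<omega>. 1 * ((V (Suc n) \<omega>)^2 - \<sigma>^2))" by (rule mart_diff_square(1)) auto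
    have 2: "expectation (\<lambda>\<omega>. (1 * ((V (Suc k) \<omega>)^2 - \<sigma>^2))^2) \<le> K" for k
      using mart_diff_square(2)[of "\<lambda>_ _. 1" k] by (simp add: prob_space)
    show ?thesis using strong_law_bounded[OF 1 2] by simp
  qed
next
  have "\<exists>c. \<forall>k. expectation (\<lambda>\<omega>. (Lin k \<omega>)^2) \<le> c"
  proof -
    define p q where "p = (2*\<theta> + corr_ye \<theta> \<rho> * \<theta>)/(1 - \<theta>^2)" and "q = (2*\<rho> + 2*\<rho>*corr_ye \<theta> \<rho> + 2*\<rho>*corr_ee \<theta> \<rho>)/(1-\<theta>^2)"
    have eq: "Lin k \<omega> = p * Y k \<omega> + q * E k \<omega>" for k \<omega>
    proof -
      have "(a * y + b * e) / c = a / c * y + b / c * e" for a b c y e :: real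
        by (simp add: add_divide_distrib)
      thus ?thesis by (simp only: Lin_def poisson_lin_def p_def q_def)
    qed
    have b: "(Lin k \<omega>)^2 \<le> 2 * p^2 * (1 + Y k \<omega>^4) + 2 * q^2 * (1 + E k \<omega>^4)" for k \<omega>
    proof -
      have "(Lin k \<omega>)^2 \<le> 2 * (p * Y k \<omega>)^2 + 2 * (q * E k \<omega>)^2"
        unfolding eq using zero_le_power2[of "p * Y k \<omega> - q * E k \<omega>"] by (simp add: power2_sum power2_diff)
      also have "\<dots> = 2 * p^2 * (Y k \<omega>)^2 + 2 * q^2 * (E k \<omega>)^2" by (simp add: power_mult_distrib)
      also have "\<dots> \<le> 2 * p^2 * (1 + Y k \<omega>^4) + 2 * q^2 * (1 + E k \<omega>^4)"
        using quartic_ineqs(2) by (intro add_mono mult_left_mono) auto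
      finally show ?thesis .
    qed
    have "expectation (\<lambda>\<omega>. (Lin k \<omega>)^2) \<le> 2 * p^2 * (1 + KY) + 2 * q^2 * (1 + KE)" for k
    proof -
      have "expectation (\<lambda>\<omega>. (Lin k \<omega>)^2) \<le> expectation (\<lambda>\<omega>. 2 * p^2 * (1 + Y k \<omega>^4) + 2 * q^2 * (1 + E k \<omega>^4))"
        using L4_int4[OF L4_Y] L4_int4[OF L4_E] L4_int2[OF L4_Lin] by (intro integral_mono b) auto
      also have "\<dots> = 2 * p^2 * (1 + expectation (\<lambda>\<omega>. Y k \<omega>^4)) + 2 * q^2 * (1 + expectation (\<lambda>\<omega>. E k \<omega>^4))"
        using L4_int4[OF L4_Y] L4_int4[OF L4_E] by (simp add: prob_space)
      also have "\<dots> \<le> 2 * p^2 * (1 + KY) + 2 * q^2 * (1 + KE)"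
        using mom_Y mom_E by (intro add_mono mult_left_mono order_refl) auto
      finally show ?thesis .
    qed
    thus ?thesis by blast
  qed
  then obtain c where c: "expectation (\<lambda>\<omega>. (Lin k \<omega>)^2) \<le> c" for k by blast
  note m = mart_diff_linear[of Lin, OF Lin_Past L4_int2[OF L4_Lin]]
  show "AE \<omega> in M. (\<lambda>n. (\<Sum>k<n. Lin k \<omega> * V (Suc k) \<omega>) / real n) \<longlonglongrightarrow> 0"
  proof (rule strong_law_bounded[OF m(1)])
    show "expectation (\<lambda>\<omega>. (Lin k \<omega> * V (Suc k) \<omega>)^2) \<le> \<sigma>^2 * c" for k
      unfolding m(2) by (rule mult_left_mono[OF c]) simp
  qed
next
  have mY: "(\<lambda>\<omega>. (Y k \<omega>)^2) \<in> borel_measurable (Past k)" for k by measurable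
  have iY: "integrable M (\<lambda>\<omega>. ((Y k \<omega>)^2)^2)" for k using L4_int4[OF L4_Y] by (simp flip: power_mult)
  note m = mart_diff_square[of "\<lambda>k \<omega>. (Y k \<omega>)^2", OF mY iY]
  have "expectation (\<lambda>\<omega>. ((Y k \<omega>)^2 * ((V (Suc k) \<omega>)^2 - \<sigma>^2))^2) \<le> K * KY" for k
  proof -
    have "expectation (\<lambda>\<omega>. ((Y k \<omega>)^2)^2) \<le> KY" using mom_Y[of k] by (simp flip: power_mult)
    hence "K * expectation (\<lambda>\<omega>. ((Y k \<omega>)^2)^2) \<le> K * KY" using K_nonneg by (rule mult_left_mono)
    with m(2) show ?thesis by (rule order_trans)
  qed
  thus "AE \<omega> in M. (\<lambda>n. (\<Sum>k<n. (Y k \<omega>)^2 * ((V (Suc k) \<omega>)^2 - \<sigma>^2)) / real n) \<longlonglongrightarrow> 0"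
    by (rule strong_law_bounded[OF m(1)])
next
  define H where "H k \<omega> = Mart k \<omega> * Y k \<omega> / real (Suc k)" for k \<omega>
  define C where "C = 16 * \<sigma>^4 * KY + 3 * \<Gamma>D"
  have C0: "C \<ge> 0" unfolding C_def using KY_nonneg \<Gamma>D_nonneg by (intro add_nonneg_nonneg mult_nonneg_nonneg) auto
  have HP: "H k \<in> borel_measurable (Past k)" for k unfolding H_def by measurable
  have H2eq: "(H k \<omega>)^2 = (Mart k \<omega>)^2 * (Y k \<omega>)^2 / (real (Suc k))^2" for k \<omega>
    by (simp add: H_def power_mult_distrib power_divide)
  have H2: "integrable M (\<lambda>\<omega>. (H k \<omega>)^2)" for k
    unfolding H2eq using L4_mult2[OF L4_Mart L4_Y] by simp
  note m = mart_diff_linear[of H, OF HP H2]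
  have bound: "expectation (\<lambda>\<omega>. (H k \<omega> * V (Suc k) \<omega>)^2) \<le> \<sigma>^2 * (C + KY) * (1 / real (Suc k))" for k
  proof -
    define s where "s = real (Suc k)"
    have s: "s > 0" by (simp add: s_def)
    have "(Mart k \<omega>)^2 * (Y k \<omega>)^2 \<le> Mart k \<omega>^4 / s + s * Y k \<omega>^4" for \<omega>
    proof -
      have "0 \<le> ((Mart k \<omega>)^2 - s * (Y k \<omega>)^2)^2 / s" using s by simp
      also have "\<dots> = Mart k \<omega>^4 / s + s * Y k \<omega>^4 - 2 * ((Mart k \<omega>)^2 * (Y k \<omega>)^2)"
        using s by (simp add: power2_eq_square power4_eq_xxxx field_simps)
      finally have "2 * ((Mart k \<omega>)^2 * (Y k \<omega>)^2) \<le> Mart k \<omega>^4 / s + s * Y k \<omega>^4" by simp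
      moreover have "0 \<le> (Mart k \<omega>)^2 * (Y k \<omega>)^2" by simp
      ultimately show ?thesis by linarith
    qed
    hence "expectation (\<lambda>\<omega>. (Mart k \<omega>)^2 * (Y k \<omega>)^2) \<le> expectation (\<lambda>\<omega>. Mart k \<omega>^4 / s + s * Y k \<omega>^4)"
      using L4_mult2[OF L4_Mart L4_Y] L4_int4[OF L4_Mart] L4_int4[OF L4_Y] by (intro integral_mono) auto
    also have "\<dots> = expectation (\<lambda>\<omega>. Mart k \<omega>^4) / s + s * expectation (\<lambda>\<omega>. Y k \<omega>^4)"
      using L4_int4[OF L4_Mart] L4_int4[OF L4_Y] by simp
    also have "\<dots> \<le> C * (real k)^2 / s + s * KY"
      using Mart_fourth_moment[of k] mom_Y[of k] s by (intro add_mono divide_right_mono mult_left_mono) (auto simp: C_def)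
    also have "\<dots> \<le> C * s + s * KY"
    proof (rule add_right_mono)
      have "(real k)^2 \<le> s * s" by (simp add: s_def power2_eq_square mult_mono)
      hence "C * (real k)^2 \<le> C * (s * s)" using C0 by (rule mult_left_mono)
      thus "C * (real k)^2 / s \<le> C * s" using s by (simp add: field_simps)
    qed
    also have "\<dots> = (C + KY) * s" by (simp only: distrib_right mult.commute[of s])
    finally have "expectation (\<lambda>\<omega>. (Mart k \<omega>)^2 * (Y k \<omega>)^2) \<le> (C + KY) * s" .
    hence "expectation (\<lambda>\<omega>. (Mart k \<omega>)^2 * (Y k \<omega>)^2) / s^2 \<le> (C + KY) * s / s^2" by (rule divide_right_mono) simp
    also have "(C + KY) * s / s^2 = (C + KY) * (1 / s)" using s by (simp add: power2_eq_square)
    finally have "expectation (\<lambda>\<omega>. (H k \<omega>)^2) \<le> (C + KY) * (1 / s)" unfolding H2eq s_def by simp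
    hence "\<sigma>^2 * expectation (\<lambda>\<omega>. (H k \<omega>)^2) \<le> \<sigma>^2 * ((C + KY) * (1 / s))" by (rule mult_left_mono) simp
    thus ?thesis unfolding m(2) s_def by (simp only: mult.assoc)
  qed
  define B where "B = \<sigma>^2 * (C + KY)"
  have B0: "B \<ge> 0" unfolding B_def using C0 KY_nonneg by (intro mult_nonneg_nonneg add_nonneg_nonneg) auto
  have "AE \<omega> in M. (\<lambda>n. (\<Sum>k<n. H k \<omega> * V (Suc k) \<omega>) / ln (real n)) \<longlonglongrightarrow> 0"
  (* The logarithm of these times grows like a square, so that the quotients 1 / ln are summable. *)
  proof (rule strong_law[OF m(1) bound, where N="\<lambda>j. 2^((j+1)^2)", folded B_def])
    show "ln (real (2 ^ ((j+1)^2))) > 0" for j :: nat by (simp add: ln_realpow)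
    show "mono (\<lambda>n. ln (real n))"
    proof (rule monoI)
      fix m n :: nat assume "m \<le> n"
      thus "ln (real m) \<le> ln (real n)" by (cases "m = 0"; cases "n = 0") auto
    qed
    show "mono (\<lambda>j. 2 ^ ((j+1)^2) :: nat)" by (intro monoI power_increasing power_mono) auto
    show "filterlim (\<lambda>j. 2 ^ ((j+1)^2) :: nat) at_top sequentially"
    proof (rule filterlim_at_top_mono[OF filterlim_ident])
      have "j \<le> 2 ^ ((j+1)^2)" for j :: nat
      proof -
        have "j \<le> (j+1)^2" by (simp add: power2_eq_square)
        also have "\<dots> < 2 ^ ((j+1)^2)" by (rule less_exp)
        finally show ?thesis by simp
      qed
      thus "\<forall>\<^sub>F j in sequentially. j \<le> 2 ^ ((j+1)^2)" by simp
    qed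
    have harm: "(\<Sum>k<n. 1 / real (Suc k)) \<le> 1 + ln (real n)" if n0: "n > 0" for n
    proof -
      have "(\<Sum>k<n. 1 / real (Suc k)) = harm n"
        unfolding harm_def by (intro sum.reindex_bij_witness[of _ "\<lambda>k. k - 1" Suc]) (auto simp: inverse_eq_divide)
      also have "\<dots> \<le> 1 + ln (real n)"
      proof -
        obtain m where m: "n = Suc m" using n0 by (cases n) auto
        have "harm (Suc m) - ln (real (Suc m)) \<le> harm (Suc 0) - ln (real (Suc 0))"
          using decseqD[OF decseq_harm_diff_ln, of 0 m] by simp
        thus ?thesis by (simp add: m harm_def)
      qed
      finally show ?thesis .
    qed
    show "summable (\<lambda>j. (\<Sum>k<2 ^ ((Suc j + 1)^2). B * (1 / real (Suc k))) / (ln (real (2 ^ ((j+1)^2))))^2)"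
    proof (rule summable_comparison_test)
      define f where "f j = B * (1 + (real j + 2)^2 * ln 2) / ((real j + 1)^2 * ln 2)^2" for j
      show "summable f"
      proof (rule summable_comparison_test_bigo)
        show "summable (\<lambda>j. norm (real j powr (-2)))" by (simp add: summable_real_powr_iff)
        have "(\<lambda>j. (1 + (real j + 2)^2 * ln 2) / ((real j + 1)^2 * ln 2)^2) \<in> O(\<lambda>j. real j powr (-2))"
          by real_asymp
        from bigo_cmult[OF this, of B] show "f \<in> O(\<lambda>j. real j powr (-2))" by (simp add: f_def[abs_def])
      qed
      have "norm ((\<Sum>k<2 ^ ((Suc j + 1)^2). B * (1 / real (Suc k))) / (ln (real (2 ^ ((j+1)^2))))^2) \<le> f j" for j
      proof -
        have "(\<Sum>k<2 ^ ((Suc j + 1)^2). B * (1 / real (Suc k))) = B * (\<Sum>k<2 ^ ((Suc j + 1)^2). 1 / real (Suc k))"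
          by (simp add: sum_distrib_left)
        also have "\<dots> \<le> B * (1 + ln (real (2 ^ ((Suc j + 1)^2))))"
          by (intro mult_left_mono[OF _ B0] harm) simp
        also have "ln (real (2 ^ ((Suc j + 1)^2))) = (real j + 2)^2 * ln 2"
          by (simp add: ln_realpow add.commute)
        finally have 1: "(\<Sum>k<2 ^ ((Suc j + 1)^2). B * (1 / real (Suc k))) \<le> B * (1 + (real j + 2)^2 * ln 2)" .
        have 2: "ln (real (2 ^ ((j+1)^2))) = (real j + 1)^2 * ln 2" by (simp add: ln_realpow add.commute)
        have 3: "0 \<le> (\<Sum>k<2 ^ ((Suc j + 1)^2). B * (1 / real (Suc k)))"
          using B0 by (intro sum_nonneg mult_nonneg_nonneg) auto
        show ?thesis unfolding 2 f_def using 1 3 by (simp add: divide_right_mono abs_of_nonneg)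
      qed
      thus "\<exists>j0. \<forall>j\<ge>j0. norm ((\<Sum>k<2 ^ ((Suc j + 1)^2). B * (1 / real (Suc k))) / (ln (real (2 ^ ((j+1)^2))))^2) \<le> f j"
        by blast
    qed
  qed
  moreover have "H k \<omega> * V (Suc k) \<omega> = Mart k \<omega> * D k \<omega> / real (Suc k)" for k \<omega>
    by (simp add: H_def D_def)
  ultimately show "AE \<omega> in M. (\<lambda>n. (\<Sum>k<n. Mart k \<omega> * D k \<omega> / real (Suc k)) / ln (real n)) \<longlonglongrightarrow> 0" by simp
qed

text \<open>Here the identical distribution enters: the number of \<open>n \<ge> 1\<close> with \<open>c * n \<le> W\<close> is at most \<open>W / c\<close>, so the probabilities that
  the fourth power of the \<open>n\<close>-th variable exceeds \<open>c * n\<close> are summable.  Growth below \<open>n powr (1/4)\<close> makes the product of two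
  consecutive values of the process negligible against \<open>sqrt n\<close>.\<close>
lemma noise_growth:
  assumes dist: "\<And>n. n \<ge> 1 \<Longrightarrow> distr M borel (V n) = distr M borel (V 1)"
  shows "AE \<omega> in M. (\<lambda>n. V n \<omega> / (real n + 1) powr (1/4)) \<longlonglongrightarrow> 0"
proof -
  define W where "W \<omega> = V 1 \<omega>^4" for \<omega>
  have W [measurable]: "W \<in> borel_measurable M" unfolding W_def using V_meas'[of 1] by measurable
  have Wi: "integrable M W" using V_int4[of 1] by (simp add: W_def[abs_def])
  have W0: "W \<omega> \<ge> 0" for \<omega> by (simp add: W_def)
  define Ev where "Ev m n = {\<omega>\<in>space M. V (Suc n) \<omega>^4 \<ge> (1 / real (Suc m)) * real (Suc n)}" for m n
  have Ev: "Ev m n \<in> events" for m n unfolding Ev_def by measurable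
  have pEv: "prob (Ev m n) = prob {\<omega>\<in>space M. W \<omega> \<ge> (1 / real (Suc m)) * real (Suc n)}" for m n
  proof -
    let ?S = "{x::real. x^4 \<ge> (1 / real (Suc m)) * real (Suc n)}"
    have S: "?S \<in> sets borel" by measurable
    have "prob (Ev m n) = measure (distr M borel (V (Suc n))) ?S"
      using S by (subst measure_distr) (auto simp: Ev_def intro!: arg_cong[of _ _ prob])
    also have "\<dots> = measure (distr M borel (V 1)) ?S" using dist[of "Suc n"] by simp
    also have "\<dots> = prob {\<omega>\<in>space M. W \<omega> \<ge> (1 / real (Suc m)) * real (Suc n)}"
      using S V_meas'[of 1] by (subst measure_distr) (auto simp: W_def intro!: arg_cong[of _ _ prob])
    finally show ?thesis .
  qed
  have "AE \<omega> in M. \<forall>\<^sub>F n in sequentially. \<omega> \<in> space M - Ev m n" for m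
  proof (rule borel_cantelli_AE1[OF Ev])
    define c where "c = 1 / real (Suc m)"
    have c: "c > 0" by (simp add: c_def)
    show "summable (\<lambda>n. prob (Ev m n))"
    proof (rule bounded_imp_summable)
      fix N
      have count: "(\<Sum>n\<le>N. indicator {\<omega>\<in>space M. W \<omega> \<ge> c * real (Suc n)} \<omega>) \<le> W \<omega> / c" for \<omega>
      proof -
        have "(\<Sum>n\<le>N. indicator {\<omega>\<in>space M. W \<omega> \<ge> c * real (Suc n)} \<omega> :: real)
          \<le> (\<Sum>n\<le>N. if n < nat \<lfloor>W \<omega> / c\<rfloor> then 1 else 0)"
        proof (rule sum_mono)
          fix n
          have "n < nat \<lfloor>W \<omega> / c\<rfloor>" if "W \<omega> \<ge> c * real (Suc n)"
          proof -
            have "real (Suc n) \<le> W \<omega> / c" using that c by (simp add: field_simps)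
            hence "int (Suc n) \<le> \<lfloor>W \<omega> / c\<rfloor>" by (simp add: le_floor_iff)
            thus ?thesis by linarith
          qed
          thus "(indicator {\<omega>\<in>space M. W \<omega> \<ge> c * real (Suc n)} \<omega> :: real) \<le> (if n < nat \<lfloor>W \<omega> / c\<rfloor> then 1 else 0)"
            by (auto simp: indicator_def)
        qed
        also have "\<dots> = real (card ({..N} \<inter> {n. n < nat \<lfloor>W \<omega> / c\<rfloor>}))"
          by (simp add: sum.If_cases)
        also have "card ({..N} \<inter> {n. n < nat \<lfloor>W \<omega> / c\<rfloor>}) \<le> card {..<nat \<lfloor>W \<omega> / c\<rfloor>}"
          by (intro card_mono) auto
        also have "real (card {..<nat \<lfloor>W \<omega> / c\<rfloor>}) \<le> W \<omega> / c"
          using W0[of \<omega>] c by simp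
        finally show ?thesis by simp
      qed
      have "(\<Sum>n\<le>N. prob (Ev m n)) = (\<Sum>n\<le>N. expectation (indicator {\<omega>\<in>space M. W \<omega> \<ge> c * real (Suc n)}))"
        unfolding pEv c_def[symmetric] by (intro sum.cong refl) simp
      also have "\<dots> = expectation (\<lambda>\<omega>. \<Sum>n\<le>N. indicator {\<omega>\<in>space M. W \<omega> \<ge> c * real (Suc n)} \<omega>)"
        by (subst Bochner_Integration.integral_sum) (auto simp: emeasure_eq_measure intro!: integrable_real_indicator)
      also have "\<dots> \<le> expectation (\<lambda>\<omega>. W \<omega> / c)"
        using count Wi by (intro integral_mono Bochner_Integration.integrable_sum integrable_real_indicator)
          (auto simp: emeasure_eq_measure)
      finally show "(\<Sum>n\<le>N. prob (Ev m n)) \<le> expectation (\<lambda>\<omega>. W \<omega> / c)" .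
    qed simp
  qed (simp add: emeasure_eq_measure)
  hence "AE \<omega> in M. \<forall>m. \<forall>\<^sub>F n in sequentially. \<omega> \<in> space M - Ev m n" by (simp add: AE_all_countable)
  thus ?thesis
  proof eventually_elim
    case (elim \<omega>)
    have "(\<lambda>n. V (Suc n) \<omega>^4 / real (Suc n)) \<longlonglongrightarrow> 0"
    proof (rule LIMSEQ_I)
      fix r :: real assume "r > 0"
      then obtain m where m: "1 / real (Suc m) < r" using nat_approx_posE by blast
      obtain J where J: "\<And>j. j \<ge> J \<Longrightarrow> \<omega> \<in> space M - Ev m j"
        using elim[rule_format, of m] by (auto simp: eventually_sequentially)
      have "norm (V (Suc n) \<omega>^4 / real (Suc n) - 0) < r" if "n \<ge> J" for n
      proof -
        have "V (Suc n) \<omega>^4 < (1 / real (Suc m)) * real (Suc n)"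
          using J[OF that] unfolding Ev_def by (metis (mono_tags, lifting) DiffE mem_Collect_eq not_le)
        hence "V (Suc n) \<omega>^4 / real (Suc n) < 1 / real (Suc m)" by (simp add: field_simps)
        thus ?thesis using m by simp
      qed
      thus "\<exists>n0. \<forall>n\<ge>n0. norm (V (Suc n) \<omega>^4 / real (Suc n) - 0) < r" by blast
    qed
    hence "(\<lambda>n. (V (Suc n) \<omega>^4 / real (Suc n)) powr (1/4)) \<longlonglongrightarrow> 0 powr (1/4)"
      by (rule tendsto_powr2) auto
    moreover have "(V (Suc n) \<omega>^4 / real (Suc n)) powr (1/4) = \<bar>V (Suc n) \<omega>\<bar> / (real (Suc n)) powr (1/4)" for n
    proof -
      have "(V (Suc n) \<omega>^4) powr (1/4) = \<bar>V (Suc n) \<omega>\<bar>"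
      proof (cases "V (Suc n) \<omega> = 0")
        case False
        hence "(V (Suc n) \<omega>^4) powr (1/4) = (\<bar>V (Suc n) \<omega>\<bar> powr 4) powr (1/4)" by (simp add: powr_numeral)
        thus ?thesis using False by (simp only: powr_powr) simp
      qed simp
      thus ?thesis by (simp add: powr_divide)
    qed
    ultimately have lim: "(\<lambda>n. \<bar>V (Suc n) \<omega>\<bar> / (real (Suc n)) powr (1/4)) \<longlonglongrightarrow> 0" by simp
    have "(\<lambda>n. V (Suc n) \<omega> / (real (Suc n) + 1) powr (1/4)) \<longlonglongrightarrow> 0"
    proof (rule Lim_null_comparison[OF _ lim], rule always_eventually, rule allI)
      fix n
      have "(real (Suc n)) powr (1/4) \<le> (real (Suc n) + 1) powr (1/4)" by (intro powr_mono2) auto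
      thus "norm (V (Suc n) \<omega> / (real (Suc n) + 1) powr (1/4)) \<le> \<bar>V (Suc n) \<omega>\<bar> / (real (Suc n)) powr (1/4)"
        by (simp add: frac_le)
    qed
    thus ?case by (subst filterlim_sequentially_Suc[symmetric])
  qed
qed

end

section \<open>Recursions and weighted averages\<close>

lemma contraction_null:
  fixes u c :: "nat \<Rightarrow> real"
  assumes \<lambda>: "0 \<le> l" "l < 1" and u: "\<And>n. u n \<ge> 0" and step: "\<And>n. u (Suc n) \<le> l * u n + c n"
    and c: "c \<longlonglongrightarrow> 0"
  shows "u \<longlonglongrightarrow> 0"
proof (rule LIMSEQ_I)
  fix r :: real assume r: "r > 0"
  define \<delta> where "\<delta> = r * (1 - l) / 2"
  have \<delta>: "\<delta> > 0" using r \<lambda> by (simp add: \<delta>_def)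
  obtain N where N: "\<And>n. n \<ge> N \<Longrightarrow> c n < \<delta>"
    using order_tendstoD(2)[OF c \<delta>] by (auto simp: eventually_sequentially)
  have bound: "u (N + k) \<le> l^k * u N + r / 2" for k
  proof (induction k)
    case (Suc k)
    have "u (N + Suc k) \<le> l * u (N + k) + c (N + k)" using step[of "N + k"] by simp
    also have "\<dots> \<le> l * (l^k * u N + r / 2) + \<delta>"
      using Suc N[of "N + k"] \<lambda> by (intro add_mono mult_left_mono) auto
    also have "\<dots> = l^Suc k * u N + r / 2" by (simp add: \<delta>_def field_simps)
    finally show ?case .
  qed (use r in simp)
  have "(\<lambda>k. l^k * u N) \<longlonglongrightarrow> 0 * u N" using \<lambda> by (intro tendsto_mult_right LIMSEQ_realpow_zero) auto
  hence "\<forall>\<^sub>F k in sequentially. l^k * u N < r / 2" using r by (intro order_tendstoD(2)[of _ 0]) auto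
  then obtain k0 where k0: "\<And>k. k \<ge> k0 \<Longrightarrow> l^k * u N < r / 2" by (auto simp: eventually_sequentially)
  have "norm (u n - 0) < r" if "n \<ge> N + k0" for n
  proof -
    have "n = N + (n - N)" "n - N \<ge> k0" using that by auto
    hence "u n < r" using bound[of "n - N"] k0[of "n - N"] by simp
    thus ?thesis using u[of n] by simp
  qed
  thus "\<exists>n0. \<forall>n\<ge>n0. norm (u n - 0) < r" by blast
qed

lemma first_order_small:
  fixes x w b :: "nat \<Rightarrow> real"
  assumes a: "\<bar>a\<bar> < 1" and rec: "\<And>n. x (Suc n) = a * x n + w (Suc n)"
    and w: "(\<lambda>n. w n / b n) \<longlonglongrightarrow> 0" and b: "\<And>n. b n > 0" "\<And>n. b n \<le> b (Suc n)"
  shows "(\<lambda>n. x n / b n) \<longlonglongrightarrow> 0"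
proof -
  have "(\<lambda>n. \<bar>x n\<bar> / b n) \<longlonglongrightarrow> 0"
  proof (rule contraction_null[of "\<bar>a\<bar>"])
    fix n
    have "\<bar>x (Suc n)\<bar> / b (Suc n) \<le> (\<bar>a\<bar> * \<bar>x n\<bar> + \<bar>w (Suc n)\<bar>) / b (Suc n)"
      using b(1)[of "Suc n"] abs_triangle_ineq[of "a * x n" "w (Suc n)"]
      by (intro divide_right_mono) (auto simp: rec abs_mult)
    also have "\<dots> = \<bar>a\<bar> * (\<bar>x n\<bar> / b (Suc n)) + \<bar>w (Suc n)\<bar> / b (Suc n)" by (simp add: add_divide_distrib)
    also have "\<dots> \<le> \<bar>a\<bar> * (\<bar>x n\<bar> / b n) + \<bar>w (Suc n)\<bar> / b (Suc n)"
      using b(1)[of n] b(2)[of n] by (intro add_right_mono mult_left_mono divide_left_mono) auto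
    finally show "\<bar>x (Suc n)\<bar> / b (Suc n) \<le> \<bar>a\<bar> * (\<bar>x n\<bar> / b n) + \<bar>w (Suc n)\<bar> / b (Suc n)" .
    show "\<bar>x n\<bar> / b n \<ge> 0" using b(1)[of n] by simp
  next
    have "(\<lambda>n. \<bar>w (Suc n) / b (Suc n)\<bar>) \<longlonglongrightarrow> 0"
      using w by (intro tendsto_rabs_zero) (rule LIMSEQ_Suc)
    thus "(\<lambda>n. \<bar>w (Suc n)\<bar> / b (Suc n)) \<longlonglongrightarrow> 0" using b(1) by (simp add: abs_of_pos)
  qed (use a in auto)
  hence "(\<lambda>n. \<bar>x n / b n\<bar>) \<longlonglongrightarrow> 0" using b(1) by (simp add: abs_of_pos)
  thus ?thesis by (rule tendsto_rabs_zero_cancel)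
qed

text \<open>Two solutions driven by the same noise differ by a solution of the recursion without noise.\<close>
lemma homogeneous_decay:
  fixes d f :: "nat \<Rightarrow> real"
  assumes r: "\<bar>\<theta>\<bar> \<le> r" "\<bar>\<rho>\<bar> \<le> r"
    and d: "\<And>n. d (Suc n) = \<theta> * d n + f (Suc n)" and f: "\<And>n. f (Suc n) = \<rho> * f n"
  shows "\<bar>d n\<bar> \<le> (real n + 1) * r^n * (\<bar>d 0\<bar> + \<bar>f 0\<bar>)"
proof -
  have r0: "r \<ge> 0" using r by linarith
  have F: "\<bar>f n\<bar> \<le> r^n * \<bar>f 0\<bar>" for n
  proof (induction n)
    case (Suc n)
    have "\<bar>f (Suc n)\<bar> = \<bar>\<rho>\<bar> * \<bar>f n\<bar>" by (simp add: f abs_mult)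
    also have "\<dots> \<le> r * (r^n * \<bar>f 0\<bar>)" using r Suc r0 by (intro mult_mono) auto
    finally show ?case by (simp add: mult.assoc)
  qed simp
  define c where "c = \<bar>d 0\<bar> + \<bar>f 0\<bar>"
  show ?thesis unfolding c_def[symmetric]
  proof (induction n)
    case (Suc n)
    have "\<bar>d (Suc n)\<bar> \<le> \<bar>\<theta>\<bar> * \<bar>d n\<bar> + \<bar>f (Suc n)\<bar>"
      unfolding d using abs_triangle_ineq[of "\<theta> * d n" "f (Suc n)"] by (simp add: abs_mult)
    also have "\<dots> \<le> r * ((real n + 1) * r^n * c) + r^Suc n * c"
    proof (intro add_mono mult_mono)
      show "\<bar>f (Suc n)\<bar> \<le> r^Suc n * c" 
        by (rule order_trans[OF F]) (use r0 in \<open>auto simp: c_def intro!: mult_left_mono\<close>)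
    qed (use r r0 Suc in auto)
    also have "\<dots> = (real (Suc n) + 1) * r^Suc n * c" by (simp add: algebra_simps)
    finally show ?case .
  qed (simp add: c_def)
qed

lemma summable_poly_geometric:
  fixes r :: real
  assumes "0 \<le> r" "r < 1"
  shows "summable (\<lambda>n. (real n + 1)^2 * r^n)"
proof (rule summable_comparison_test)
  have 1: "summable (\<lambda>n. diffs (\<lambda>_. 1) n * x^n)" if "norm x < 1" for x :: real
    using that by (rule termdiff_converges) (auto intro: summable_geometric)
  have "summable (\<lambda>n. diffs (diffs (\<lambda>_. 1)) n * r^n)"
    by (rule termdiff_converges[of r 1]) (use assms 1 in auto)
  thus "summable (\<lambda>n. (real n + 1) * (real n + 2) * r^n)" by (simp add: diffs_def algebra_simps)
  have "(real n + 1)^2 * r^n \<le> (real n + 1) * (real n + 2) * r^n" for n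
    using assms by (intro mult_right_mono) (auto simp: power2_eq_square)
  thus "\<exists>N. \<forall>n\<ge>N. norm ((real n + 1)^2 * r^n) \<le> (real n + 1) * (real n + 2) * r^n" using assms by auto
qed

lemma weighted_null:
  fixes a c L :: "nat \<Rightarrow> real"
  assumes a: "\<And>k. a k \<ge> 0" and L: "filterlim L at_top sequentially"
    and avg: "(\<lambda>n. (\<Sum>k<n. a k) / L n) \<longlonglongrightarrow> \<alpha>" and c: "c \<longlonglongrightarrow> 0"
  shows "(\<lambda>n. (\<Sum>k<n. a k * c k) / L n) \<longlonglongrightarrow> 0"
proof (rule LIMSEQ_I)
  fix r :: real assume r: "r > 0"
  define B where "B = \<bar>\<alpha>\<bar> + 1"
  have B: "B > 0" by (simp add: B_def)
  obtain N where N: "\<And>n. n \<ge> N \<Longrightarrow> \<bar>c n\<bar> < r / (2 * B)"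
    using tendsto_rabs_zero[OF c] r B order_tendstoD(2)[of "\<lambda>n. \<bar>c n\<bar>" 0 sequentially "r / (2*B)"]
    by (auto simp: eventually_sequentially)
  define H where "H = (\<Sum>k<N. a k * \<bar>c k\<bar>)"
  have "((\<lambda>n. H / L n) \<longlongrightarrow> 0) sequentially"
    by (rule tendsto_divide_0[OF tendsto_const filterlim_at_top_imp_at_infinity[OF L]])
  hence "\<forall>\<^sub>F n in sequentially. H / L n < r / 2" using r by (intro order_tendstoD(2)) auto
  moreover have "\<forall>\<^sub>F n in sequentially. (\<Sum>k<n. a k) / L n < B"
    by (rule order_tendstoD(2)[OF avg]) (simp add: B_def)
  moreover have "\<forall>\<^sub>F n in sequentially. L n > 0" using L by (auto simp: filterlim_at_top_dense)
  ultimately have "\<forall>\<^sub>F n in sequentially. norm ((\<Sum>k<n. a k * c k) / L n - 0) < r"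
    using eventually_ge_at_top[of N]
  proof eventually_elim
    case (elim n)
    have "\<bar>\<Sum>k<n. a k * c k\<bar> \<le> (\<Sum>k<n. a k * \<bar>c k\<bar>)"
      by (rule order_trans[OF sum_abs]) (simp add: abs_mult a)
    also have "\<dots> = H + (\<Sum>k=N..<n. a k * \<bar>c k\<bar>)"
      unfolding H_def using elim(4) by (simp add: sum.atLeastLessThan_concat lessThan_atLeast0)
    also have "(\<Sum>k=N..<n. a k * \<bar>c k\<bar>) \<le> (\<Sum>k=N..<n. a k * (r / (2 * B)))"
      using N a by (intro sum_mono mult_left_mono) (auto intro: less_imp_le)
    also have "\<dots> \<le> (\<Sum>k<n. a k * (r / (2 * B)))"
      using a r B by (intro sum_mono2) auto
    also have "\<dots> = (\<Sum>k<n. a k) * (r / (2 * B))" by (rule sum_distrib_right[symmetric])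
    finally have "\<bar>\<Sum>k<n. a k * c k\<bar> / L n \<le> (H + (\<Sum>k<n. a k) * (r / (2 * B))) / L n"
      using elim(3) by (intro divide_right_mono) auto
    also have "\<dots> = H / L n + (\<Sum>k<n. a k) / L n * (r / (2 * B))" by (simp add: add_divide_distrib)
    also have "\<dots> < r / 2 + B * (r / (2 * B))"
      using elim r B by (intro add_less_le_mono mult_right_mono) auto
    also have "\<dots> = r" using B by simp
    finally show ?case using elim(3) by (simp add: abs_of_pos)
  qed
  thus "\<exists>n0. \<forall>n\<ge>n0. norm ((\<Sum>k<n. a k * c k) / L n - 0) < r" by (simp add: eventually_sequentially)
qed

lemma weighted_limit:
  fixes a c L :: "nat \<Rightarrow> real"
  assumes a: "\<And>k. a k \<ge> 0" and L: "filterlim L at_top sequentially"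
    and avg: "(\<lambda>n. (\<Sum>k<n. a k) / L n) \<longlonglongrightarrow> \<alpha>" and c: "c \<longlonglongrightarrow> \<gamma>"
  shows "(\<lambda>n. (\<Sum>k<n. a k * c k) / L n) \<longlonglongrightarrow> \<alpha> * \<gamma>"
proof -
  have "(\<lambda>k. c k - \<gamma>) \<longlonglongrightarrow> 0" using c by (simp add: LIM_zero)
  from weighted_null[OF a L avg this]
  have "(\<lambda>n. (\<Sum>k<n. a k * (c k - \<gamma>)) / L n + (\<Sum>k<n. a k) / L n * \<gamma>) \<longlonglongrightarrow> 0 + \<alpha> * \<gamma>"
    by (intro tendsto_add tendsto_mult avg tendsto_const)
  moreover have "(\<Sum>k<n. a k * (c k - \<gamma>)) / L n + (\<Sum>k<n. a k) / L n * \<gamma> = (\<Sum>k<n. a k * c k) / L n" for n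
    by (simp add: right_diff_distrib sum_subtractf sum_distrib_right diff_divide_distrib)
  ultimately show ?thesis by simp
qed

lemma ln_at_top: "filterlim (\<lambda>n. ln (real n)) at_top sequentially"
  by real_asymp

lemma harmonic_log: "(\<lambda>n. (\<Sum>k<n. 1 / real (Suc k)) / ln (real n)) \<longlonglongrightarrow> 1"
proof -
  have h: "(\<Sum>k<n. 1 / real (Suc k)) = harm n" for n
    unfolding harm_def by (intro sum.reindex_bij_witness[of _ "\<lambda>k. k - 1" Suc]) (auto simp: inverse_eq_divide)
  have "(\<lambda>n. (harm n - ln (real n)) / ln (real n)) \<longlonglongrightarrow> 0"
    by (rule tendsto_divide_0[OF euler_mascheroni_LIMSEQ filterlim_at_top_imp_at_infinity[OF ln_at_top]])
  hence "(\<lambda>n. (harm n - ln (real n)) / ln (real n) + 1) \<longlonglongrightarrow> 0 + 1" by (intro tendsto_add tendsto_const)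
  moreover have "\<forall>\<^sub>F n in sequentially. (harm n - ln (real n)) / ln (real n) + 1 = harm n / ln (real n)"
    using eventually_gt_at_top[of 1] by eventually_elim (simp add: diff_divide_distrib)
  ultimately show ?thesis unfolding h by (auto intro: Lim_transform_eventually)
qed

text \<open>Abel summation: Cesaro convergence implies convergence of the logarithmic averages.\<close>
lemma log_average:
  fixes c :: "nat \<Rightarrow> real"
  assumes c: "(\<lambda>n. (\<Sum>k<n. c k) / real n) \<longlonglongrightarrow> \<gamma>"
  shows "(\<lambda>n. (\<Sum>k<n. c k / real (Suc k)) / ln (real n)) \<longlonglongrightarrow> \<gamma>"
proof -
  define C where "C n = (\<Sum>k<n. c k) / real n" for n
  (* The terms with k = 0 vanish because division by zero gives zero. *)
  have abel: "(\<Sum>k<n. c k / real (Suc k)) = C n + (\<Sum>k<n. 1 / real (Suc k) * C k)" for n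
  proof (induction n)
    case (Suc n)
    have "C (Suc n) = C n + c n / real (Suc n) - 1 / real (Suc n) * C n"
    proof (cases "n = 0")
      case False
      have "(S + t) / (x + 1) = S / x + t / (x + 1) - 1 / (x + 1) * (S / x)" if "x > 0" for S t x :: real
        using that by (simp add: divide_simps) (simp add: algebra_simps)
      from this[of "real n" "\<Sum>k<n. c k" "c n"] show ?thesis using False by (simp add: C_def add.commute)
    qed (simp add: C_def)
    thus ?case using Suc by simp
  qed (simp add: C_def)
  have "(\<lambda>n. C n / ln (real n)) \<longlonglongrightarrow> 0"
    using c unfolding C_def[symmetric]
    by (rule tendsto_divide_0[OF _ filterlim_at_top_imp_at_infinity[OF ln_at_top]])
  moreover have "(\<lambda>n. (\<Sum>k<n. 1 / real (Suc k) * C k) / ln (real n)) \<longlonglongrightarrow> 1 * \<gamma>"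
    by (rule weighted_limit[OF _ ln_at_top harmonic_log]) (use c in \<open>auto simp: C_def[abs_def]\<close>)
  ultimately have "(\<lambda>n. C n / ln (real n) + (\<Sum>k<n. 1 / real (Suc k) * C k) / ln (real n)) \<longlonglongrightarrow> 0 + 1 * \<gamma>"
    by (rule tendsto_add)
  thus ?thesis unfolding abel add_divide_distrib by simp
qed

text \<open>The cross term is controlled by the Cauchy-Schwarz inequality.\<close>
lemma square_sum_perturb:
  fixes a b L :: "nat \<Rightarrow> real"
  assumes L: "filterlim L at_top sequentially"
    and A: "(\<lambda>n. (\<Sum>k<n. (a k)^2) / L n) \<longlonglongrightarrow> \<alpha>" and B: "(\<lambda>n. (\<Sum>k<n. (b k)^2) / L n) \<longlonglongrightarrow> 0"
  shows "(\<lambda>n. (\<Sum>k<n. (a k + b k)^2) / L n) \<longlonglongrightarrow> \<alpha>"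
proof -
  have Lpos: "\<forall>\<^sub>F n in sequentially. L n > 0" using L by (auto simp: filterlim_at_top_dense)
  have lim: "(\<lambda>n. sqrt ((\<Sum>k<n. (a k)^2) / L n) * sqrt ((\<Sum>k<n. (b k)^2) / L n)) \<longlonglongrightarrow> sqrt \<alpha> * sqrt 0"
    by (intro tendsto_mult tendsto_real_sqrt A B)
  have "(\<lambda>n. (\<Sum>k<n. a k * b k) / L n) \<longlonglongrightarrow> 0"
  proof (rule Lim_null_comparison)
    show "(\<lambda>n. sqrt ((\<Sum>k<n. (a k)^2) / L n) * sqrt ((\<Sum>k<n. (b k)^2) / L n)) \<longlonglongrightarrow> 0" using lim by simp
    show "\<forall>\<^sub>F n in sequentially. norm ((\<Sum>k<n. a k * b k) / L n)
        \<le> sqrt ((\<Sum>k<n. (a k)^2) / L n) * sqrt ((\<Sum>k<n. (b k)^2) / L n)"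
      using Lpos
    proof eventually_elim
      case (elim n)
      have "(\<Sum>k<n. a k * b k)^2 \<le> (\<Sum>k<n. (a k)^2) * (\<Sum>k<n. (b k)^2)"
        by (rule Cauchy_Schwarz_ineq_sum)
      hence "((\<Sum>k<n. a k * b k) / L n)^2 \<le> ((\<Sum>k<n. (a k)^2) / L n) * ((\<Sum>k<n. (b k)^2) / L n)"
        using elim by (simp add: power_divide power2_eq_square divide_right_mono)
      hence "sqrt (((\<Sum>k<n. a k * b k) / L n)^2) \<le> sqrt (((\<Sum>k<n. (a k)^2) / L n) * ((\<Sum>k<n. (b k)^2) / L n))"
        by (rule real_sqrt_le_mono)
      thus ?case by (simp only: real_sqrt_abs real_sqrt_mult real_norm_def)
    qed
  qed
  hence "(\<lambda>n. (\<Sum>k<n. (a k)^2) / L n + 2 * ((\<Sum>k<n. a k * b k) / L n) + (\<Sum>k<n. (b k)^2) / L n) \<longlonglongrightarrow> \<alpha> + 2 * 0 + 0"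
    by (intro tendsto_add tendsto_mult tendsto_const A B)
  moreover have "(\<Sum>k<n. (a k)^2) / L n + 2 * ((\<Sum>k<n. a k * b k) / L n) + (\<Sum>k<n. (b k)^2) / L n
      = (\<Sum>k<n. (a k + b k)^2) / L n" for n
    by (simp add: power2_sum sum.distrib sum_distrib_left add_divide_distrib mult.assoc)
  ultimately show ?thesis by simp
qed

section \<open>The behaviour of a single path\<close>

definition lil_scale :: "nat \<Rightarrow> real" where
  "lil_scale n = sqrt (2 * real n * ln (ln (real n)))"

lemma lil_scale_at_top: "filterlim lil_scale at_top sequentially"
  unfolding lil_scale_def[abs_def] by real_asymp

lemma sqrt_over_lil_scale: "(\<lambda>n. sqrt (real n) / lil_scale n) \<longlonglongrightarrow> 0"
  unfolding lil_scale_def[abs_def] by real_asymp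

text \<open>The shift by one in \<open>real n + 1\<close> here and below only keeps the normalisation away from zero at \<open>n = 0\<close>.\<close>
lemma quarter_power:
  fixes x :: "nat \<Rightarrow> real"
  assumes "(\<lambda>n. x n / (real n + 1) powr (1/4)) \<longlonglongrightarrow> 0" "(\<lambda>n. z n / (real n + 1) powr (1/4)) \<longlonglongrightarrow> 0"
  shows "(\<lambda>n. x n * z n / sqrt (real n)) \<longlonglongrightarrow> 0"
proof -
  have "(\<lambda>n. sqrt (real n + 1) / sqrt (real n)) \<longlonglongrightarrow> 1" by real_asymp
  hence "(\<lambda>n. (x n / (real n + 1) powr (1/4)) * (z n / (real n + 1) powr (1/4)) * (sqrt (real n + 1) / sqrt (real n))) \<longlonglongrightarrow> 0 * 0 * 1"
    by (intro tendsto_mult assms)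
  moreover have "(x n / (real n + 1) powr (1/4)) * (z n / (real n + 1) powr (1/4)) * (sqrt (real n + 1) / sqrt (real n)) = x n * z n / sqrt (real n)" for n
  proof -
    have "(real n + 1) powr (1/4) * (real n + 1) powr (1/4) = sqrt (real n + 1)"
      by (simp add: powr_add[symmetric] powr_half_sqrt)
    hence "x n * z n / sqrt (real n) = x n * z n * ((real n + 1) powr (1/4) * (real n + 1) powr (1/4)) / (sqrt (real n + 1) * sqrt (real n))"
      by simp
    thus ?thesis using \<open>(real n + 1) powr (1/4) * (real n + 1) powr (1/4) = sqrt (real n + 1)\<close>
      by (simp add: field_simps)
  qed
  ultimately show ?thesis by simp
qed

lemma sum_over_eventually_eq:
  fixes f g L :: "nat \<Rightarrow> real"
  assumes fg: "\<forall>\<^sub>F k in sequentially. f k = g k" and L: "filterlim L at_top sequentially"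
    and g: "(\<lambda>n. (\<Sum>k<n. g k) / L n) \<longlonglongrightarrow> \<alpha>"
  shows "(\<lambda>n. (\<Sum>k<n. f k) / L n) \<longlonglongrightarrow> \<alpha>"
proof -
  obtain N where N: "\<And>k. k \<ge> N \<Longrightarrow> f k = g k" using fg by (auto simp: eventually_sequentially)
  define H where "H = (\<Sum>k<N. f k - g k)"
  have "(\<lambda>n. H / L n) \<longlonglongrightarrow> 0"
    by (rule tendsto_divide_0[OF tendsto_const filterlim_at_top_imp_at_infinity[OF L]])
  hence "(\<lambda>n. H / L n + (\<Sum>k<n. g k) / L n) \<longlonglongrightarrow> 0 + \<alpha>" by (intro tendsto_add g)
  moreover have "\<forall>\<^sub>F n in sequentially. H / L n + (\<Sum>k<n. g k) / L n = (\<Sum>k<n. f k) / L n"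
    using eventually_ge_at_top[of N]
  proof eventually_elim
    case (elim n)
    have "(\<Sum>k<n. f k - g k) = H" unfolding H_def
      by (rule sum.mono_neutral_right) (use elim N in auto)
    thus ?case by (simp add: sum_subtractf add_divide_distrib[symmetric])
  qed
  ultimately show ?thesis by (auto intro: Lim_transform_eventually)
qed

lemma limsup_eq_of_bounds:
  fixes z :: "nat \<Rightarrow> real"
  assumes up: "\<And>\<eta>. \<eta> > 0 \<Longrightarrow> \<forall>\<^sub>F n in sequentially. z n \<le> c + \<eta>"
    and lo: "\<And>\<eta>. \<eta> > 0 \<Longrightarrow> \<exists>\<^sub>F n in sequentially. z n \<ge> c - \<eta>"
  shows "limsup (\<lambda>n. ereal (z n)) = ereal c"
proof (rule antisym)
  show "limsup (\<lambda>n. ereal (z n)) \<le> ereal c"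
    unfolding Limsup_le_iff
  proof (intro allI impI)
    fix y assume "ereal c < y"
    then obtain x where x: "ereal c < ereal x" "ereal x < y" using ereal_dense2 by blast
    have "\<forall>\<^sub>F n in sequentially. z n \<le> c + (x - c)" using x(1) by (intro up) simp
    thus "\<forall>\<^sub>F n in sequentially. ereal (z n) < y"
    proof eventually_elim
      case (elim n)
      hence "ereal (z n) \<le> ereal x" by simp
      thus ?case using x(2) by (rule order.strict_trans1)
    qed
  qed
  show "ereal c \<le> limsup (\<lambda>n. ereal (z n))"
  proof (rule ccontr)
    assume "\<not> ereal c \<le> limsup (\<lambda>n. ereal (z n))"
    hence "limsup (\<lambda>n. ereal (z n)) < ereal c" by (simp add: not_le)
    then obtain x where x: "limsup (\<lambda>n. ereal (z n)) < ereal x" "ereal x < ereal c"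
      using ereal_dense2 by blast
    from Limsup_lessD[OF x(1)] have "\<forall>\<^sub>F n in sequentially. \<not> z n \<ge> c - (c - x)" by (auto elim: eventually_mono)
    moreover have "\<exists>\<^sub>F n in sequentially. z n \<ge> c - (c - x)" using x(2) by (intro lo) simp
    ultimately show False by (simp add: frequently_def)
  qed
qed

text \<open>The almost sure facts about one trajectory from which the theorem follows without further probability.
  \<open>X\<close> and \<open>\<epsilon>\<close> start anywhere, \<open>y\<close> and \<open>e\<close> solve the same recursions from zero, and \<open>B m N\<close> is the martingale of the process restarted
  from zero at time \<open>m\<close>.  In the last assumption the block ratio is \<open>m + 2 \<ge> 2\<close> and the relative loss \<open>1 / (m + 4)\<close> is at most 1/4;
  letting \<open>m\<close> tend to infinity makes both losses disappear.\<close>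
locale ar_path =
  fixes \<theta> \<rho> \<sigma> :: real and v y e X \<epsilon> :: "nat \<Rightarrow> real" and B :: "nat \<Rightarrow> nat \<Rightarrow> real"
  assumes \<theta>: "\<bar>\<theta>\<bar> < 1" and \<rho>: "\<bar>\<rho>\<bar> < 1" and \<sigma>: "\<sigma>^2 > 0"
    and y0: "y 0 = 0" and e0: "e 0 = 0"
    and e_rec: "\<And>n. e (Suc n) = \<rho> * e n + v (Suc n)" and y_rec: "\<And>n. y (Suc n) = \<theta> * y n + e (Suc n)"
    and \<epsilon>_rec: "\<And>n. \<epsilon> (Suc n) = \<rho> * \<epsilon> n + v (Suc n)" and X_rec: "\<And>n. X (Suc n) = \<theta> * X n + \<epsilon> (Suc n)"
    and B_block: "\<And>m N. \<exists>y' e'. y' 0 = 0 \<and> e' 0 = 0 \<and> (\<forall>k. e' (Suc k) = \<rho> * e' k + v (m + Suc k)) \<and>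
        (\<forall>k. y' (Suc k) = \<theta> * y' k + e' (Suc k)) \<and> B m N = (\<Sum>k<N. v (m + Suc k) * y' k)"
    and v_small: "(\<lambda>n. v n / (real n + 1) powr (1/4)) \<longlonglongrightarrow> 0"
    and square_law: "(\<lambda>n. (\<Sum>k<n. (v (Suc k))^2 - \<sigma>^2) / real n) \<longlonglongrightarrow> 0"
    and linear_law: "(\<lambda>n. (\<Sum>k<n. poisson_lin \<theta> \<rho> (y k) (e k) * v (Suc k)) / real n) \<longlonglongrightarrow> 0"
    and product_law: "(\<lambda>n. (\<Sum>k<n. (y k)^2 * ((v (Suc k))^2 - \<sigma>^2)) / real n) \<longlonglongrightarrow> 0"
    and log_law: "(\<lambda>n. (\<Sum>k<n. (\<Sum>i<k. v (Suc i) * y i) * (v (Suc k) * y k) / real (Suc k)) / ln (real n)) \<longlonglongrightarrow> 0"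
    and upper: "\<And>\<eta>. \<eta> > 0 \<Longrightarrow> \<forall>\<^sub>F n in sequentially.
        \<bar>\<Sum>i<n. v (Suc i) * y i\<bar> \<le> (1 + \<eta>) * sqrt (\<sigma>^4 * var_ratio \<theta> \<rho>) * lil_scale n"
    and lower: "\<And>\<upsilon> m. \<bar>\<upsilon>\<bar> = 1 \<Longrightarrow> \<exists>\<^sub>F j in sequentially. \<upsilon> * B ((m+2)^j) ((m+2)^j * (m+1))
        \<ge> (1 - 1 / (real m + 4)) * sqrt (\<sigma>^4 * var_ratio \<theta> \<rho>) * sqrt (2 * ln (real j)) * sqrt (real ((m+2)^j * (m+1)))"
begin

definition mart :: "nat \<Rightarrow> real" where "mart n = (\<Sum>i<n. v (Suc i) * y i)"
definition s where "s = sqrt (\<sigma>^4 * var_ratio \<theta> \<rho>)"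
definition r where "r = max \<bar>\<theta>\<bar> \<bar>\<rho>\<bar>"
abbreviation quarter :: "nat \<Rightarrow> real" where "quarter n \<equiv> (real n + 1) powr (1/4)"

lemma s_pos: "s > 0" using var_ratio_pos[OF \<theta> \<rho>] \<sigma> by (simp add: s_def)

lemma r_bounds: "0 \<le> r" "r < 1" "\<bar>\<theta>\<bar> \<le> r" "\<bar>\<rho>\<bar> \<le> r"
  using \<theta> \<rho> by (auto simp: r_def)

lemma quarter_pos: "quarter n > 0" and quarter_mono: "m \<le> n \<Longrightarrow> quarter m \<le> quarter n"
  by (auto intro!: powr_mono2)

lemma e_small: "(\<lambda>n. e n / quarter n) \<longlonglongrightarrow> 0"
  by (rule first_order_small[OF \<rho> e_rec v_small]) (auto intro: powr_mono2)
lemma y_small: "(\<lambda>n. y n / quarter n) \<longlonglongrightarrow> 0"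
  by (rule first_order_small[OF \<theta> y_rec e_small]) (auto intro: powr_mono2)
lemma \<epsilon>_small: "(\<lambda>n. \<epsilon> n / quarter n) \<longlonglongrightarrow> 0"
  by (rule first_order_small[OF \<rho> \<epsilon>_rec v_small]) (auto intro: powr_mono2)
lemma X_small: "(\<lambda>n. X n / quarter n) \<longlonglongrightarrow> 0"
  by (rule first_order_small[OF \<theta> X_rec \<epsilon>_small]) (auto intro: powr_mono2)

lemma quarter_bound:
  fixes x :: "nat \<Rightarrow> real"
  assumes "(\<lambda>n. x n / quarter n) \<longlonglongrightarrow> 0"
  obtains C where "C \<ge> 0" "\<And>n. \<bar>x n\<bar> \<le> C * quarter n"
proof -
  have "Bseq (\<lambda>n. x n / quarter n)" using assms by (intro convergent_imp_Bseq) (auto simp: convergent_def)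
  then obtain C where C: "C > 0" "\<And>n. norm (x n / quarter n) \<le> C" by (auto simp: Bseq_def)
  have "\<bar>x n\<bar> \<le> C * quarter n" for n
    using C(2)[of n] quarter_pos[of n] by (simp add: abs_of_pos field_simps)
  thus thesis using that[of C] C by simp
qed

lemma quarter_le: "quarter n \<le> real n + 1"
proof -
  have "quarter n \<le> (real n + 1) powr 1" by (intro powr_mono) auto
  thus ?thesis by simp
qed

lemma bounded_partial_sums:
  fixes x d :: "nat \<Rightarrow> real"
  assumes x: "\<And>n. \<bar>x n\<bar> \<le> C * (real n + 1)" and d: "\<And>n. \<bar>d n\<bar> \<le> (real n + 1) * r^n * c"
    and "C \<ge> 0" "c \<ge> 0"
  shows "\<exists>G. \<forall>n. \<bar>\<Sum>k<n. x k * d k\<bar> \<le> G"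
proof -
  have sm: "summable (\<lambda>n. C * c * ((real n + 1)^2 * r^n))"
    by (intro summable_mult summable_poly_geometric r_bounds)
  have "\<bar>\<Sum>k<n. x k * d k\<bar> \<le> (\<Sum>n. C * c * ((real n + 1)^2 * r^n))" for n
  proof -
    have "\<bar>\<Sum>k<n. x k * d k\<bar> \<le> (\<Sum>k<n. \<bar>x k\<bar> * \<bar>d k\<bar>)"
      by (rule order_trans[OF sum_abs]) (simp add: abs_mult)
    also have "\<dots> \<le> (\<Sum>k<n. C * (real k + 1) * ((real k + 1) * r^k * c))"
      using assms by (intro sum_mono mult_mono) auto
    also have "\<dots> = (\<Sum>k<n. C * c * ((real k + 1)^2 * r^k))"
      by (intro sum.cong refl) (simp add: power2_eq_square mult_ac)
    also have "\<dots> \<le> (\<Sum>n. C * c * ((real n + 1)^2 * r^n))"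
      using assms r_bounds by (intro sum_le_suminf sm) auto
    finally show ?thesis .
  qed
  thus ?thesis by blast
qed

lemma initial_difference: "\<bar>X n - y n\<bar> \<le> (real n + 1) * r^n * (\<bar>X 0\<bar> + \<bar>\<epsilon> 0\<bar>)"
  using homogeneous_decay[OF r_bounds(3,4), of "\<lambda>n. X n - y n" "\<lambda>n. \<epsilon> n - e n" n]
  by (simp add: X_rec y_rec \<epsilon>_rec e_rec y0 e0 algebra_simps)

text \<open>The initial values are arbitrary functions on the probability space, possibly dependent on the noise, so their
  influence is estimated path by path: it decays geometrically against terms of polynomial growth.\<close>
lemma martingale_difference_bounded: "\<exists>G. \<forall>n. \<bar>(\<Sum>k<n. v (Suc k) * X k) - mart n\<bar> \<le> G"
proof -
  obtain C where C: "C \<ge> 0" "\<And>n. \<bar>v n\<bar> \<le> C * quarter n" using quarter_bound[OF v_small] by blast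
  have b: "\<bar>v (Suc n)\<bar> \<le> 2 * C * (real n + 1)" for n
  proof -
    have "\<bar>v (Suc n)\<bar> \<le> C * (real (Suc n) + 1)"
      by (rule order_trans[OF C(2) mult_left_mono[OF quarter_le C(1)]])
    also have "\<dots> \<le> C * (2 * (real n + 1))" using C(1) by (intro mult_left_mono) auto
    finally show ?thesis by (simp add: mult_ac)
  qed
  have "\<exists>G. \<forall>n. \<bar>\<Sum>k<n. v (Suc k) * (X k - y k)\<bar> \<le> G"
    by (rule bounded_partial_sums[OF b initial_difference]) (use C in auto)
  thus ?thesis by (simp add: mart_def right_diff_distrib sum_subtractf)
qed

lemma square_sum_difference_bounded: "\<exists>G. \<forall>n. \<bar>(\<Sum>k<n. (X k)^2) - (\<Sum>k<n. (y k)^2)\<bar> \<le> G"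
proof -
  have "(\<lambda>n. X n / quarter n + y n / quarter n) \<longlonglongrightarrow> 0 + 0" by (intro tendsto_add X_small y_small)
  hence "(\<lambda>n. (X n + y n) / quarter n) \<longlonglongrightarrow> 0" by (simp add: add_divide_distrib)
  then obtain C where C: "C \<ge> 0" "\<And>n. \<bar>X n + y n\<bar> \<le> C * quarter n" by (rule quarter_bound) blast
  have b: "\<bar>X n + y n\<bar> \<le> C * (real n + 1)" for n
    by (rule order_trans[OF C(2) mult_left_mono[OF quarter_le C(1)]])
  have "\<exists>G. \<forall>n. \<bar>\<Sum>k<n. (X k + y k) * (X k - y k)\<bar> \<le> G"
    by (rule bounded_partial_sums[OF b initial_difference]) (use C in auto)
  moreover have "(\<Sum>k<n. (X k + y k) * (X k - y k)) = (\<Sum>k<n. (X k)^2) - (\<Sum>k<n. (y k)^2)" for n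
    by (simp add: sum_subtractf[symmetric] power2_eq_square algebra_simps)
  ultimately show ?thesis by simp
qed

lemma bounded_over_n:
  fixes f :: "nat \<Rightarrow> real"
  assumes "\<exists>G. \<forall>n. \<bar>f n\<bar> \<le> G" and g: "filterlim g at_top sequentially"
  shows "(\<lambda>n. f n / g n) \<longlonglongrightarrow> 0"
proof -
  obtain G where G: "\<bar>f n\<bar> \<le> G" for n using assms by blast
  have "Bfun f sequentially" by (rule BfunI[of _ G]) (use G in auto)
  moreover have "((\<lambda>n. inverse (g n)) \<longlongrightarrow> 0) sequentially"
    using g by (intro tendsto_inverse_0_at_top)
  ultimately have "Zfun (\<lambda>n. inverse (g n) * f n) sequentially"
    by (intro bounded_bilinear.Zfun_prod_Bfun[OF bounded_bilinear_mult]) (auto simp: tendsto_Zfun_iff)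
  thus ?thesis by (simp add: tendsto_Zfun_iff divide_inverse mult.commute)
qed

lemma real_at_top: "filterlim (\<lambda>n. real n) at_top sequentially" by (rule filterlim_real_sequentially)

lemma y_square_law: "(\<lambda>n. (\<Sum>k<n. (y k)^2) / real n) \<longlonglongrightarrow> var_ratio \<theta> \<rho> * \<sigma>^2"
proof -
  have po: "(y k)^2 = var_ratio \<theta> \<rho> * (v (Suc k))^2 + poisson_lin \<theta> \<rho> (y k) (e k) * v (Suc k)
      - (corrector \<theta> \<rho> (y (Suc k)) (e (Suc k)) - corrector \<theta> \<rho> (y k) (e k))" for k
    by (rule poisson_equation[OF \<theta> \<rho>]) (simp_all add: y_rec e_rec)
  have "(\<Sum>k<n. (y k)^2) = var_ratio \<theta> \<rho> * (\<Sum>k<n. (v (Suc k))^2 - \<sigma>^2) + var_ratio \<theta> \<rho> * \<sigma>^2 * real n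
      + (\<Sum>k<n. poisson_lin \<theta> \<rho> (y k) (e k) * v (Suc k)) - corrector \<theta> \<rho> (y n) (e n)" for n
  proof -
    have "(\<Sum>k<n. (y k)^2) = var_ratio \<theta> \<rho> * (\<Sum>k<n. (v (Suc k))^2) + (\<Sum>k<n. poisson_lin \<theta> \<rho> (y k) (e k) * v (Suc k))
      - (\<Sum>k<n. corrector \<theta> \<rho> (y (Suc k)) (e (Suc k)) - corrector \<theta> \<rho> (y k) (e k))"
      by (subst po) (simp add: sum.distrib sum_subtractf sum_distrib_left)
    also have "(\<Sum>k<n. corrector \<theta> \<rho> (y (Suc k)) (e (Suc k)) - corrector \<theta> \<rho> (y k) (e k)) = corrector \<theta> \<rho> (y n) (e n)"
      by (subst sum_lessThan_telescope) (simp add: y0 e0 corrector_def)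
    finally show ?thesis by (simp add: sum_subtractf algebra_simps)
  qed
  note decomp = this
  have q: "(\<lambda>n. f n * g n / real n) \<longlonglongrightarrow> 0"
    if "(\<lambda>n. f n / quarter n) \<longlonglongrightarrow> 0" "(\<lambda>n. g n / quarter n) \<longlonglongrightarrow> 0" for f g :: "nat \<Rightarrow> real"
  proof -
    have "(\<lambda>n. sqrt (real n) / real n) \<longlonglongrightarrow> 0" by real_asymp
    hence "(\<lambda>n. (f n * g n / sqrt (real n)) * (sqrt (real n) / real n)) \<longlonglongrightarrow> 0 * 0"
      by (intro tendsto_mult quarter_power that)
    moreover have "(\<lambda>n. (f n * g n / sqrt (real n)) * (sqrt (real n) / real n)) = (\<lambda>n. f n * g n / real n)"
    proof
      show "(f n * g n / sqrt (real n)) * (sqrt (real n) / real n) = f n * g n / real n" for n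
        by (cases "n = 0") auto
    qed
    ultimately show ?thesis by simp
  qed
  have "(\<lambda>n. (y n * y n / real n + corr_ye \<theta> \<rho> * (y n * e n / real n) + corr_ee \<theta> \<rho> * (e n * e n / real n)) / (1 - \<theta>^2)) \<longlonglongrightarrow> (0 + corr_ye \<theta> \<rho> * 0 + corr_ee \<theta> \<rho> * 0) / (1 - \<theta>^2)"
    using stable_pos[OF \<theta> \<rho>] by (intro tendsto_intros q y_small e_small) auto
  hence corrector: "(\<lambda>n. corrector \<theta> \<rho> (y n) (e n) / real n) \<longlonglongrightarrow> 0"
    by (simp add: corrector_def power2_eq_square add_divide_distrib mult_ac)
  have "(\<lambda>n. var_ratio \<theta> \<rho> * ((\<Sum>k<n. (v (Suc k))^2 - \<sigma>^2) / real n) + var_ratio \<theta> \<rho> * \<sigma>^2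
      + (\<Sum>k<n. poisson_lin \<theta> \<rho> (y k) (e k) * v (Suc k)) / real n - corrector \<theta> \<rho> (y n) (e n) / real n)
     \<longlonglongrightarrow> var_ratio \<theta> \<rho> * 0 + var_ratio \<theta> \<rho> * \<sigma>^2 + 0 - 0"
    by (intro tendsto_intros square_law linear_law corrector)
  hence "(\<lambda>n. var_ratio \<theta> \<rho> * ((\<Sum>k<n. (v (Suc k))^2 - \<sigma>^2) / real n) + var_ratio \<theta> \<rho> * \<sigma>^2
      + (\<Sum>k<n. poisson_lin \<theta> \<rho> (y k) (e k) * v (Suc k)) / real n - corrector \<theta> \<rho> (y n) (e n) / real n) \<longlonglongrightarrow> var_ratio \<theta> \<rho> * \<sigma>^2" by simp
  moreover have "\<forall>\<^sub>F n in sequentially. var_ratio \<theta> \<rho> * ((\<Sum>k<n. (v (Suc k))^2 - \<sigma>^2) / real n) + var_ratio \<theta> \<rho> * \<sigma>^2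
      + (\<Sum>k<n. poisson_lin \<theta> \<rho> (y k) (e k) * v (Suc k)) / real n - corrector \<theta> \<rho> (y n) (e n) / real n = (\<Sum>k<n. (y k)^2) / real n"
    using eventually_gt_at_top[of 0]
    by eventually_elim (simp add: decomp add_divide_distrib diff_divide_distrib)
  ultimately show ?thesis by (rule Lim_transform_eventually)
qed

lemma X_square_law: "(\<lambda>n. (\<Sum>k<n. (X k)^2) / real n) \<longlonglongrightarrow> var_ratio \<theta> \<rho> * \<sigma>^2"
proof -
  have "(\<lambda>n. ((\<Sum>k<n. (X k)^2) - (\<Sum>k<n. (y k)^2)) / real n + (\<Sum>k<n. (y k)^2) / real n) \<longlonglongrightarrow> 0 + var_ratio \<theta> \<rho> * \<sigma>^2"
    by (intro tendsto_add y_square_law bounded_over_n[OF square_sum_difference_bounded real_at_top])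
  thus ?thesis by (simp add: diff_divide_distrib)
qed

text \<open>Multiply the second order recursion \<open>X (k+1) = (\<theta> + \<rho>) X k - \<theta> \<rho> X (k-1) + v (k+1)\<close> by \<open>X k\<close> and sum; the shifted sum of products
  reappears on the right, which produces the factor \<open>1 + \<theta> * \<rho>\<close> and hence the limit \<open>theta_star\<close>.\<close>
lemma normal_equation:
  "(1 + \<theta>*\<rho>) * (\<Sum>k<Suc n. X (Suc k) * X k) = (\<theta> + \<rho>) * (\<Sum>k<Suc n. (X k)^2) + (\<Sum>k<Suc n. v (Suc k) * X k)
     + \<theta>*\<rho> * X (Suc n) * X n + (X 1 * X 0 - (\<theta> + \<rho>) * (X 0)^2 - v 1 * X 0)"
proof (induction n)
  case 0
  show ?case by (simp add: power2_eq_square algebra_simps)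
next
  case (Suc n)
  have e1: "\<epsilon> (Suc n) = X (Suc n) - \<theta> * X n" using X_rec[of n] by simp
  have "X (Suc (Suc n)) = \<theta> * X (Suc n) + (\<rho> * \<epsilon> (Suc n) + v (Suc (Suc n)))"
    by (simp only: X_rec[of "Suc n"] \<epsilon>_rec[of "Suc n"])
  hence e2: "X (Suc (Suc n)) = (\<theta> + \<rho>) * X (Suc n) - \<theta>*\<rho> * X n + v (Suc (Suc n))"
    unfolding e1 by (simp add: algebra_simps)
  have "X (Suc (Suc n)) * X (Suc n) = (\<theta> + \<rho>) * (X (Suc n))^2 - \<theta>*\<rho> * X (Suc n) * X n + v (Suc (Suc n)) * X (Suc n)"
    unfolding e2 by (simp add: power2_eq_square algebra_simps)
  thus ?case using Suc by (simp add: algebra_simps)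
qed

definition est :: "nat \<Rightarrow> real" where
  "est n = (\<Sum>k=1..n. X k * X (k - 1)) / (\<Sum>k=1..n. (X (k - 1))^2)"
definition err :: "nat \<Rightarrow> real" where "err n = est n - theta_star \<theta> \<rho>"

text \<open>What separates the normalised estimation error from the martingale of the zero-start process: the effect of the
  initial values, the boundary product, and a constant from the first step.\<close>
definition remainder :: "nat \<Rightarrow> real" where
  "remainder n = ((\<Sum>k<n. v (Suc k) * X k) - mart n) + \<theta>*\<rho> * X n * X (n - 1) + (X 1 * X 0 - (\<theta> + \<rho>) * (X 0)^2 - v 1 * X 0)"

text \<open>The factor that converts \<open>(mart n + remainder n) / n\<close> into the estimation error.\<close>
definition gain :: "nat \<Rightarrow> real" where
  "gain n = real n / ((1 + \<theta>*\<rho>) * (\<Sum>k<n. (X k)^2))"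
definition gain_limit where "gain_limit = 1 / ((1 + \<theta>*\<rho>) * (var_ratio \<theta> \<rho> * \<sigma>^2))"

lemma gain_limit_pos: "gain_limit > 0"
  using stable_pos[OF \<theta> \<rho>] var_ratio_pos[OF \<theta> \<rho>] \<sigma> by (simp add: gain_limit_def)

lemma gain_tendsto: "gain \<longlonglongrightarrow> gain_limit"
proof -
  have "(\<lambda>n. 1 / ((1 + \<theta>*\<rho>) * ((\<Sum>k<n. (X k)^2) / real n))) \<longlonglongrightarrow> gain_limit"
    unfolding gain_limit_def using stable_pos[OF \<theta> \<rho>] var_ratio_pos[OF \<theta> \<rho>] \<sigma>
    by (intro tendsto_intros X_square_law) auto
  thus ?thesis by (simp add: gain_def[abs_def])
qed

lemma err_eq: "\<forall>\<^sub>F n in sequentially. err n = (mart n + remainder n) / real n * gain n"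
proof -
  have "var_ratio \<theta> \<rho> * \<sigma>^2 > 0" using var_ratio_pos[OF \<theta> \<rho>] \<sigma> by simp
  hence "\<forall>\<^sub>F n in sequentially. (\<Sum>k<n. (X k)^2) / real n > 0" by (rule order_tendstoD(1)[OF X_square_law])
  thus ?thesis using eventually_gt_at_top[of 0]
  proof eventually_elim
    case (elim n)
    define S P where "S = (\<Sum>k<n. (X k)^2)" and "P = (\<Sum>k<n. X (Suc k) * X k)"
    have S: "S > 0" using elim by (simp add: S_def zero_less_divide_iff)
    have b: "1 + \<theta>*\<rho> > 0" by (rule stable_pos[OF \<theta> \<rho>])
    have "est n = P / S"
    proof -
      have "(\<Sum>k=1..n. X k * X (k - 1)) = P" "(\<Sum>k=1..n. (X (k - 1))^2) = S"
        unfolding P_def S_def by (rule sum.reindex_bij_witness[of _ Suc "\<lambda>k. k - 1"]; auto)+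
      thus ?thesis by (simp add: est_def)
    qed
    hence "err n = ((1 + \<theta>*\<rho>) * P - (\<theta> + \<rho>) * S) / ((1 + \<theta>*\<rho>) * S)"
      using S b by (simp add: err_def theta_star_def diff_divide_distrib)
    also have "(1 + \<theta>*\<rho>) * P - (\<theta> + \<rho>) * S = mart n + remainder n"
    proof -
      obtain m where m: "n = Suc m" using elim(2) by (cases n) auto
      show ?thesis using normal_equation[of m] unfolding P_def S_def remainder_def m by simp
    qed
    also have "(mart n + remainder n) / ((1 + \<theta>*\<rho>) * S) = (mart n + remainder n) / real n * gain n"
      using elim(2) by (simp add: gain_def S_def)
    finally show ?case .
  qed
qed

lemma remainder_small: "(\<lambda>n. remainder n / sqrt (real n)) \<longlonglongrightarrow> 0"
proof -
  have sq: "filterlim (\<lambda>n. sqrt (real n)) at_top sequentially" by real_asymp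
  have "(\<lambda>n. (X n * X (n - 1)) / sqrt (real n)) \<longlonglongrightarrow> 0"
  proof (rule quarter_power[OF X_small])
    have "(\<lambda>n. X n / quarter (Suc n)) \<longlonglongrightarrow> 0"
    proof (rule Lim_null_comparison[OF _ tendsto_rabs_zero[OF X_small]], rule always_eventually, rule allI)
      fix n
      have "quarter n \<le> quarter (Suc n)" by (rule quarter_mono) simp
      thus "norm (X n / quarter (Suc n)) \<le> \<bar>X n / quarter n\<bar>"
        using quarter_pos[of n] quarter_pos[of "Suc n"] by (simp add: abs_of_pos frac_le)
    qed
    thus "(\<lambda>n. X (n - 1) / quarter n) \<longlonglongrightarrow> 0"
      by (subst filterlim_sequentially_Suc[symmetric]) simp
  qed
  moreover have "(\<lambda>n. (\<lambda>_. X 1 * X 0 - (\<theta> + \<rho>) * (X 0)^2 - v 1 * X 0) n / sqrt (real n)) \<longlonglongrightarrow> 0"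
    by (rule bounded_over_n[OF _ sq]) auto
  ultimately have "(\<lambda>n. ((\<Sum>k<n. v (Suc k) * X k) - mart n) / sqrt (real n) + \<theta>*\<rho> * ((X n * X (n - 1)) / sqrt (real n))
    + (X 1 * X 0 - (\<theta> + \<rho>) * (X 0)^2 - v 1 * X 0) / sqrt (real n)) \<longlonglongrightarrow> 0 + \<theta>*\<rho> * 0 + 0"
    by (intro tendsto_add tendsto_mult tendsto_const bounded_over_n[OF martingale_difference_bounded sq])
  thus ?thesis by (simp add: remainder_def add_divide_distrib mult.assoc)
qed

text \<open>Restarting the process at time \<open>m\<close> changes it by a geometrically decaying multiple of its value at \<open>m\<close>.  That value and
  the noise are of order \<open>n powr (1/4)\<close>, which is exactly enough for an error of order \<open>sqrt n\<close>.\<close>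
lemma block_restart: "\<exists>G. \<forall>m N. \<bar>mart (m + N) - mart m - B m N\<bar> \<le> G * sqrt (real (m + N) + 1)"
proof -
  obtain C1 where C1: "C1 \<ge> 0" "\<And>n. \<bar>v n\<bar> \<le> C1 * quarter n" using quarter_bound[OF v_small] by blast
  obtain C2 where C2: "C2 \<ge> 0" "\<And>n. \<bar>y n\<bar> \<le> C2 * quarter n" using quarter_bound[OF y_small] by blast
  obtain C3 where C3: "C3 \<ge> 0" "\<And>n. \<bar>e n\<bar> \<le> C3 * quarter n" using quarter_bound[OF e_small] by blast
  define S where "S = (\<Sum>n. (real n + 1)^2 * r^n)"
  have sm: "summable (\<lambda>n. (real n + 1)^2 * r^n)" by (intro summable_poly_geometric r_bounds)
  have "\<bar>mart (m + N) - mart m - B m N\<bar> \<le> C1 * (C2 + C3) * S * sqrt (real (m + N) + 1)" for m N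
  proof -
    obtain y' e' where y': "y' 0 = 0" "\<And>k. y' (Suc k) = \<theta> * y' k + e' (Suc k)"
      and e': "e' 0 = 0" "\<And>k. e' (Suc k) = \<rho> * e' k + v (m + Suc k)"
      and Bm: "B m N = (\<Sum>k<N. v (m + Suc k) * y' k)" using B_block[of m N] by blast
    define b where "b = quarter (m + N)"
    have b: "b > 0" "b * b = sqrt (real (m + N) + 1)"
      by (auto simp: b_def powr_add[symmetric] powr_half_sqrt)
    have d: "\<bar>y (m + k) - y' k\<bar> \<le> (real k + 1) * r^k * ((C2 + C3) * b)" for k
    proof -
      have "\<bar>y (m + k) - y' k\<bar> \<le> (real k + 1) * r^k * (\<bar>y m\<bar> + \<bar>e m\<bar>)"
        using homogeneous_decay[OF r_bounds(3,4), of "\<lambda>k. y (m + k) - y' k" "\<lambda>k. e (m + k) - e' k" k]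
        by (simp add: y_rec e_rec y' e' algebra_simps)
      also have "\<dots> \<le> (real k + 1) * r^k * ((C2 + C3) * b)"
      proof (rule mult_left_mono)
        have "quarter m \<le> b" unfolding b_def by (rule quarter_mono) simp
        hence "C2 * quarter m + C3 * quarter m \<le> C2 * b + C3 * b" using C2 C3 by (intro add_mono mult_left_mono) auto
        thus "\<bar>y m\<bar> + \<bar>e m\<bar> \<le> (C2 + C3) * b" using C2(2)[of m] C3(2)[of m] by (simp add: distrib_right)
      qed (use r_bounds in auto)
      finally show ?thesis .
    qed
    have "mart (m + N) = mart m + (\<Sum>k<N. v (m + Suc k) * y (m + k))"
      by (induction N) (auto simp: mart_def)
    hence "\<bar>mart (m + N) - mart m - B m N\<bar> = \<bar>\<Sum>k<N. v (m + Suc k) * (y (m + k) - y' k)\<bar>"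
      by (simp add: Bm right_diff_distrib sum_subtractf)
    also have "\<dots> \<le> (\<Sum>k<N. \<bar>v (m + Suc k)\<bar> * \<bar>y (m + k) - y' k\<bar>)"
      by (rule order_trans[OF sum_abs]) (simp add: abs_mult)
    also have "\<dots> \<le> (\<Sum>k<N. (C1 * b) * ((real k + 1) * r^k * ((C2 + C3) * b)))"
    proof (intro sum_mono mult_mono d)
      fix k assume "k \<in> {..<N}"
      hence "quarter (m + Suc k) \<le> b" unfolding b_def by (intro quarter_mono) auto
      thus "\<bar>v (m + Suc k)\<bar> \<le> C1 * b" by (intro order_trans[OF C1(2)] mult_left_mono C1)
    qed (use C1 b in auto)
    also have "\<dots> = C1 * (C2 + C3) * (b * b) * (\<Sum>k<N. (real k + 1) * r^k)"
      by (simp add: sum_distrib_left mult_ac)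
    also have "\<dots> \<le> C1 * (C2 + C3) * (b * b) * S"
    proof (rule mult_left_mono)
      have "(\<Sum>k<N. (real k + 1) * r^k) \<le> (\<Sum>k<N. (real k + 1)^2 * r^k)"
        using r_bounds by (intro sum_mono mult_right_mono) (auto simp: power2_eq_square)
      also have "\<dots> \<le> S" unfolding S_def using r_bounds by (intro sum_le_suminf sm) auto
      finally show "(\<Sum>k<N. (real k + 1) * r^k) \<le> S" .
    qed (use C1 C2 C3 b in auto)
    also have "\<dots> = C1 * (C2 + C3) * S * sqrt (real (m + N) + 1)" unfolding b by (simp only: mult_ac)
    finally show ?thesis .
  qed
  thus ?thesis by blast
qed

text \<open>The last block carries all but a fraction \<open>1 / Q\<close> of the variance up to time \<open>Q^(j+1)\<close>, and the martingale before that block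
  is controlled by the upper half.\<close>
lemma lower_LIL:
  assumes sgn: "\<bar>\<upsilon>\<bar> = 1" and \<eta>: "\<eta> > 0"
  shows "\<exists>\<^sub>F n in sequentially. \<upsilon> * mart n \<ge> (s - \<eta>) * lil_scale n"
proof -
  (* g m collects the three losses: in the block, in the length of the block, and from the past before it. *)
  define g where "g m = (1 - 1 / (real m + 4)) * sqrt (1 - 1 / (real m + 2)) - 2 / sqrt (real m + 2)" for m :: nat
  have "g \<longlonglongrightarrow> 1" unfolding g_def by real_asymp
  hence "(\<lambda>m. s * g m) \<longlonglongrightarrow> s * 1" by (intro tendsto_mult tendsto_const)
  hence "\<forall>\<^sub>F m in sequentially. s * g m > s - \<eta> / 2" using \<eta> by (intro order_tendstoD(1)) auto
  then obtain m where m: "s * g m > s - \<eta> / 2" by (auto simp: eventually_sequentially)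
  define Q where "Q = m + 2"
  define q where "q = real Q"
  define \<kappa> where "\<kappa> = ln q"
  have q: "q \<ge> 2" "q = real m + 2" and \<kappa>: "\<kappa> > 0" by (auto simp: q_def Q_def \<kappa>_def)
  have Qpow: "real (Q^j) = q^j" for j by (simp add: q_def)
  have Q_top: "filterlim (\<lambda>j. Q^j) at_top sequentially"
  proof (rule filterlim_at_top_mono[OF filterlim_ident])
    have "j \<le> Q^j" for j
    proof -
      have "j < 2^j" by (rule less_exp)
      also have "\<dots> \<le> Q^j" by (intro power_mono) (auto simp: Q_def)
      finally show ?thesis by simp
    qed
    thus "\<forall>\<^sub>F j in sequentially. j \<le> Q^j" by simp
  qed
  have Q_top': "filterlim (\<lambda>j. Q^Suc j) at_top sequentially"
    using Q_top by (rule filterlim_compose[OF _ filterlim_Suc])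
  define \<epsilon>' where "\<epsilon>' = 1 / (real m + 4)"
  have \<epsilon>': "0 < \<epsilon>'" "\<epsilon>' < 1" by (auto simp: \<epsilon>'_def)
  define L where "L j = lil_scale (Q^Suc j)" for j
  define \<phi> where "\<phi> j = sqrt (ln (real j) / ln (\<kappa> * (real j + 1)))" for j
  have phi: "\<phi> \<longlonglongrightarrow> 1" unfolding \<phi>_def using \<kappa> by real_asymp
  have lnln: "ln (ln (q^j)) = ln (\<kappa> * real j)" for j
    unfolding \<kappa>_def using q(1) by (simp add: ln_realpow mult.commute)
  have ev_ln: "\<forall>\<^sub>F j in sequentially. ln (\<kappa> * real j) > 0 \<and> ln (real j) > 0"
    using \<kappa> by (intro eventually_conj) real_asymp+
  have ev_L: "\<forall>\<^sub>F j in sequentially. L j > 0"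
    unfolding L_def using filterlim_compose[OF lil_scale_at_top Q_top'] by (auto simp: filterlim_at_top_dense)
  obtain G where G: "\<And>m N. \<bar>mart (m + N) - mart m - B m N\<bar> \<le> G * sqrt (real (m + N) + 1)"
    using block_restart by blast
  have 1: "\<forall>\<^sub>F j in sequentially. \<bar>mart (Q^j)\<bar> \<le> 2 * s * lil_scale (Q^j)"
  proof -
    have "\<forall>\<^sub>F n in sequentially. \<bar>mart n\<bar> \<le> 2 * s * lil_scale n"
      using upper[of 1] by (simp add: mart_def s_def)
    thus ?thesis by (rule eventually_compose_filterlim[OF _ Q_top])
  qed
  have 2: "\<forall>\<^sub>F j in sequentially. lil_scale (Q^j) \<le> L j / sqrt q"
    using ev_ln eventually_gt_at_top[of 0]
  proof eventually_elim
    case (elim j)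
    have "ln (\<kappa> * real j) \<le> ln (\<kappa> * real (Suc j))" using \<kappa> elim by (subst ln_le_cancel_iff) auto
    hence "2 * q^j * ln (\<kappa> * real j) \<le> 2 * q^j * ln (\<kappa> * real (Suc j))" using q by (intro mult_left_mono) auto
    also have "\<dots> = 2 * q^Suc j * ln (\<kappa> * real (Suc j)) / q" using q by simp
    finally have "lil_scale (Q^j) \<le> sqrt (2 * q^Suc j * ln (\<kappa> * real (Suc j)) / q)"
      unfolding lil_scale_def Qpow lnln by (rule real_sqrt_le_mono)
    also have "\<dots> = L j / sqrt q" unfolding L_def lil_scale_def Qpow lnln by (rule real_sqrt_divide)
    finally show ?case .
  qed
  have 3: "\<forall>\<^sub>F j in sequentially. sqrt (2 * ln (real j)) * sqrt (real (Q^j * (m+1))) = sqrt (1 - 1/q) * \<phi> j * L j"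
    using ev_ln
  proof eventually_elim
    case (elim j)
    have "\<kappa> * real j \<le> \<kappa> * (real j + 1)" using \<kappa> by simp
    moreover have "j > 0" using elim by (cases j) auto
    ultimately have "ln (\<kappa> * real j) \<le> ln (\<kappa> * (real j + 1))" using \<kappa> by (subst ln_le_cancel_iff) auto
    hence pos: "ln (\<kappa> * (real j + 1)) > 0" using elim by linarith
    have L: "L j = sqrt (2 * q^Suc j * ln (\<kappa> * (real j + 1)))"
      unfolding L_def lil_scale_def Qpow lnln by (simp add: add.commute)
    have "sqrt (1 - 1/q) * \<phi> j * L j = sqrt ((1 - 1/q) * (ln (real j) / ln (\<kappa> * (real j + 1))) * (2 * q^Suc j * ln (\<kappa> * (real j + 1))))"
      unfolding L \<phi>_def by (simp only: real_sqrt_mult)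
    also have "(1 - 1/q) * (ln (real j) / ln (\<kappa> * (real j + 1))) * (2 * q^Suc j * ln (\<kappa> * (real j + 1)))
       = 2 * ln (real j) * (q^j * (q - 1))" using pos q(1) by (simp add: field_simps)
    also have "q^j * (q - 1) = real (Q^j * (m+1))" unfolding of_nat_mult Qpow by (simp add: q(2))
    finally show ?case by (simp only: real_sqrt_mult)
  qed
  have 4: "\<forall>\<^sub>F j in sequentially. G * sqrt (real (Q^Suc j) + 1) \<le> \<eta> / 4 * L j"
  proof -
    have "(\<lambda>n. sqrt (real n + 1) / lil_scale n) \<longlonglongrightarrow> 0" unfolding lil_scale_def[abs_def] by real_asymp
    hence "(\<lambda>n. G * (sqrt (real n + 1) / lil_scale n)) \<longlonglongrightarrow> G * 0" by (intro tendsto_mult tendsto_const)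
    hence "\<forall>\<^sub>F n in sequentially. G * (sqrt (real n + 1) / lil_scale n) < \<eta> / 4"
      using \<eta> by (intro order_tendstoD(2)) auto
    from eventually_compose_filterlim[OF this Q_top'] ev_L
    show ?thesis
    proof eventually_elim
      case (elim j)
      thus ?case unfolding L_def by (simp add: field_simps)
    qed
  qed
  have 5: "\<forall>\<^sub>F j in sequentially. (1 - \<epsilon>') * s * sqrt (1 - 1/q) * \<phi> j \<ge> (1 - \<epsilon>') * s * sqrt (1 - 1/q) - \<eta> / 4"
  proof -
    have "(\<lambda>j. (1 - \<epsilon>') * s * sqrt (1 - 1/q) * \<phi> j) \<longlonglongrightarrow> (1 - \<epsilon>') * s * sqrt (1 - 1/q) * 1"
      by (intro tendsto_mult tendsto_const phi)
    hence "\<forall>\<^sub>F j in sequentially. (1 - \<epsilon>') * s * sqrt (1 - 1/q) * \<phi> j > (1 - \<epsilon>') * s * sqrt (1 - 1/q) - \<eta> / 4"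
      using \<eta> by (intro order_tendstoD(1)) auto
    thus ?thesis by eventually_elim simp
  qed
  have low: "\<exists>\<^sub>F j in sequentially. \<upsilon> * B (Q^j) (Q^j * (m+1))
        \<ge> (1 - \<epsilon>') * s * (sqrt (2 * ln (real j)) * sqrt (real (Q^j * (m+1))))"
    using lower[OF sgn, of m] by (simp add: Q_def \<epsilon>'_def s_def mult.assoc)
  have "\<exists>\<^sub>F j in sequentially. \<upsilon> * mart (Q^Suc j) \<ge> (s - \<eta>) * L j"
  proof (rule frequently_rev_mp[OF low])
    show "\<forall>\<^sub>F j in sequentially. (1 - \<epsilon>') * s * (sqrt (2 * ln (real j)) * sqrt (real (Q^j * (m+1)))) \<le> \<upsilon> * B (Q^j) (Q^j * (m+1))
      \<longrightarrow> (s - \<eta>) * L j \<le> \<upsilon> * mart (Q^Suc j)"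
      using 1 2 3 4 5 ev_L
    proof (eventually_elim, intro impI)
      case (elim j)
      have sum: "Q^j + Q^j * (m+1) = Q^Suc j" by (simp add: Q_def algebra_simps)
      have G': "\<bar>mart (Q^Suc j) - mart (Q^j) - B (Q^j) (Q^j * (m+1))\<bar> \<le> \<eta> / 4 * L j"
        using G[of "Q^j" "Q^j * (m+1)"] elim(4) unfolding sum by linarith
      have abs_v: "\<upsilon> * x \<ge> - \<bar>x\<bar>" for x
        using sgn abs_ge_minus_self[of "\<upsilon> * x"] by (simp add: abs_mult)
      have "\<upsilon> * mart (Q^Suc j) = \<upsilon> * B (Q^j) (Q^j * (m+1)) + \<upsilon> * mart (Q^j)
         + \<upsilon> * (mart (Q^Suc j) - mart (Q^j) - B (Q^j) (Q^j * (m+1)))" by (simp add: algebra_simps)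
      moreover have "\<upsilon> * mart (Q^j) \<ge> - (2 * s * (L j / sqrt q))"
      proof -
        have "2 * s * lil_scale (Q^j) \<le> 2 * s * (L j / sqrt q)" using elim(2) s_pos by (intro mult_left_mono) auto
        thus ?thesis using abs_v[of "mart (Q^j)"] elim(1) by linarith
      qed
      moreover have "\<upsilon> * (mart (Q^Suc j) - mart (Q^j) - B (Q^j) (Q^j * (m+1))) \<ge> - (\<eta> / 4 * L j)"
        using abs_v[of "mart (Q^Suc j) - mart (Q^j) - B (Q^j) (Q^j * (m+1))"] G' by linarith
      moreover have "(1 - \<epsilon>') * s * (sqrt (2 * ln (real j)) * sqrt (real (Q^j * (m+1)))) \<ge> ((1 - \<epsilon>') * s * sqrt (1 - 1/q) - \<eta> / 4) * L j"
      proof -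
        have "((1 - \<epsilon>') * s * sqrt (1 - 1/q) - \<eta> / 4) * L j \<le> (1 - \<epsilon>') * s * sqrt (1 - 1/q) * \<phi> j * L j"
          using elim(5,6) by (intro mult_right_mono) auto
        also have "\<dots> = (1 - \<epsilon>') * s * (sqrt (1 - 1/q) * \<phi> j * L j)" by (simp only: mult.assoc)
        finally show ?thesis unfolding elim(3) .
      qed
      moreover have "(s - \<eta>) * L j \<le> ((1 - \<epsilon>') * s * sqrt (1 - 1/q) - \<eta> / 4) * L j - 2 * s * (L j / sqrt q) - \<eta> / 4 * L j"
      proof -
        have "s * g m = (1 - \<epsilon>') * s * sqrt (1 - 1/q) - 2 * s / sqrt q"
          by (simp add: g_def \<epsilon>'_def q(2) algebra_simps)
        hence "s - \<eta> \<le> (1 - \<epsilon>') * s * sqrt (1 - 1/q) - \<eta> / 4 - 2 * s / sqrt q - \<eta> / 4" using m by linarith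
        hence "(s - \<eta>) * L j \<le> ((1 - \<epsilon>') * s * sqrt (1 - 1/q) - \<eta> / 4 - 2 * s / sqrt q - \<eta> / 4) * L j"
          using elim(6) by (intro mult_right_mono) auto
        thus ?thesis by (simp only: left_diff_distrib times_divide_eq_left times_divide_eq_right)
      qed
      ultimately show "(1 - \<epsilon>') * s * (sqrt (2 * ln (real j)) * sqrt (real (Q^j * (m+1)))) \<le> \<upsilon> * B (Q^j) (Q^j * (m+1))
         \<Longrightarrow> (s - \<eta>) * L j \<le> \<upsilon> * mart (Q^Suc j)" by linarith
    qed
  qed
  thus ?thesis unfolding frequently_def L_def
    using eventually_compose_filterlim[OF _ Q_top'] by blast
qed

definition norm_err :: "nat \<Rightarrow> real" where
  "norm_err n = sqrt (real n / (2 * ln (ln (real n)))) * err n"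

text \<open>The limiting variance of the martingale and the limit of the denominators combine to the constant of the theorem.\<close>
lemma s_gain: "s * gain_limit = sigma_theta \<theta> \<rho>" and sigma_theta_sq_eq: "(s * gain_limit)^2 = sigma_theta_sq \<theta> \<rho>"
proof -
  note p = stable_pos[OF \<theta> \<rho>]
  have nz: "\<sigma> \<noteq> 0" "var_ratio \<theta> \<rho> \<noteq> 0" using \<sigma> var_ratio_pos[OF \<theta> \<rho>] by auto
  have "(s * gain_limit)^2 = (\<sigma>^4 * var_ratio \<theta> \<rho>) / ((1 + \<theta>*\<rho>) * (var_ratio \<theta> \<rho> * \<sigma>^2))^2"
    using var_ratio_pos[OF \<theta> \<rho>] by (simp add: s_def gain_limit_def power_mult_distrib power_divide)
  also have "\<dots> = 1 / ((1 + \<theta>*\<rho>)^2 * var_ratio \<theta> \<rho>)"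
  proof -
    have "\<sigma>^4 * c / (w * (c * \<sigma>^2))^2 = 1 / (w^2 * c)" if "c \<noteq> 0" "w \<noteq> 0" for c w :: real
      using nz that by (simp add: power2_eq_square power4_eq_xxxx)
    thus ?thesis using nz p by simp
  qed
  also have "\<dots> = sigma_theta_sq \<theta> \<rho>"
  proof -
    have "1 / (w^2 * (w / (a * b * c))) = (a * b * c) / w^3" if "w \<noteq> 0" for a b c w :: real
      using that by (simp add: power2_eq_square power3_eq_cube)
    from this[of "1 + \<theta>*\<rho>" "1 - \<theta>^2" "1 - \<theta>*\<rho>" "1 - \<rho>^2"] show ?thesis
      using p unfolding var_ratio_def sigma_theta_sq_def by simp
  qed
  finally show e: "(s * gain_limit)^2 = sigma_theta_sq \<theta> \<rho>" .
  show "s * gain_limit = sigma_theta \<theta> \<rho>"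
    unfolding sigma_theta_def e[symmetric] using s_pos gain_limit_pos by simp
qed

lemma norm_err_eq: "\<forall>\<^sub>F n in sequentially. norm_err n = (mart n / lil_scale n + remainder n / lil_scale n) * gain n"
proof -
  have "\<forall>\<^sub>F n in sequentially. ln (ln (real n)) > 0" by real_asymp
  thus ?thesis using err_eq eventually_gt_at_top[of 0]
  proof eventually_elim
    case (elim n)
    have "sqrt (real n / (2 * ln (ln (real n)))) * lil_scale n = sqrt ((real n / (2 * ln (ln (real n)))) * (2 * real n * ln (ln (real n))))"
      unfolding lil_scale_def by (simp only: real_sqrt_mult)
    also have "(real n / (2 * ln (ln (real n)))) * (2 * real n * ln (ln (real n))) = (real n)^2"
      using elim(1) by (simp add: field_simps power2_eq_square)
    finally have p: "sqrt (real n / (2 * ln (ln (real n)))) * lil_scale n = real n" by simp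
    have L: "lil_scale n > 0" using elim by (simp add: lil_scale_def)
    have q: "sqrt (real n / (2 * ln (ln (real n)))) = real n / lil_scale n" using p L by (simp add: field_simps)
    have "norm_err n = real n / lil_scale n * ((mart n + remainder n) / real n * gain n)" unfolding norm_err_def q elim(2) ..
    also have "\<dots> = (mart n + remainder n) / lil_scale n * gain n" using elim(3) by simp
    finally show ?case by (simp only: add_divide_distrib)
  qed
qed

text \<open>The martingale on the scale of the iterated logarithm is bounded, so the convergence of the gain suffices.\<close>
lemma norm_err_perturbation: "(\<lambda>n. norm_err n - gain_limit * (mart n / lil_scale n)) \<longlonglongrightarrow> 0"
proof -
  have Lpos: "\<forall>\<^sub>F n in sequentially. lil_scale n > 0"
    using lil_scale_at_top by (auto simp: filterlim_at_top_dense)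
  have "(\<lambda>n. (remainder n / sqrt (real n)) * (sqrt (real n) / lil_scale n)) \<longlonglongrightarrow> 0 * 0"
    by (intro tendsto_mult remainder_small sqrt_over_lil_scale)
  moreover have "\<forall>\<^sub>F n in sequentially. (remainder n / sqrt (real n)) * (sqrt (real n) / lil_scale n) = remainder n / lil_scale n"
    using eventually_gt_at_top[of 0] by eventually_elim simp
  ultimately have remainder: "(\<lambda>n. remainder n / lil_scale n) \<longlonglongrightarrow> 0" by (auto intro: Lim_transform_eventually)
  have "(\<lambda>n. (gain n - gain_limit) * (mart n / lil_scale n)) \<longlonglongrightarrow> 0"
  proof (rule Lim_null_comparison)
    have "(\<lambda>n. \<bar>gain n - gain_limit\<bar> * (2 * s)) \<longlonglongrightarrow> 0 * (2 * s)"
      using gain_tendsto by (intro tendsto_mult tendsto_const tendsto_rabs_zero) (simp add: LIM_zero)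
    thus "(\<lambda>n. \<bar>gain n - gain_limit\<bar> * (2 * s)) \<longlonglongrightarrow> 0" by simp
    have "\<forall>\<^sub>F n in sequentially. \<bar>mart n\<bar> \<le> 2 * s * lil_scale n"
      using upper[of 1] by (simp add: mart_def s_def)
    thus "\<forall>\<^sub>F n in sequentially. norm ((gain n - gain_limit) * (mart n / lil_scale n)) \<le> \<bar>gain n - gain_limit\<bar> * (2 * s)"
      using Lpos
    proof eventually_elim
      case (elim n)
      have "\<bar>mart n / lil_scale n\<bar> \<le> 2 * s" using elim by (simp add: field_simps)
      thus ?case unfolding real_norm_def abs_mult by (rule mult_left_mono) simp
    qed
  qed
  hence "(\<lambda>n. (gain n - gain_limit) * (mart n / lil_scale n) + remainder n / lil_scale n * gain n) \<longlonglongrightarrow> 0 + 0 * gain_limit"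
    by (intro tendsto_add tendsto_mult remainder gain_tendsto)
  hence "(\<lambda>n. (gain n - gain_limit) * (mart n / lil_scale n) + remainder n / lil_scale n * gain n) \<longlonglongrightarrow> 0" by simp
  moreover have "\<forall>\<^sub>F n in sequentially. (gain n - gain_limit) * (mart n / lil_scale n) + remainder n / lil_scale n * gain n
      = norm_err n - gain_limit * (mart n / lil_scale n)"
    using norm_err_eq
  proof eventually_elim
    case (elim n)
    show ?case unfolding elim by (simp add: algebra_simps)
  qed
  ultimately show ?thesis by (rule Lim_transform_eventually)
qed

lemma norm_err_upper: assumes "\<eta> > 0" shows "\<forall>\<^sub>F n in sequentially. \<bar>norm_err n\<bar> \<le> s * gain_limit + \<eta>"
proof -
  define \<eta>' where "\<eta>' = \<eta> / (2 * (s * gain_limit))"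
  have sg: "s * gain_limit > 0" using s_pos gain_limit_pos by simp
  have e': "\<eta>' > 0" using assms sg by (simp add: \<eta>'_def)
  have t: "\<forall>\<^sub>F n in sequentially. \<bar>norm_err n - gain_limit * (mart n / lil_scale n)\<bar> < \<eta> / 2"
    using tendsto_rabs_zero[OF norm_err_perturbation] assms by (intro order_tendstoD(2)) auto
  have Lpos: "\<forall>\<^sub>F n in sequentially. lil_scale n > 0"
    using lil_scale_at_top by (auto simp: filterlim_at_top_dense)
  from upper[OF e'] t Lpos show ?thesis
  proof eventually_elim
    case (elim n)
    have "\<bar>mart n\<bar> / lil_scale n \<le> (1 + \<eta>') * s"
      using elim(1,3) by (simp add: mart_def s_def field_simps)
    hence "gain_limit * (\<bar>mart n\<bar> / lil_scale n) \<le> gain_limit * ((1 + \<eta>') * s)"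
      using gain_limit_pos by (intro mult_left_mono) auto
    also have "\<dots> = s * gain_limit + \<eta> / 2" using s_pos gain_limit_pos by (simp add: \<eta>'_def field_simps)
    finally have "\<bar>gain_limit * (mart n / lil_scale n)\<bar> \<le> s * gain_limit + \<eta> / 2"
      using gain_limit_pos elim(3) by (simp add: abs_mult)
    thus ?case using elim(2) by linarith
  qed
qed

lemma norm_err_lower: assumes "\<eta> > 0" "\<bar>\<upsilon>\<bar> = 1" shows "\<exists>\<^sub>F n in sequentially. \<upsilon> * norm_err n \<ge> s * gain_limit - \<eta>"
proof -
  define \<eta>' where "\<eta>' = \<eta> / (2 * gain_limit)"
  have e': "\<eta>' > 0" using assms gain_limit_pos by (simp add: \<eta>'_def)
  have t: "\<forall>\<^sub>F n in sequentially. \<bar>norm_err n - gain_limit * (mart n / lil_scale n)\<bar> < \<eta> / 2"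
    using tendsto_rabs_zero[OF norm_err_perturbation] assms by (intro order_tendstoD(2)) auto
  have Lpos: "\<forall>\<^sub>F n in sequentially. lil_scale n > 0"
    using lil_scale_at_top by (auto simp: filterlim_at_top_dense)
  show ?thesis
  proof (rule frequently_rev_mp[OF lower_LIL[OF assms(2) e']])
    show "\<forall>\<^sub>F n in sequentially. (s - \<eta>') * lil_scale n \<le> \<upsilon> * mart n \<longrightarrow> s * gain_limit - \<eta> \<le> \<upsilon> * norm_err n"
      using t Lpos
    proof (eventually_elim, intro impI)
      fix n assume t: "\<bar>norm_err n - gain_limit * (mart n / lil_scale n)\<bar> < \<eta> / 2" and L: "0 < lil_scale n"
        and lo: "(s - \<eta>') * lil_scale n \<le> \<upsilon> * mart n"
      have "s - \<eta>' \<le> \<upsilon> * (mart n / lil_scale n)" using lo L by (simp add: field_simps)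
      hence "gain_limit * (s - \<eta>') \<le> gain_limit * (\<upsilon> * (mart n / lil_scale n))"
        using gain_limit_pos by (intro mult_left_mono) auto
      moreover have "gain_limit * (s - \<eta>') = s * gain_limit - \<eta> / 2"
        using gain_limit_pos by (simp add: \<eta>'_def field_simps)
      moreover have "\<upsilon> * (norm_err n - gain_limit * (mart n / lil_scale n)) \<ge> - (\<eta> / 2)"
      proof -
        have "\<bar>\<upsilon> * (norm_err n - gain_limit * (mart n / lil_scale n))\<bar> < \<eta> / 2" using t assms(2) by (simp add: abs_mult)
        thus ?thesis by linarith
      qed
      ultimately show "s * gain_limit - \<eta> \<le> \<upsilon> * norm_err n" by (simp add: algebra_simps)
    qed
  qed
qed

lemma limsup_norm_err: "limsup (\<lambda>n. ereal (norm_err n)) = ereal (sigma_theta \<theta> \<rho>)"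
  unfolding s_gain[symmetric]
proof (rule limsup_eq_of_bounds)
  show "\<forall>\<^sub>F n in sequentially. norm_err n \<le> s * gain_limit + \<eta>" if "\<eta> > 0" for \<eta>
    using norm_err_upper[OF that] by eventually_elim simp
  show "\<exists>\<^sub>F n in sequentially. norm_err n \<ge> s * gain_limit - \<eta>" if "\<eta> > 0" for \<eta>
    using norm_err_lower[OF that, of 1] by simp
qed

lemma liminf_norm_err: "- liminf (\<lambda>n. ereal (norm_err n)) = ereal (sigma_theta \<theta> \<rho>)"
proof -
  have "limsup (\<lambda>n. ereal (- norm_err n)) = ereal (s * gain_limit)"
  proof (rule limsup_eq_of_bounds)
    show "\<forall>\<^sub>F n in sequentially. - norm_err n \<le> s * gain_limit + \<eta>" if "\<eta> > 0" for \<eta>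
      using norm_err_upper[OF that] by eventually_elim simp
    show "\<exists>\<^sub>F n in sequentially. - norm_err n \<ge> s * gain_limit - \<eta>" if "\<eta> > 0" for \<eta>
      using norm_err_lower[OF that, of "-1"] by simp
  qed
  moreover have "limsup (\<lambda>n. ereal (- norm_err n)) = - liminf (\<lambda>n. ereal (norm_err n))"
    using ereal_Limsup_uminus[of sequentially "\<lambda>n. ereal (norm_err n)"] by simp
  ultimately show ?thesis by (simp add: s_gain)
qed

lemma limsup_norm_err_square:
  "limsup (\<lambda>n. ereal (real n / (2 * ln (ln (real n))) * (err n)^2)) = ereal (sigma_theta_sq \<theta> \<rho>)"
  unfolding sigma_theta_sq_eq[symmetric]
proof (rule limsup_eq_of_bounds)
  define c where "c = s * gain_limit"
  have c: "c > 0" using s_pos gain_limit_pos by (simp add: c_def)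
  have sq: "\<forall>\<^sub>F n in sequentially. real n / (2 * ln (ln (real n))) * (err n)^2 = (norm_err n)^2"
  proof -
    have "\<forall>\<^sub>F n in sequentially. ln (ln (real n)) > 0" by real_asymp
    thus ?thesis by eventually_elim (simp add: norm_err_def power_mult_distrib)
  qed
  fix \<eta> :: real assume \<eta>: "\<eta> > 0"
  (* Then 2 c delta + delta^2 <= 3 c delta <= eta, and c - delta stays nonnegative. *)
  define \<delta> where "\<delta> = min c (\<eta> / (3 * c))"
  have \<delta>: "\<delta> > 0" "\<delta> \<le> c" "3 * (c * \<delta>) \<le> \<eta>" using \<eta> c by (auto simp: \<delta>_def min_def field_simps)
  have dd: "\<delta> * \<delta> \<le> c * \<delta>" "0 \<le> \<delta> * \<delta>" "0 \<le> c * \<delta>" using \<delta> c by (auto intro: mult_right_mono)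
  have "(c + \<delta>)^2 = c^2 + 2 * (c * \<delta>) + \<delta> * \<delta>" "(c - \<delta>)^2 = c^2 - 2 * (c * \<delta>) + \<delta> * \<delta>"
    by (simp_all add: power2_eq_square algebra_simps)
  hence up: "(c + \<delta>)^2 \<le> c^2 + \<eta>" and lo: "c^2 - \<eta> \<le> (c - \<delta>)^2"
    using \<delta>(3) dd by linarith+
  show "\<forall>\<^sub>F n in sequentially. real n / (2 * ln (ln (real n))) * (err n)^2 \<le> (s * gain_limit)^2 + \<eta>"
    using norm_err_upper[OF \<delta>(1)] sq unfolding c_def[symmetric]
  proof eventually_elim
    case (elim n)
    have "\<bar>norm_err n\<bar>^2 \<le> (c + \<delta>)^2" using elim by (intro power_mono) auto
    thus ?case using up elim by simp
  qed
  show "\<exists>\<^sub>F n in sequentially. real n / (2 * ln (ln (real n))) * (err n)^2 \<ge> (s * gain_limit)^2 - \<eta>"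
    unfolding c_def[symmetric]
  proof (rule frequently_rev_mp[OF norm_err_lower[OF \<delta>(1), of 1]])
    show "\<forall>\<^sub>F n in sequentially. s * gain_limit - \<delta> \<le> 1 * norm_err n \<longrightarrow> c^2 - \<eta> \<le> real n / (2 * ln (ln (real n))) * (err n)^2"
      using sq
    proof (eventually_elim, intro impI)
      fix n assume e: "real n / (2 * ln (ln (real n))) * (err n)^2 = (norm_err n)^2" and "s * gain_limit - \<delta> \<le> 1 * norm_err n"
      hence "c - \<delta> \<le> norm_err n" by (simp add: c_def)
      hence "(c - \<delta>)^2 \<le> (norm_err n)^2" using \<delta> by (intro power_mono) auto
      thus "c^2 - \<eta> \<le> real n / (2 * ln (ln (real n))) * (err n)^2" using lo e by simp
    qed
  qed simp
qed

text \<open>Telescoping \<open>mart n ^ 2 / n\<close> expresses the sum through a boundary term, a martingale and the logarithmic average of the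
  squared increments.  The boundary term is negligible against \<open>ln n\<close> by the law of the iterated logarithm.\<close>
lemma martingale_quadratic_law:
  "(\<lambda>n. (\<Sum>k<n. (mart k / sqrt (real k * (real k + 1)))^2) / ln (real n)) \<longlonglongrightarrow> s^2"
proof -
  define T where "T n = (\<Sum>k<n. mart k * (v (Suc k) * y k) / real (Suc k))" for n
  have mart_Suc: "mart (Suc n) = mart n + v (Suc n) * y n" for n by (simp add: mart_def)
  have parts: "(\<Sum>k<n. (mart k / sqrt (real k * (real k + 1)))^2)
     = - ((mart n)^2 / real n) + 2 * T n + (\<Sum>k<n. (v (Suc k) * y k)^2 / real (Suc k))" for n
  proof (induction n)
    case (Suc n)
    have "(mart n / sqrt (real n * (real n + 1)))^2 - (mart n)^2 / real n
       = - ((mart (Suc n))^2 / real (Suc n)) + 2 * (mart n * (v (Suc n) * y n) / real (Suc n)) + (v (Suc n) * y n)^2 / real (Suc n)"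
    proof (cases "n = 0")
      case True
      thus ?thesis by (simp add: mart_def)
    next
      case False
      have "M^2 / (x * (x + 1)) - M^2 / x = - ((M + d)^2 / (x + 1)) + 2 * (M * d / (x + 1)) + d^2 / (x + 1)"
        if "x > 0" for M d x :: real
        using that by (simp add: divide_simps) (simp add: power2_eq_square algebra_simps)
      from this[of "real n" "mart n" "v (Suc n) * y n"] False show ?thesis
        by (simp add: mart_Suc power_divide add.commute)
    qed
    thus ?case using Suc by (simp add: T_def)
  qed (simp add: T_def mart_def)
  have T: "(\<lambda>n. T n / ln (real n)) \<longlonglongrightarrow> 0" using log_law by (simp add: T_def[abs_def] mart_def)
  have D: "(\<lambda>n. (\<Sum>k<n. (v (Suc k) * y k)^2 / real (Suc k)) / ln (real n)) \<longlonglongrightarrow> s^2"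
  proof (rule log_average)
    have "(\<lambda>n. (\<Sum>k<n. (y k)^2 * ((v (Suc k))^2 - \<sigma>^2)) / real n + \<sigma>^2 * ((\<Sum>k<n. (y k)^2) / real n)) \<longlonglongrightarrow> 0 + \<sigma>^2 * (var_ratio \<theta> \<rho> * \<sigma>^2)"
      by (intro tendsto_intros product_law y_square_law)
    moreover have "(\<Sum>k<n. (y k)^2 * ((v (Suc k))^2 - \<sigma>^2)) / real n + \<sigma>^2 * ((\<Sum>k<n. (y k)^2) / real n)
      = (\<Sum>k<n. (v (Suc k) * y k)^2) / real n" for n
    proof -
      have "(\<Sum>k<n. (v (Suc k) * y k)^2) = (\<Sum>k<n. (y k)^2 * ((v (Suc k))^2 - \<sigma>^2)) + \<sigma>^2 * (\<Sum>k<n. (y k)^2)"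
        by (simp add: sum_distrib_left sum.distrib[symmetric] power_mult_distrib algebra_simps)
      thus ?thesis by (simp add: add_divide_distrib)
    qed
    moreover have "\<sigma>^2 * (var_ratio \<theta> \<rho> * \<sigma>^2) = s^2"
    proof -
      have "s^2 = \<sigma>^4 * var_ratio \<theta> \<rho>" using var_ratio_pos[OF \<theta> \<rho>] by (simp add: s_def)
      thus ?thesis by (simp add: power2_eq_square power4_eq_xxxx)
    qed
    ultimately show "(\<lambda>n. (\<Sum>k<n. (v (Suc k) * y k)^2) / real n) \<longlonglongrightarrow> s^2" by simp
  qed
  have E: "(\<lambda>n. (mart n)^2 / real n / ln (real n)) \<longlonglongrightarrow> 0"
  proof (rule Lim_null_comparison)
    have "(\<lambda>n. 8 * ln (ln (real n)) / ln (real n)) \<longlonglongrightarrow> 0" by real_asymp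
    hence "(\<lambda>n. s^2 * (8 * ln (ln (real n)) / ln (real n))) \<longlonglongrightarrow> s^2 * 0" by (intro tendsto_mult tendsto_const)
    thus "(\<lambda>n. s^2 * (8 * ln (ln (real n)) / ln (real n))) \<longlonglongrightarrow> 0" by simp
    have u: "\<forall>\<^sub>F n in sequentially. \<bar>mart n\<bar> \<le> 2 * s * lil_scale n"
      using upper[of 1] by (simp add: mart_def s_def)
    have p: "\<forall>\<^sub>F n in sequentially. ln (ln (real n)) > 0" "\<forall>\<^sub>F n in sequentially. ln (real n) > 0" by real_asymp+
    show "\<forall>\<^sub>F n in sequentially. norm ((mart n)^2 / real n / ln (real n)) \<le> s^2 * (8 * ln (ln (real n)) / ln (real n))"
      using u p eventually_gt_at_top[of 0]
    proof eventually_elim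
      case (elim n)
      have "\<bar>mart n\<bar>^2 \<le> (2 * s * lil_scale n)^2" using elim(1) by (intro power_mono) auto
      also have "\<dots> = 4 * s^2 * (2 * real n * ln (ln (real n)))"
        using elim by (simp add: power_mult_distrib lil_scale_def)
      finally have "(mart n)^2 / (real n * ln (real n)) \<le> 4 * s^2 * (2 * real n * ln (ln (real n))) / (real n * ln (real n))"
        using elim by (intro divide_right_mono) auto
      also have "\<dots> = s^2 * (8 * ln (ln (real n)) / ln (real n))" using elim by simp
      finally show ?case using elim by simp
    qed
  qed
  have "(\<lambda>n. - ((mart n)^2 / real n / ln (real n)) + 2 * (T n / ln (real n))
     + (\<Sum>k<n. (v (Suc k) * y k)^2 / real (Suc k)) / ln (real n)) \<longlonglongrightarrow> - 0 + 2 * 0 + s^2"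
    by (intro tendsto_intros T D E)
  thus ?thesis unfolding parts add_divide_distrib by simp
qed

lemma quadratic_strong_law:
  "(\<lambda>n. 1 / ln (real n) * (\<Sum>k=1..n. (err k)^2)) \<longlonglongrightarrow> sigma_theta_sq \<theta> \<rho>"
proof -
  define a b where "a k = mart k / sqrt (real k * (real k + 1))" and "b k = remainder k / sqrt (real k * (real k + 1))" for k
  have "(\<lambda>k. (remainder k / sqrt (real k))^2) \<longlonglongrightarrow> 0^2" by (intro tendsto_power remainder_small)
  hence "(\<lambda>n. (\<Sum>k<n. 1 / real (Suc k) * (remainder k / sqrt (real k))^2) / ln (real n)) \<longlonglongrightarrow> 0"
    by (intro weighted_null[OF _ ln_at_top harmonic_log]) auto
  moreover have "1 / real (Suc k) * (remainder k / sqrt (real k))^2 = (b k)^2" for k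
    by (simp add: b_def power_divide mult.commute add.commute)
  ultimately have B: "(\<lambda>n. (\<Sum>k<n. (b k)^2) / ln (real n)) \<longlonglongrightarrow> 0" by simp
  have "(\<lambda>n. (\<Sum>k<n. (a k + b k)^2) / ln (real n)) \<longlonglongrightarrow> s^2"
    by (rule square_sum_perturb[OF ln_at_top _ B]) (use martingale_quadratic_law in \<open>simp add: a_def\<close>)
  moreover have "(\<lambda>k. (real k + 1) / real k * (gain k)^2) \<longlonglongrightarrow> 1 * gain_limit^2"
  proof (intro tendsto_mult tendsto_power gain_tendsto)
    show "(\<lambda>k. (real k + 1) / real k) \<longlonglongrightarrow> 1" by real_asymp
  qed
  ultimately have W: "(\<lambda>n. (\<Sum>k<n. (a k + b k)^2 * ((real k + 1) / real k * (gain k)^2)) / ln (real n)) \<longlonglongrightarrow> s^2 * (1 * gain_limit^2)"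
    by (intro weighted_limit[OF _ ln_at_top]) auto
  have ev: "\<forall>\<^sub>F k in sequentially. (err k)^2 = (a k + b k)^2 * ((real k + 1) / real k * (gain k)^2)"
    using err_eq eventually_gt_at_top[of 0]
  proof eventually_elim
    case (elim k)
    have "(a k + b k)^2 = (mart k + remainder k)^2 / (real k * (real k + 1))"
      by (simp add: a_def b_def add_divide_distrib[symmetric] power_divide)
    moreover have "u / (x * (x + 1)) * ((x + 1) / x * g) = u / x^2 * g" if "x > 0" for u x g :: real
      using that by (simp add: power2_eq_square)
    ultimately show ?case using elim by (simp add: power_mult_distrib power_divide power2_eq_square)
  qed
  have "(\<lambda>n. (\<Sum>k<n. (err k)^2) / ln (real n)) \<longlonglongrightarrow> sigma_theta_sq \<theta> \<rho>"
    using sum_over_eventually_eq[OF ev ln_at_top W] by (simp add: sigma_theta_sq_eq[symmetric] power_mult_distrib)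
  hence "(\<lambda>n. (\<Sum>k<Suc n. (err k)^2) / ln (real (Suc n))) \<longlonglongrightarrow> sigma_theta_sq \<theta> \<rho>" by (rule LIMSEQ_Suc)
  moreover have "(\<lambda>n. ln (real (Suc n)) / ln (real n)) \<longlonglongrightarrow> 1" by real_asymp
  moreover have "(\<lambda>n. (err 0)^2 / ln (real n)) \<longlonglongrightarrow> 0"
    by (rule tendsto_divide_0[OF tendsto_const filterlim_at_top_imp_at_infinity[OF ln_at_top]])
  ultimately have "(\<lambda>n. (\<Sum>k<Suc n. (err k)^2) / ln (real (Suc n)) * (ln (real (Suc n)) / ln (real n)) - (err 0)^2 / ln (real n))
      \<longlonglongrightarrow> sigma_theta_sq \<theta> \<rho> * 1 - 0" by (intro tendsto_diff tendsto_mult)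
  moreover have "\<forall>\<^sub>F n in sequentially. (\<Sum>k<Suc n. (err k)^2) / ln (real (Suc n)) * (ln (real (Suc n)) / ln (real n)) - (err 0)^2 / ln (real n)
      = 1 / ln (real n) * (\<Sum>k=1..n. (err k)^2)"
    using eventually_gt_at_top[of 0]
  proof eventually_elim
    case (elim n)
    have "{..<Suc n} = insert 0 {1..n}" by auto
    hence "(\<Sum>k<Suc n. (err k)^2) = (err 0)^2 + (\<Sum>k=1..n. (err k)^2)" by simp
    moreover have "(x + S) / l1 * (l1 / l0) - x / l0 = 1 / l0 * S" if "l1 \<noteq> 0" for x S l1 l0 :: real
    proof -
      have "(x + S) / l1 * (l1 / l0) = (x + S) / l0" using that by simp
      thus ?thesis by (simp add: add_divide_distrib)
    qed
    moreover have "ln (real (Suc n)) \<noteq> 0" using elim by simp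
    ultimately show ?case by (simp only:)
  qed
  ultimately show ?thesis by (auto intro: Lim_transform_eventually)
qed

end

section \<open>The least squares estimator\<close>

theorem theorem2p3:
  fixes M :: "'a measure"
    and V X \<epsilon> :: "nat \<Rightarrow> 'a \<Rightarrow> real"
    and \<theta> \<rho> \<sigma> :: real
  assumes "prob_space M"
    and "\<bar>\<theta>\<bar> < 1" and "\<bar>\<rho>\<bar> < 1"
    and "prob_space.indep_vars M (\<lambda>_. borel) V {1..}"
    and "\<And>n. n \<ge> 1 \<Longrightarrow> distr M borel (V n) = distr M borel (V 1)"
    and "\<And>n. n \<ge> 1 \<Longrightarrow> integrable M (\<lambda>\<omega>. V n \<omega> ^ 4)"
    and "\<And>n. n \<ge> 1 \<Longrightarrow> prob_space.expectation M (V n) = 0"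
    and "\<And>n. n \<ge> 1 \<Longrightarrow> prob_space.variance M (V n) = \<sigma>\<^sup>2"
    and "\<sigma>\<^sup>2 > 0"
    and "X 0 \<in> borel_measurable M" and "\<epsilon> 0 \<in> borel_measurable M"
    and "\<And>n \<omega>. n \<ge> 1 \<Longrightarrow> \<omega> \<in> space M \<Longrightarrow> X n \<omega> = \<theta> * X (n - 1) \<omega> + \<epsilon> n \<omega>"
    and "\<And>n \<omega>. n \<ge> 1 \<Longrightarrow> \<omega> \<in> space M \<Longrightarrow> \<epsilon> n \<omega> = \<rho> * \<epsilon> (n - 1) \<omega> + V n \<omega>"
  shows "(AE \<omega> in M. (\<lambda>n. 1 / ln (real n) * (\<Sum>k=1..n. (theta_hat X k \<omega> - theta_star \<theta> \<rho>)\<^sup>2))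
            \<longlonglongrightarrow> sigma_theta_sq \<theta> \<rho>) \<and>
         (AE \<omega> in M.
            limsup (\<lambda>n. ereal (sqrt (real n / (2 * ln (ln (real n)))) * (theta_hat X n \<omega> - theta_star \<theta> \<rho>)))
              = - liminf (\<lambda>n. ereal (sqrt (real n / (2 * ln (ln (real n)))) * (theta_hat X n \<omega> - theta_star \<theta> \<rho>)))
          \<and> - liminf (\<lambda>n. ereal (sqrt (real n / (2 * ln (ln (real n)))) * (theta_hat X n \<omega> - theta_star \<theta> \<rho>)))
              = ereal (sigma_theta \<theta> \<rho>)) \<and>
         (AE \<omega> in M.
            limsup (\<lambda>n. ereal (real n / (2 * ln (ln (real n))) * (theta_hat X n \<omega> - theta_star \<theta> \<rho>)\<^sup>2))
              = ereal (sigma_theta_sq \<theta> \<rho>))"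
proof -
  note H = assms
  interpret prob_space M by (rule H(1))
  define K where "K = expectation (\<lambda>\<omega>. V 1 \<omega> ^ 4)"
  have Vm: "V n \<in> borel_measurable M" if "n \<ge> 1" for n using H(4) that by (auto simp: indep_vars_def)
  (* The common distribution makes one constant K serve for all fourth moments. *)
  interpret ar_noise M V \<sigma> K \<theta> \<rho>
  proof
    show "indep_vars (\<lambda>_. borel) V {1..}" by (rule H(4))
    fix n :: nat assume n: "n \<ge> 1"
    show "expectation (V n) = 0" by (rule H(7)[OF n])
    show "expectation (\<lambda>\<omega>. (V n \<omega>)^2) = \<sigma>^2" using H(8)[OF n] H(7)[OF n] by simp
    show "integrable M (\<lambda>\<omega>. V n \<omega> ^ 4)" by (rule H(6)[OF n])
    have "expectation (\<lambda>\<omega>. V n \<omega> ^ 4) = integral\<^sup>L (distr M borel (V n)) (\<lambda>x. x^4)"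
      using Vm[OF n] by (subst integral_distr) auto
    also have "\<dots> = integral\<^sup>L (distr M borel (V 1)) (\<lambda>x. x^4)" by (simp only: H(5)[OF n])
    also have "\<dots> = K" using Vm[of 1] unfolding K_def by (subst integral_distr) auto
    finally show "expectation (\<lambda>\<omega>. V n \<omega> ^ 4) \<le> K" by simp
  qed (use H in auto)
  have growth: "AE \<omega> in M. (\<lambda>n. V n \<omega> / (real n + 1) powr (1/4)) \<longlonglongrightarrow> 0"
    by (rule noise_growth) (rule H(5))
  have blocks: "AE \<omega> in M. \<forall>m. (\<exists>\<^sub>F j in sequentially. 1 * block_sum ((m+2)^j) ((m+2)^j * ((m+2)-1)) \<omega>
        \<ge> (1 - 1 / (real m + 4)) * sqrt (\<sigma>^4 * var_ratio \<theta> \<rho>) * sqrt (2 * ln (real j)) * sqrt (real ((m+2)^j * ((m+2)-1))))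
      \<and> (\<exists>\<^sub>F j in sequentially. (-1) * block_sum ((m+2)^j) ((m+2)^j * ((m+2)-1)) \<omega>
        \<ge> (1 - 1 / (real m + 4)) * sqrt (\<sigma>^4 * var_ratio \<theta> \<rho>) * sqrt (2 * ln (real j)) * sqrt (real ((m+2)^j * ((m+2)-1))))"
    unfolding AE_all_countable AE_conj_iff
    by (intro allI conjI block_sums_large H(9)) auto
  have path: "AE \<omega> in M. ar_path \<theta> \<rho> \<sigma> (\<lambda>n. V n \<omega>) (\<lambda>n. Y n \<omega>) (\<lambda>n. E n \<omega>) (\<lambda>n. X n \<omega>) (\<lambda>n. \<epsilon> n \<omega>) (\<lambda>m N. block_sum m N \<omega>)"
    using growth strong_laws upper_LIL[OF H(9)] blocks AE_space
  proof eventually_elim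
    case (elim \<omega>)
    show ?case
    proof
      show "\<bar>\<theta>\<bar> < 1" "\<bar>\<rho>\<bar> < 1" "\<sigma>^2 > 0" by (rule H)+
      show "Y 0 \<omega> = 0" "E 0 \<omega> = 0" by simp_all
      show "E (Suc n) \<omega> = \<rho> * E n \<omega> + V (Suc n) \<omega>" "Y (Suc n) \<omega> = \<theta> * Y n \<omega> + E (Suc n) \<omega>" for n
        by (rule E_Suc Y_Suc)+
      show "\<epsilon> (Suc n) \<omega> = \<rho> * \<epsilon> n \<omega> + V (Suc n) \<omega>" "X (Suc n) \<omega> = \<theta> * X n \<omega> + \<epsilon> (Suc n) \<omega>" for n
        using H(12)[of "Suc n" \<omega>] H(13)[of "Suc n" \<omega>] elim by auto
      show "\<exists>y' e'. y' 0 = 0 \<and> e' 0 = 0 \<and> (\<forall>k. e' (Suc k) = \<rho> * e' k + V (m + Suc k) \<omega>) \<and>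
        (\<forall>k. y' (Suc k) = \<theta> * y' k + e' (Suc k)) \<and> block_sum m N \<omega> = (\<Sum>k<N. V (m + Suc k) \<omega> * y' k)" for m N
      proof -
        interpret S: ar_noise M "\<lambda>i. V (m + i)" \<sigma> K \<theta> \<rho> by (rule ar_noise_shift)
        show ?thesis
          by (rule exI[of _ "\<lambda>k. S.Y k \<omega>"], rule exI[of _ "\<lambda>k. S.E k \<omega>"])
             (simp add: S.E_Suc S.Y_Suc block_sum_def S.Mart_def S.D_def)
      qed
      show "(\<lambda>n. V n \<omega> / (real n + 1) powr (1/4)) \<longlonglongrightarrow> 0" by (rule elim(1))
      show "(\<lambda>n. (\<Sum>k<n. (V (Suc k) \<omega>)^2 - \<sigma>^2) / real n) \<longlonglongrightarrow> 0" by (rule elim(2))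
      show "(\<lambda>n. (\<Sum>k<n. poisson_lin \<theta> \<rho> (Y k \<omega>) (E k \<omega>) * V (Suc k) \<omega>) / real n) \<longlonglongrightarrow> 0"
        using elim(3) by (simp add: Lin_def)
      show "(\<lambda>n. (\<Sum>k<n. (Y k \<omega>)^2 * ((V (Suc k) \<omega>)^2 - \<sigma>^2)) / real n) \<longlonglongrightarrow> 0" by (rule elim(4))
      show "(\<lambda>n. (\<Sum>k<n. (\<Sum>i<k. V (Suc i) \<omega> * Y i \<omega>) * (V (Suc k) \<omega> * Y k \<omega>) / real (Suc k)) / ln (real n)) \<longlonglongrightarrow> 0"
        using elim(5) by (simp only: Mart_def D_def)
      show "\<forall>\<^sub>F n in sequentially. \<bar>\<Sum>i<n. V (Suc i) \<omega> * Y i \<omega>\<bar> \<le> (1 + \<eta>) * sqrt (\<sigma>^4 * var_ratio \<theta> \<rho>) * lil_scale n"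
        if "\<eta> > 0" for \<eta>
        using elim(6) that by (simp add: Mart_def D_def lil_scale_def)
      show "\<exists>\<^sub>F j in sequentially. \<upsilon> * block_sum ((m+2)^j) ((m+2)^j * (m+1)) \<omega>
        \<ge> (1 - 1 / (real m + 4)) * sqrt (\<sigma>^4 * var_ratio \<theta> \<rho>) * sqrt (2 * ln (real j)) * sqrt (real ((m+2)^j * (m+1)))"
        if "\<bar>\<upsilon>\<bar> = 1" for \<upsilon> :: real and m
      proof -
        have e: "m + 2 - 1 = m + 1" by simp
        note c = elim(7)[rule_format, of m, unfolded e]
        have "\<upsilon> = 1 \<or> \<upsilon> = -1" using that by (auto simp: abs_if split: if_splits)
        thus ?thesis
        proof
          assume u: "\<upsilon> = 1"
          show ?thesis unfolding u by (rule c[THEN conjunct1])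
        next
          assume u: "\<upsilon> = -1"
          show ?thesis unfolding u by (rule c[THEN conjunct2])
        qed
      qed
    qed
  qed
  have main: "AE \<omega> in M.
     (\<lambda>n. 1 / ln (real n) * (\<Sum>k=1..n. (theta_hat X k \<omega> - theta_star \<theta> \<rho>)\<^sup>2)) \<longlonglongrightarrow> sigma_theta_sq \<theta> \<rho> \<and>
     limsup (\<lambda>n. ereal (sqrt (real n / (2 * ln (ln (real n)))) * (theta_hat X n \<omega> - theta_star \<theta> \<rho>))) = ereal (sigma_theta \<theta> \<rho>) \<and>
     - liminf (\<lambda>n. ereal (sqrt (real n / (2 * ln (ln (real n)))) * (theta_hat X n \<omega> - theta_star \<theta> \<rho>))) = ereal (sigma_theta \<theta> \<rho>) \<and>
     limsup (\<lambda>n. ereal (real n / (2 * ln (ln (real n))) * (theta_hat X n \<omega> - theta_star \<theta> \<rho>)\<^sup>2)) = ereal (sigma_theta_sq \<theta> \<rho>)"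
    using path
  proof eventually_elim
    case (elim \<omega>)
    interpret ar_path \<theta> \<rho> \<sigma> "\<lambda>n. V n \<omega>" "\<lambda>n. Y n \<omega>" "\<lambda>n. E n \<omega>" "\<lambda>n. X n \<omega>" "\<lambda>n. \<epsilon> n \<omega>" "\<lambda>m N. block_sum m N \<omega>"
      by (rule elim)
    have "err n = theta_hat X n \<omega> - theta_star \<theta> \<rho>" for n
      by (simp add: err_def est_def theta_hat_def)
    thus ?case
      using quadratic_strong_law limsup_norm_err liminf_norm_err limsup_norm_err_square by (simp add: norm_err_def)
  qed
  show ?thesis
    unfolding AE_conj_iff[symmetric] using main
    by eventually_elim (elim conjE, intro conjI, simp_all only:)
qed

end
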